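(* Let $\mathcal{A}$ be a locally noetherian Grothendieck cosmos such that the unit object $I$ is finitely presented, and let $\mathcal{L}$ be a small set of invertible objects of $\mathcal{A}$ such that $\mathcal{A}$ is generated by a small set of $\mathcal{L}^{\otimes}$-filtered objects, where $\mathcal{L}^{\otimes}:=\{L^{\otimes n}\mid L\in\mathcal{L},\ n\in\mathbb{Z}\}$. Let $G:=G_{\mathcal{L}}$ be the subgroup of $\operatorname{Pic}\mathcal{A}$ generated by the isomorphism classes of objects of $\mathcal{L}$, acting on $\mathcal{A}$ via tensor product. Then: - a localizing subcategory of $\mathcal{A}$ is a tensor ideal of $\mathcal{A}$ if and only if it is $G$-closed; - a torsion class of $\mathcal{A}_{\mathrm{noeth}}$ is a tensor ideal of $\mathcal{A}_{\mathrm{noeth}}$ if and only if it is $G$-closed; - a torsion-free class of $\mathcal{A}_{\mathrm{noeth}}$ is a Hom ideal of $\mathcal{A}_{\mathrm{noeth}}$ if and only if it is $G$-closed.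
   Context: A Grothendieck cosmos is a symmetric monoidal closed category $(\mathcal{A},\otimes,I)$, with internal Hom $[-,-]$, whose underlying category is a Grothendieck category; it is locally noetherian if the underlying category is. $\mathcal{A}_{\mathrm{noeth}}$ is the full subcategory of noetherian objects; under the hypotheses it is a symmetric monoidal closed abelian category with the restricted tensor product and internal Hom. An object $L$ is invertible if $L\otimes M\cong I$ for some $M$; for $n<0$, $L^{\otimes n}$ denotes the corresponding tensor power of an inverse of $L$. $\operatorname{Pic}\mathcal{A}$ is the group of isomorphism classes of invertible objects. An object is $\mathcal{L}^{\otimes}$-filtered if it has a finite filtration by subobjects whose successive quotients are isomorphic to objects in $\mathcal{L}^{\otimes}$. Subcategories are full and closed under isomorphisms. $\mathcal{X}$ is $G$-closed if $X\otimes L\in\mathcal{X}$ for all $X\in\mathcal{X}$ and all $L$ with class in $G$. In a symmetric monoidal closed category $\mathcal{B}$, $\mathcal{X}$ is a tensor ideal (resp. Hom ideal) if $X\otimes M\in\mathcal{X}$ (resp. $[M,X]\in\mathcal{X}$) for all $X\in\mathcal{X}$, $M\in\mathcal{B}$. A localizing subcategory is an additive subcategory closed under subobjects, quotients, extensions and coproducts; a torsion class is an additive subcategory closed under quotients and extensions; a torsion-free class is an additive subcategory closed under subobjects and extensions. *)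

theory Defs
  imports Main "HOL-Algebra.Generated_Groups"
begin

unbundle cardinal_syntax

section \<open>Smallness\<close>

text \<open>
  "Small" is taken relative to a Grothendieck universe, which is recorded by its cardinal: an
  uncountable strongly inaccessible cardinal \<open>\<kappa>\<close>, given as a cardinal order on (a subset of) the
  type \<open>'u\<close>. A set, of any type, is small if it has fewer than \<open>\<kappa>\<close> elements. Every small set is in
  bijection with a small subset of \<open>'u\<close>, so families indexed by small sets (coproducts, direct
  systems) may be taken to have index sets in \<open>'u\<close>.
\<close>

definition inaccessible :: "'u rel \<Rightarrow> bool" where
  "inaccessible \<kappa> \<longleftrightarrow> Card_order \<kappa> \<and> natLeq <o \<kappa> \<and> regularCard \<kappa> \<and>
     (\<forall>S :: 'u set. |S| <o \<kappa> \<longrightarrow> |Pow S| <o \<kappa>)"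

definition small :: "'u rel \<Rightarrow> 'x set \<Rightarrow> bool" where
  "small \<kappa> S \<longleftrightarrow> |S| <o \<kappa>"


section \<open>Categories\<close>

record ('o, 'a) cat =
  Obj :: "'o set"
  Arr :: "'a set"
  Dom :: "'a \<Rightarrow> 'o"
  Cod :: "'a \<Rightarrow> 'o"
  Id  :: "'o \<Rightarrow> 'a"
  Comp :: "'a \<Rightarrow> 'a \<Rightarrow> 'a"  (infixl "\<cdot>\<index>" 70)

definition homs :: "('o, 'a, 'm) cat_scheme \<Rightarrow> 'o \<Rightarrow> 'o \<Rightarrow> 'a set" where
  "homs C x y = {f \<in> Arr C. Dom C f = x \<and> Cod C f = y}"

locale category =
  fixes C :: "('o, 'a, 'm) cat_scheme" (structure)
  assumes Dom_in_Obj: "f \<in> Arr C \<Longrightarrow> Dom C f \<in> Obj C"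
    and Cod_in_Obj: "f \<in> Arr C \<Longrightarrow> Cod C f \<in> Obj C"
    and Id_in_homs: "x \<in> Obj C \<Longrightarrow> Id C x \<in> homs C x x"
    and Comp_in_homs: "f \<in> homs C x y \<Longrightarrow> g \<in> homs C y z \<Longrightarrow> g \<cdot> f \<in> homs C x z"
    and Comp_assoc: "f \<in> homs C w x \<Longrightarrow> g \<in> homs C x y \<Longrightarrow> h \<in> homs C y z \<Longrightarrow>
      (h \<cdot> g) \<cdot> f = h \<cdot> (g \<cdot> f)"
    and Comp_Id_left: "f \<in> homs C x y \<Longrightarrow> Id C y \<cdot> f = f"
    and Comp_Id_right: "f \<in> homs C x y \<Longrightarrow> f \<cdot> Id C x = f"

definition full_subcategory :: "('o, 'a, 'm) cat_scheme \<Rightarrow> 'o set \<Rightarrow> ('o, 'a, 'm) cat_scheme" where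
  "full_subcategory C P = C\<lparr>Obj := P, Arr := {f \<in> Arr C. Dom C f \<in> P \<and> Cod C f \<in> P}\<rparr>"

definition is_iso :: "('o, 'a, 'm) cat_scheme \<Rightarrow> 'a \<Rightarrow> bool" where
  "is_iso C f \<longleftrightarrow> f \<in> Arr C \<and> (\<exists>g \<in> homs C (Cod C f) (Dom C f).
     g \<cdot>\<^bsub>C\<^esub> f = Id C (Dom C f) \<and> f \<cdot>\<^bsub>C\<^esub> g = Id C (Cod C f))"

definition isomorphic :: "('o, 'a, 'm) cat_scheme \<Rightarrow> 'o \<Rightarrow> 'o \<Rightarrow> bool" where
  "isomorphic C x y \<longleftrightarrow> (\<exists>f \<in> homs C x y. is_iso C f)"

definition mono_arr :: "('o, 'a, 'm) cat_scheme \<Rightarrow> 'a \<Rightarrow> bool" where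
  "mono_arr C f \<longleftrightarrow> f \<in> Arr C \<and>
     (\<forall>w. \<forall>g \<in> homs C w (Dom C f). \<forall>h \<in> homs C w (Dom C f). f \<cdot>\<^bsub>C\<^esub> g = f \<cdot>\<^bsub>C\<^esub> h \<longrightarrow> g = h)"

definition epi_arr :: "('o, 'a, 'm) cat_scheme \<Rightarrow> 'a \<Rightarrow> bool" where
  "epi_arr C f \<longleftrightarrow> f \<in> Arr C \<and>
     (\<forall>w. \<forall>g \<in> homs C (Cod C f) w. \<forall>h \<in> homs C (Cod C f) w. g \<cdot>\<^bsub>C\<^esub> f = h \<cdot>\<^bsub>C\<^esub> f \<longrightarrow> g = h)"

definition is_zero :: "('o, 'a, 'm) cat_scheme \<Rightarrow> 'o \<Rightarrow> bool" where
  "is_zero C z \<longleftrightarrow> z \<in> Obj C \<and>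
     (\<forall>x \<in> Obj C. (\<exists>!f. f \<in> homs C z x) \<and> (\<exists>!f. f \<in> homs C x z))"

definition zero_arr :: "('o, 'a, 'm) cat_scheme \<Rightarrow> 'a \<Rightarrow> bool" where
  "zero_arr C f \<longleftrightarrow> (\<exists>z. is_zero C z \<and>
     (\<exists>g \<in> homs C (Dom C f) z. \<exists>h \<in> homs C z (Cod C f). f = h \<cdot>\<^bsub>C\<^esub> g))"

definition is_kernel :: "('o, 'a, 'm) cat_scheme \<Rightarrow> 'a \<Rightarrow> 'a \<Rightarrow> bool" where
  "is_kernel C k f \<longleftrightarrow> k \<in> Arr C \<and> f \<in> Arr C \<and> Cod C k = Dom C f \<and> zero_arr C (f \<cdot>\<^bsub>C\<^esub> k) \<and>
     (\<forall>w. \<forall>g \<in> homs C w (Dom C f). zero_arr C (f \<cdot>\<^bsub>C\<^esub> g) \<longrightarrow>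
        (\<exists>!h. h \<in> homs C w (Dom C k) \<and> k \<cdot>\<^bsub>C\<^esub> h = g))"

definition is_cokernel :: "('o, 'a, 'm) cat_scheme \<Rightarrow> 'a \<Rightarrow> 'a \<Rightarrow> bool" where
  "is_cokernel C q f \<longleftrightarrow> q \<in> Arr C \<and> f \<in> Arr C \<and> Dom C q = Cod C f \<and> zero_arr C (q \<cdot>\<^bsub>C\<^esub> f) \<and>
     (\<forall>w. \<forall>g \<in> homs C (Cod C f) w. zero_arr C (g \<cdot>\<^bsub>C\<^esub> f) \<longrightarrow>
        (\<exists>!h. h \<in> homs C (Cod C q) w \<and> h \<cdot>\<^bsub>C\<^esub> q = g))"

definition short_exact :: "('o, 'a, 'm) cat_scheme \<Rightarrow> 'a \<Rightarrow> 'a \<Rightarrow> bool" where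
  "short_exact C f g \<longleftrightarrow> is_kernel C f g \<and> is_cokernel C g f"

definition is_coproduct ::
  "('o, 'a, 'm) cat_scheme \<Rightarrow> 'i set \<Rightarrow> ('i \<Rightarrow> 'o) \<Rightarrow> 'o \<Rightarrow> ('i \<Rightarrow> 'a) \<Rightarrow> bool" where
  "is_coproduct C I X c \<iota> \<longleftrightarrow> c \<in> Obj C \<and> (\<forall>i \<in> I. X i \<in> Obj C \<and> \<iota> i \<in> homs C (X i) c) \<and>
     (\<forall>d \<in> Obj C. \<forall>g. (\<forall>i \<in> I. g i \<in> homs C (X i) d) \<longrightarrow>
        (\<exists>!h. h \<in> homs C c d \<and> (\<forall>i \<in> I. h \<cdot>\<^bsub>C\<^esub> \<iota> i = g i)))"


section \<open>Abelian and Grothendieck categories\<close>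

definition preadditive :: "('o, 'a, 'm) cat_scheme \<Rightarrow> bool" where
  "preadditive C \<longleftrightarrow> category C \<and> (\<exists>add zer.
     (\<forall>x \<in> Obj C. \<forall>y \<in> Obj C.
        comm_group \<lparr>carrier = homs C x y, monoid.mult = add, one = zer x y\<rparr>) \<and>
     (\<forall>x y z. \<forall>f \<in> homs C x y. \<forall>f' \<in> homs C x y. \<forall>g \<in> homs C y z. \<forall>g' \<in> homs C y z.
        g \<cdot>\<^bsub>C\<^esub> add f f' = add (g \<cdot>\<^bsub>C\<^esub> f) (g \<cdot>\<^bsub>C\<^esub> f') \<and>
        add g g' \<cdot>\<^bsub>C\<^esub> f = add (g \<cdot>\<^bsub>C\<^esub> f) (g' \<cdot>\<^bsub>C\<^esub> f)))"

text \<open>In a preadditive category, binary coproducts are automatically biproducts.\<close>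

definition additive :: "('o, 'a, 'm) cat_scheme \<Rightarrow> bool" where
  "additive C \<longleftrightarrow> preadditive C \<and> (\<exists>z. is_zero C z) \<and>
     (\<forall>X :: bool \<Rightarrow> 'o. range X \<subseteq> Obj C \<longrightarrow> (\<exists>c \<iota>. is_coproduct C UNIV X c \<iota>))"

definition abelian :: "('o, 'a, 'm) cat_scheme \<Rightarrow> bool" where
  "abelian C \<longleftrightarrow> additive C \<and>
     (\<forall>f \<in> Arr C. (\<exists>k. is_kernel C k f) \<and> (\<exists>q. is_cokernel C q f)) \<and>
     (\<forall>m. mono_arr C m \<longrightarrow> (\<exists>f. is_kernel C m f)) \<and>
     (\<forall>e. epi_arr C e \<longrightarrow> (\<exists>f. is_cokernel C e f))"

definition locally_small :: "'u rel \<Rightarrow> ('o, 'a, 'm) cat_scheme \<Rightarrow> bool" where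
  "locally_small \<kappa> C \<longleftrightarrow> (\<forall>x \<in> Obj C. \<forall>y \<in> Obj C. small \<kappa> (homs C x y))"

definition has_small_coproducts :: "'u rel \<Rightarrow> ('o, 'a, 'm) cat_scheme \<Rightarrow> bool" where
  "has_small_coproducts \<kappa> C \<longleftrightarrow>
     (\<forall>(I :: 'u set) X. small \<kappa> I \<and> X ` I \<subseteq> Obj C \<longrightarrow> (\<exists>c \<iota>. is_coproduct C I X c \<iota>))"

definition directed_set :: "'i set \<Rightarrow> ('i \<Rightarrow> 'i \<Rightarrow> bool) \<Rightarrow> bool" where
  "directed_set I leq \<longleftrightarrow> I \<noteq> {} \<and> (\<forall>i \<in> I. leq i i) \<and>
     (\<forall>i \<in> I. \<forall>j \<in> I. \<forall>k \<in> I. leq i j \<and> leq j k \<longrightarrow> leq i k) \<and>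
     (\<forall>i \<in> I. \<forall>j \<in> I. \<exists>k \<in> I. leq i k \<and> leq j k)"

definition direct_system ::
  "('o, 'a, 'm) cat_scheme \<Rightarrow> 'i set \<Rightarrow> ('i \<Rightarrow> 'i \<Rightarrow> bool) \<Rightarrow> ('i \<Rightarrow> 'o) \<Rightarrow> ('i \<Rightarrow> 'i \<Rightarrow> 'a) \<Rightarrow> bool"
where
  "direct_system C I leq D \<phi> \<longleftrightarrow> directed_set I leq \<and>
     (\<forall>i \<in> I. D i \<in> Obj C \<and> \<phi> i i = Id C (D i)) \<and>
     (\<forall>i \<in> I. \<forall>j \<in> I. leq i j \<longrightarrow> \<phi> i j \<in> homs C (D i) (D j)) \<and>
     (\<forall>i \<in> I. \<forall>j \<in> I. \<forall>k \<in> I. leq i j \<and> leq j k \<longrightarrow> \<phi> j k \<cdot>\<^bsub>C\<^esub> \<phi> i j = \<phi> i k)"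

definition is_direct_limit ::
  "('o, 'a, 'm) cat_scheme \<Rightarrow> 'i set \<Rightarrow> ('i \<Rightarrow> 'i \<Rightarrow> bool) \<Rightarrow> ('i \<Rightarrow> 'o) \<Rightarrow> ('i \<Rightarrow> 'i \<Rightarrow> 'a) \<Rightarrow>
     'o \<Rightarrow> ('i \<Rightarrow> 'a) \<Rightarrow> bool"
where
  "is_direct_limit C I leq D \<phi> c \<iota> \<longleftrightarrow> direct_system C I leq D \<phi> \<and> c \<in> Obj C \<and>
     (\<forall>i \<in> I. \<iota> i \<in> homs C (D i) c) \<and>
     (\<forall>i \<in> I. \<forall>j \<in> I. leq i j \<longrightarrow> \<iota> j \<cdot>\<^bsub>C\<^esub> \<phi> i j = \<iota> i) \<and>
     (\<forall>d \<in> Obj C. \<forall>g. (\<forall>i \<in> I. g i \<in> homs C (D i) d) \<and>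
           (\<forall>i \<in> I. \<forall>j \<in> I. leq i j \<longrightarrow> g j \<cdot>\<^bsub>C\<^esub> \<phi> i j = g i) \<longrightarrow>
        (\<exists>!h. h \<in> homs C c d \<and> (\<forall>i \<in> I. h \<cdot>\<^bsub>C\<^esub> \<iota> i = g i)))"

definition exact_direct_limits :: "'u rel \<Rightarrow> ('o, 'a, 'm) cat_scheme \<Rightarrow> bool" where
  "exact_direct_limits \<kappa> C \<longleftrightarrow>
     (\<forall>(I :: 'u set) leq X \<phi> x \<iota> Y \<psi> y \<upsilon> Z \<chi> z \<zeta> \<alpha> \<beta> f g.
        small \<kappa> I \<and>
        is_direct_limit C I leq X \<phi> x \<iota> \<and> is_direct_limit C I leq Y \<psi> y \<upsilon> \<and>
        is_direct_limit C I leq Z \<chi> z \<zeta> \<and>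
        (\<forall>i \<in> I. \<alpha> i \<in> homs C (X i) (Y i) \<and> \<beta> i \<in> homs C (Y i) (Z i) \<and>
           short_exact C (\<alpha> i) (\<beta> i)) \<and>
        (\<forall>i \<in> I. \<forall>j \<in> I. leq i j \<longrightarrow>
           \<alpha> j \<cdot>\<^bsub>C\<^esub> \<phi> i j = \<psi> i j \<cdot>\<^bsub>C\<^esub> \<alpha> i \<and> \<beta> j \<cdot>\<^bsub>C\<^esub> \<psi> i j = \<chi> i j \<cdot>\<^bsub>C\<^esub> \<beta> i) \<and>
        f \<in> homs C x y \<and> (\<forall>i \<in> I. f \<cdot>\<^bsub>C\<^esub> \<iota> i = \<upsilon> i \<cdot>\<^bsub>C\<^esub> \<alpha> i) \<and>
        g \<in> homs C y z \<and> (\<forall>i \<in> I. g \<cdot>\<^bsub>C\<^esub> \<upsilon> i = \<zeta> i \<cdot>\<^bsub>C\<^esub> \<beta> i)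
        \<longrightarrow> short_exact C f g)"

definition generating :: "('o, 'a, 'm) cat_scheme \<Rightarrow> 'o set \<Rightarrow> bool" where
  "generating C S \<longleftrightarrow> S \<subseteq> Obj C \<and>
     (\<forall>x y. \<forall>f \<in> homs C x y. \<forall>g \<in> homs C x y.
        (\<forall>s \<in> S. \<forall>h \<in> homs C s x. f \<cdot>\<^bsub>C\<^esub> h = g \<cdot>\<^bsub>C\<^esub> h) \<longrightarrow> f = g)"

definition grothendieck_category :: "'u rel \<Rightarrow> ('o, 'a, 'm) cat_scheme \<Rightarrow> bool" where
  "grothendieck_category \<kappa> C \<longleftrightarrow> abelian C \<and> locally_small \<kappa> C \<and> has_small_coproducts \<kappa> C \<and>
     exact_direct_limits \<kappa> C \<and> (\<exists>s. generating C {s})"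

text \<open>
  Subobjects of \<open>x\<close> are represented by monomorphisms into \<open>x\<close>, preordered by factorization; they
  represent the same subobject if they factor through each other.
\<close>

definition sub_le :: "('o, 'a, 'm) cat_scheme \<Rightarrow> 'a \<Rightarrow> 'a \<Rightarrow> bool" where
  "sub_le C m n \<longleftrightarrow> (\<exists>h \<in> homs C (Dom C m) (Dom C n). n \<cdot>\<^bsub>C\<^esub> h = m)"

definition noetherian_object :: "('o, 'a, 'm) cat_scheme \<Rightarrow> 'o \<Rightarrow> bool" where
  "noetherian_object C x \<longleftrightarrow> x \<in> Obj C \<and>
     (\<forall>m :: nat \<Rightarrow> 'a. (\<forall>n. mono_arr C (m n) \<and> Cod C (m n) = x \<and> sub_le C (m n) (m (Suc n))) \<longrightarrow>
        (\<exists>N. \<forall>n \<ge> N. sub_le C (m n) (m N)))"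

definition locally_noetherian :: "'u rel \<Rightarrow> ('o, 'a, 'm) cat_scheme \<Rightarrow> bool" where
  "locally_noetherian \<kappa> C \<longleftrightarrow>
     (\<exists>S. small \<kappa> S \<and> (\<forall>s \<in> S. noetherian_object C s) \<and> generating C S)"

definition noeth :: "('o, 'a, 'm) cat_scheme \<Rightarrow> ('o, 'a, 'm) cat_scheme" where
  "noeth C = full_subcategory C {x. noetherian_object C x}"

text \<open>
  \<open>Hom(x, -)\<close> preserves direct limits: the canonical map from the direct limit of the sets
  \<open>Hom(x, D i)\<close> to \<open>Hom(x, c)\<close> is surjective and injective.
\<close>

definition finitely_presented :: "'u rel \<Rightarrow> ('o, 'a, 'm) cat_scheme \<Rightarrow> 'o \<Rightarrow> bool" where
  "finitely_presented \<kappa> C x \<longleftrightarrow> x \<in> Obj C \<and>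
     (\<forall>(I :: 'u set) leq D \<phi> c \<iota>. small \<kappa> I \<and> is_direct_limit C I leq D \<phi> c \<iota> \<longrightarrow>
        (\<forall>f \<in> homs C x c. \<exists>i \<in> I. \<exists>g \<in> homs C x (D i). f = \<iota> i \<cdot>\<^bsub>C\<^esub> g) \<and>
        (\<forall>i \<in> I. \<forall>j \<in> I. \<forall>g \<in> homs C x (D i). \<forall>h \<in> homs C x (D j).
           \<iota> i \<cdot>\<^bsub>C\<^esub> g = \<iota> j \<cdot>\<^bsub>C\<^esub> h \<longrightarrow>
           (\<exists>k \<in> I. leq i k \<and> leq j k \<and> \<phi> i k \<cdot>\<^bsub>C\<^esub> g = \<phi> j k \<cdot>\<^bsub>C\<^esub> h)))"


section \<open>Subcategories\<close>

text \<open>Full subcategories are given by their sets of objects.\<close>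

definition additive_subcategory :: "('o, 'a, 'm) cat_scheme \<Rightarrow> 'o set \<Rightarrow> bool" where
  "additive_subcategory C X \<longleftrightarrow> X \<subseteq> Obj C \<and>
     (\<forall>x \<in> X. \<forall>y \<in> Obj C. isomorphic C x y \<longrightarrow> y \<in> X) \<and>
     (\<exists>z \<in> X. is_zero C z) \<and>
     (\<forall>(Y :: bool \<Rightarrow> 'o) c \<iota>. range Y \<subseteq> X \<and> is_coproduct C UNIV Y c \<iota> \<longrightarrow> c \<in> X)"

definition closed_under_subobjects :: "('o, 'a, 'm) cat_scheme \<Rightarrow> 'o set \<Rightarrow> bool" where
  "closed_under_subobjects C X \<longleftrightarrow> (\<forall>m. mono_arr C m \<and> Cod C m \<in> X \<longrightarrow> Dom C m \<in> X)"

definition closed_under_quotients :: "('o, 'a, 'm) cat_scheme \<Rightarrow> 'o set \<Rightarrow> bool" where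
  "closed_under_quotients C X \<longleftrightarrow> (\<forall>e. epi_arr C e \<and> Dom C e \<in> X \<longrightarrow> Cod C e \<in> X)"

definition closed_under_extensions :: "('o, 'a, 'm) cat_scheme \<Rightarrow> 'o set \<Rightarrow> bool" where
  "closed_under_extensions C X \<longleftrightarrow>
     (\<forall>f g. short_exact C f g \<and> Dom C f \<in> X \<and> Cod C g \<in> X \<longrightarrow> Cod C f \<in> X)"

definition closed_under_coproducts :: "'u rel \<Rightarrow> ('o, 'a, 'm) cat_scheme \<Rightarrow> 'o set \<Rightarrow> bool" where
  "closed_under_coproducts \<kappa> C X \<longleftrightarrow>
     (\<forall>(I :: 'u set) Y c \<iota>. small \<kappa> I \<and> Y ` I \<subseteq> X \<and> is_coproduct C I Y c \<iota> \<longrightarrow> c \<in> X)"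

definition localizing_subcategory :: "'u rel \<Rightarrow> ('o, 'a, 'm) cat_scheme \<Rightarrow> 'o set \<Rightarrow> bool" where
  "localizing_subcategory \<kappa> C X \<longleftrightarrow> additive_subcategory C X \<and> closed_under_subobjects C X \<and>
     closed_under_quotients C X \<and> closed_under_extensions C X \<and> closed_under_coproducts \<kappa> C X"

definition torsion_class :: "('o, 'a, 'm) cat_scheme \<Rightarrow> 'o set \<Rightarrow> bool" where
  "torsion_class C X \<longleftrightarrow>
     additive_subcategory C X \<and> closed_under_quotients C X \<and> closed_under_extensions C X"

definition torsion_free_class :: "('o, 'a, 'm) cat_scheme \<Rightarrow> 'o set \<Rightarrow> bool" where
  "torsion_free_class C X \<longleftrightarrow>
     additive_subcategory C X \<and> closed_under_subobjects C X \<and> closed_under_extensions C X"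

text \<open>
  \<open>m 0, \<dots>, m n\<close> are the inclusions into \<open>x\<close> of the steps of the filtration
  \<open>0 = F\<^sub>0 \<subseteq> \<dots> \<subseteq> F\<^sub>n = x\<close>.
\<close>

definition filtered_object :: "('o, 'a, 'm) cat_scheme \<Rightarrow> 'o set \<Rightarrow> 'o \<Rightarrow> bool" where
  "filtered_object C S x \<longleftrightarrow> x \<in> Obj C \<and>
     (\<exists>(n :: nat) m. (\<forall>k \<le> n. mono_arr C (m k) \<and> Cod C (m k) = x) \<and>
        is_zero C (Dom C (m 0)) \<and> is_iso C (m n) \<and>
        (\<forall>k < n. \<exists>j q. j \<in> homs C (Dom C (m k)) (Dom C (m (Suc k))) \<and> m (Suc k) \<cdot>\<^bsub>C\<^esub> j = m k \<and>
           short_exact C j q \<and> (\<exists>s \<in> S. isomorphic C (Cod C q) s)))"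


section \<open>Symmetric monoidal closed categories\<close>

text \<open>
  \<open>TensA\<close> is the tensor product of morphisms; the associator \<open>Assoc x y z\<close> goes from
  \<open>(x \<otimes> y) \<otimes> z\<close> to \<open>x \<otimes> (y \<otimes> z)\<close>. \<open>IHom m x\<close> is \<open>[m, x]\<close>, with evaluation
  \<open>Ev m x : [m, x] \<otimes> m \<rightarrow> x\<close>.
\<close>

record ('o, 'a) smc_cat = "('o, 'a) cat" +
  Tens :: "'o \<Rightarrow> 'o \<Rightarrow> 'o"  (infixl "\<boxtimes>\<index>" 75)
  TensA :: "'a \<Rightarrow> 'a \<Rightarrow> 'a"  (infixl "\<boxdot>\<index>" 75)
  Unit :: "'o"
  Assoc :: "'o \<Rightarrow> 'o \<Rightarrow> 'o \<Rightarrow> 'a"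
  LUnit :: "'o \<Rightarrow> 'a"
  RUnit :: "'o \<Rightarrow> 'a"
  Swap :: "'o \<Rightarrow> 'o \<Rightarrow> 'a"
  IHom :: "'o \<Rightarrow> 'o \<Rightarrow> 'o"
  Ev :: "'o \<Rightarrow> 'o \<Rightarrow> 'a"

locale symmetric_monoidal_closed = category A for A :: "('o, 'a, 'm) smc_cat_scheme" (structure) +
  assumes Tens_in_Obj: "x \<in> Obj A \<Longrightarrow> y \<in> Obj A \<Longrightarrow> x \<boxtimes> y \<in> Obj A"
    and TensA_in_homs: "f \<in> homs A x x' \<Longrightarrow> g \<in> homs A y y' \<Longrightarrow> f \<boxdot> g \<in> homs A (x \<boxtimes> y) (x' \<boxtimes> y')"
    and TensA_Id: "x \<in> Obj A \<Longrightarrow> y \<in> Obj A \<Longrightarrow> Id A x \<boxdot> Id A y = Id A (x \<boxtimes> y)"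
    and TensA_Comp: "f \<in> homs A x x' \<Longrightarrow> f' \<in> homs A x' x'' \<Longrightarrow>
      g \<in> homs A y y' \<Longrightarrow> g' \<in> homs A y' y'' \<Longrightarrow>
      (f' \<cdot> f) \<boxdot> (g' \<cdot> g) = (f' \<boxdot> g') \<cdot> (f \<boxdot> g)"
    and Unit_in_Obj: "Unit A \<in> Obj A"
    and Assoc_in_homs: "x \<in> Obj A \<Longrightarrow> y \<in> Obj A \<Longrightarrow> z \<in> Obj A \<Longrightarrow>
      Assoc A x y z \<in> homs A ((x \<boxtimes> y) \<boxtimes> z) (x \<boxtimes> (y \<boxtimes> z)) \<and> is_iso A (Assoc A x y z)"
    and Assoc_natural: "f \<in> homs A x x' \<Longrightarrow> g \<in> homs A y y' \<Longrightarrow> h \<in> homs A z z' \<Longrightarrow>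
      Assoc A x' y' z' \<cdot> ((f \<boxdot> g) \<boxdot> h) = (f \<boxdot> (g \<boxdot> h)) \<cdot> Assoc A x y z"
    and LUnit_in_homs: "x \<in> Obj A \<Longrightarrow>
      LUnit A x \<in> homs A (Unit A \<boxtimes> x) x \<and> is_iso A (LUnit A x)"
    and LUnit_natural: "f \<in> homs A x x' \<Longrightarrow>
      LUnit A x' \<cdot> (Id A (Unit A) \<boxdot> f) = f \<cdot> LUnit A x"
    and RUnit_in_homs: "x \<in> Obj A \<Longrightarrow>
      RUnit A x \<in> homs A (x \<boxtimes> Unit A) x \<and> is_iso A (RUnit A x)"
    and RUnit_natural: "f \<in> homs A x x' \<Longrightarrow>
      RUnit A x' \<cdot> (f \<boxdot> Id A (Unit A)) = f \<cdot> RUnit A x"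
    and Swap_in_homs: "x \<in> Obj A \<Longrightarrow> y \<in> Obj A \<Longrightarrow> Swap A x y \<in> homs A (x \<boxtimes> y) (y \<boxtimes> x)"
    and Swap_natural: "f \<in> homs A x x' \<Longrightarrow> g \<in> homs A y y' \<Longrightarrow>
      Swap A x' y' \<cdot> (f \<boxdot> g) = (g \<boxdot> f) \<cdot> Swap A x y"
    and Swap_Swap: "x \<in> Obj A \<Longrightarrow> y \<in> Obj A \<Longrightarrow> Swap A y x \<cdot> Swap A x y = Id A (x \<boxtimes> y)"
    and pentagon: "w \<in> Obj A \<Longrightarrow> x \<in> Obj A \<Longrightarrow> y \<in> Obj A \<Longrightarrow> z \<in> Obj A \<Longrightarrow>
      Assoc A w x (y \<boxtimes> z) \<cdot> Assoc A (w \<boxtimes> x) y z =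
      (Id A w \<boxdot> Assoc A x y z) \<cdot> Assoc A w (x \<boxtimes> y) z \<cdot> (Assoc A w x y \<boxdot> Id A z)"
    and triangle: "x \<in> Obj A \<Longrightarrow> y \<in> Obj A \<Longrightarrow>
      (Id A x \<boxdot> LUnit A y) \<cdot> Assoc A x (Unit A) y = RUnit A x \<boxdot> Id A y"
    and hexagon: "x \<in> Obj A \<Longrightarrow> y \<in> Obj A \<Longrightarrow> z \<in> Obj A \<Longrightarrow>
      Assoc A y z x \<cdot> Swap A x (y \<boxtimes> z) \<cdot> Assoc A x y z =
      (Id A y \<boxdot> Swap A x z) \<cdot> Assoc A y x z \<cdot> (Swap A x y \<boxdot> Id A z)"
    and IHom_in_Obj: "m \<in> Obj A \<Longrightarrow> x \<in> Obj A \<Longrightarrow> IHom A m x \<in> Obj A"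
    and Ev_in_homs: "m \<in> Obj A \<Longrightarrow> x \<in> Obj A \<Longrightarrow> Ev A m x \<in> homs A (IHom A m x \<boxtimes> m) x"
    and Ev_universal: "m \<in> Obj A \<Longrightarrow> x \<in> Obj A \<Longrightarrow> z \<in> Obj A \<Longrightarrow> f \<in> homs A (z \<boxtimes> m) x \<Longrightarrow>
      \<exists>!g. g \<in> homs A z (IHom A m x) \<and> Ev A m x \<cdot> (g \<boxdot> Id A m) = f"

definition grothendieck_cosmos :: "'u rel \<Rightarrow> ('o, 'a, 'm) smc_cat_scheme \<Rightarrow> bool" where
  "grothendieck_cosmos \<kappa> A \<longleftrightarrow> symmetric_monoidal_closed A \<and> grothendieck_category \<kappa> A"

text \<open>
  Since \<open>full_subcategory\<close> only changes objects and morphisms, these two notions, applied to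
  \<open>noeth A\<close>, refer to the restrictions of the tensor product and the internal Hom of \<open>A\<close>.
\<close>

definition tensor_ideal :: "('o, 'a, 'm) smc_cat_scheme \<Rightarrow> 'o set \<Rightarrow> bool" where
  "tensor_ideal B X \<longleftrightarrow> (\<forall>x \<in> X. \<forall>m \<in> Obj B. x \<boxtimes>\<^bsub>B\<^esub> m \<in> X)"

definition Hom_ideal :: "('o, 'a, 'm) smc_cat_scheme \<Rightarrow> 'o set \<Rightarrow> bool" where
  "Hom_ideal B X \<longleftrightarrow> (\<forall>x \<in> X. \<forall>m \<in> Obj B. IHom B m x \<in> X)"


section \<open>Invertible objects\<close>

definition is_inverse :: "('o, 'a, 'm) smc_cat_scheme \<Rightarrow> 'o \<Rightarrow> 'o \<Rightarrow> bool" where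
  "is_inverse A l m \<longleftrightarrow> l \<in> Obj A \<and> m \<in> Obj A \<and> isomorphic A (l \<boxtimes>\<^bsub>A\<^esub> m) (Unit A)"

definition invertible :: "('o, 'a, 'm) smc_cat_scheme \<Rightarrow> 'o \<Rightarrow> bool" where
  "invertible A l \<longleftrightarrow> (\<exists>m. is_inverse A l m)"

primrec tensor_power :: "('o, 'a, 'm) smc_cat_scheme \<Rightarrow> 'o \<Rightarrow> nat \<Rightarrow> 'o" where
  "tensor_power A l 0 = Unit A"
| "tensor_power A l (Suc n) = tensor_power A l n \<boxtimes>\<^bsub>A\<^esub> l"

text \<open>Inverses are unique up to isomorphism, so the choice made here is immaterial.\<close>

definition tensor_zpower :: "('o, 'a, 'm) smc_cat_scheme \<Rightarrow> 'o \<Rightarrow> int \<Rightarrow> 'o" where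
  "tensor_zpower A l n =
     (if n \<ge> 0 then tensor_power A l (nat n)
      else tensor_power A (SOME m. is_inverse A l m) (nat (- n)))"

definition tensor_powers :: "('o, 'a, 'm) smc_cat_scheme \<Rightarrow> 'o set \<Rightarrow> 'o set" where
  "tensor_powers A L = {tensor_zpower A l n | l n. l \<in> L}"

definition iso_class :: "('o, 'a, 'm) cat_scheme \<Rightarrow> 'o \<Rightarrow> 'o set" where
  "iso_class A x = {y \<in> Obj A. isomorphic A x y}"

definition Pic :: "('o, 'a, 'm) smc_cat_scheme \<Rightarrow> 'o set monoid" where
  "Pic A = \<lparr>carrier = {iso_class A l | l. invertible A l},
            monoid.mult = (\<lambda>c d. \<Union>l \<in> c. \<Union>m \<in> d. iso_class A (l \<boxtimes>\<^bsub>A\<^esub> m)),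
            one = iso_class A (Unit A)\<rparr>"

definition Pic_subgroup :: "('o, 'a, 'm) smc_cat_scheme \<Rightarrow> 'o set \<Rightarrow> 'o set set" where
  "Pic_subgroup A L = generate (Pic A) (iso_class A ` L)"

definition G_closed :: "('o, 'a, 'm) smc_cat_scheme \<Rightarrow> 'o set set \<Rightarrow> 'o set \<Rightarrow> bool" where
  "G_closed A G X \<longleftrightarrow> (\<forall>x \<in> X. \<forall>l \<in> Obj A. iso_class A l \<in> G \<longrightarrow> x \<boxtimes>\<^bsub>A\<^esub> l \<in> X)"

end

theory Submission
  imports Defs
begin

text \<open>
  Every \<open>M\<close> in \<open>\<A>\<close> for which \<open>M \<otimes> X\<close> has to be controlled is built from \<open>\<L>\<^sup>\<otimes>\<close> by extensions,
  quotients and, in the localizing case, coproducts. Since \<open>- \<otimes> X\<close> is a left adjoint, it is right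
  exact and preserves coproducts, so the objects \<open>M\<close> with \<open>M \<otimes> X \<in> \<X>\<close> are closed under the same
  operations, and \<open>G\<close>-closedness says that they contain \<open>\<L>\<^sup>\<otimes>\<close>. Dually, \<open>[-, X]\<close> turns cokernels
  into kernels and \<open>[L, X] \<cong> X \<otimes> L\<^sup>-\<^sup>1\<close> for invertible \<open>L\<close>. A noetherian \<open>M\<close> is reached without
  coproducts: a subobject of \<open>M\<close> that is maximal among those with the required property is \<open>M\<close>, because
  adding the image of a morphism from a generator preserves the property. For the converse implications,
  \<open>I\<close> is noetherian: it is finitely presented and the direct limit of its quotients by the images of
  finitely many morphisms from noetherian generators is zero. Hence all invertible objects are noetherian.
\<close>

section \<open>Categories, duality and normal categories\<close>

text \<open>The ideal conditions over \<open>noeth A\<close> test noetherian objects only, while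
  \<open>G_closed\<close> tests every object whose class lies in \<open>G\<close>. This is why the
  unit, and through it every such object, has to be noetherian. For the unit, a zero limit of
  quotients forces one of these quotients to vanish already, so \<open>I\<close> is a sum of
  finitely many images of noetherian objects.

  Tensoring does not preserve short exact sequences. Closure under quotients compensates: the left
  term, which may fail to inject, is replaced by its image. Closure under subobjects does the same
  for the contravariant internal Hom. The two cases are one argument read in a category and in its
  opposite, hence the self-dual axioms.

  Torsion and torsion-free classes are given in \<open>noeth A\<close>, but exactness of tensoring
  is proved in \<open>A\<close>. Since noetherian objects are closed under subobjects, quotients and
  extensions, closure relative to \<open>noeth A\<close> carries over to \<open>A\<close>. Infinite
  coproducts of generators in general leave \<open>noeth A\<close>, whence the argument by maximal
  subobjects.\<close>

lemma hom_iff: "f \<in> homs C x y \<longleftrightarrow> f \<in> Arr C \<and> Dom C f = x \<and> Cod C f = y"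
  by (auto simp: homs_def)

context category
begin

lemma Id_Arr [simp]: "x \<in> Obj C \<Longrightarrow> Id C x \<in> Arr C"
  and Dom_Id [simp]: "x \<in> Obj C \<Longrightarrow> Dom C (Id C x) = x"
  and Cod_Id [simp]: "x \<in> Obj C \<Longrightarrow> Cod C (Id C x) = x"
  using Id_in_homs[of x] by (auto simp: hom_iff)

lemma Comp_Arr [simp]: "f \<in> Arr C \<Longrightarrow> g \<in> Arr C \<Longrightarrow> Cod C f = Dom C g \<Longrightarrow> g \<cdot> f \<in> Arr C"
  and Dom_Comp [simp]: "f \<in> Arr C \<Longrightarrow> g \<in> Arr C \<Longrightarrow> Cod C f = Dom C g \<Longrightarrow> Dom C (g \<cdot> f) = Dom C f"
  and Cod_Comp [simp]: "f \<in> Arr C \<Longrightarrow> g \<in> Arr C \<Longrightarrow> Cod C f = Dom C g \<Longrightarrow> Cod C (g \<cdot> f) = Cod C g"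
  using Comp_in_homs[of f "Dom C f" "Cod C f" g "Cod C g"] by (auto simp: hom_iff)

lemma Dom_Obj [simp]: "f \<in> Arr C \<Longrightarrow> Dom C f \<in> Obj C"
  and Cod_Obj [simp]: "f \<in> Arr C \<Longrightarrow> Cod C f \<in> Obj C"
  by (auto intro: Dom_in_Obj Cod_in_Obj)

lemma assoc [simp]:
  "f \<in> Arr C \<Longrightarrow> g \<in> Arr C \<Longrightarrow> h \<in> Arr C \<Longrightarrow> Cod C f = Dom C g \<Longrightarrow> Cod C g = Dom C h \<Longrightarrow>
    (h \<cdot> g) \<cdot> f = h \<cdot> (g \<cdot> f)"
  using Comp_assoc[of f "Dom C f" "Cod C f" g "Cod C g" h "Cod C h"] by (auto simp: hom_iff)

lemma Id_left [simp]: "f \<in> Arr C \<Longrightarrow> Cod C f = y \<Longrightarrow> Id C y \<cdot> f = f"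
  using Comp_Id_left[of f "Dom C f" y] by (auto simp: hom_iff)

lemma Id_right [simp]: "f \<in> Arr C \<Longrightarrow> Dom C f = x \<Longrightarrow> f \<cdot> Id C x = f"
  using Comp_Id_right[of f x "Cod C f"] by (auto simp: hom_iff)

text \<open>Simplification brackets composites to the right, which hides \<open>g \<cdot> f\<close>
  inside \<open>g \<cdot> (f \<cdot> h)\<close>; this form applies a known equation for
  \<open>g \<cdot> f\<close> there.\<close>

lemma reassoc:
  assumes "g \<cdot> f = k" "f \<in> Arr C" "g \<in> Arr C" "Cod C f = Dom C g" "h \<in> Arr C" "Cod C h = Dom C f"
  shows "g \<cdot> (f \<cdot> h) = k \<cdot> h"
  using assms assoc[of h f g] by simp

lemma mono_cancel:
  assumes "mono_arr C m" "m \<cdot> g = m \<cdot> h" "g \<in> Arr C" "h \<in> Arr C" "Dom C g = Dom C h"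
    "Cod C g = Dom C m" "Cod C h = Dom C m"
  shows "g = h"
  using assms by (simp add: mono_arr_def hom_iff)

lemma epi_cancel:
  assumes "epi_arr C m" "g \<cdot> m = h \<cdot> m" "g \<in> Arr C" "h \<in> Arr C" "Cod C g = Cod C h"
    "Dom C g = Cod C m" "Dom C h = Cod C m"
  shows "g = h"
  using assms by (simp add: epi_arr_def hom_iff)

lemma mono_Arr [simp]: "mono_arr C m \<Longrightarrow> m \<in> Arr C"
  and epi_Arr [simp]: "epi_arr C m \<Longrightarrow> m \<in> Arr C"
  by (auto simp: mono_arr_def epi_arr_def)

lemma mono_Comp:
  assumes "mono_arr C f" "mono_arr C g" "Cod C f = Dom C g"
  shows "mono_arr C (g \<cdot> f)"
  unfolding mono_arr_def
proof (intro conjI allI ballI impI)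
  show "g \<cdot> f \<in> Arr C" using assms by simp
  fix w u v assume *: "u \<in> homs C w (Dom C (g \<cdot> f))" "v \<in> homs C w (Dom C (g \<cdot> f))" "g \<cdot> f \<cdot> u = g \<cdot> f \<cdot> v"
  then have "g \<cdot> (f \<cdot> u) = g \<cdot> (f \<cdot> v)" using assms by (simp add: hom_iff)
  then have "f \<cdot> u = f \<cdot> v"
    by (rule mono_cancel[OF assms(2)]) (use * assms in \<open>auto simp: hom_iff\<close>)
  then show "u = v"
    by (rule mono_cancel[OF assms(1)]) (use * assms in \<open>auto simp: hom_iff\<close>)
qed

lemma mono_Comp_right:
  assumes "mono_arr C (g \<cdot> f)" "f \<in> Arr C" "g \<in> Arr C" "Cod C f = Dom C g"
  shows "mono_arr C f"
  unfolding mono_arr_def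
proof (intro conjI allI ballI impI)
  show "f \<in> Arr C" by fact
  fix w u v assume *: "u \<in> homs C w (Dom C f)" "v \<in> homs C w (Dom C f)" "f \<cdot> u = f \<cdot> v"
  then have "g \<cdot> f \<cdot> u = g \<cdot> f \<cdot> v" using assms by (simp add: hom_iff)
  then show "u = v"
    by (rule mono_cancel[OF assms(1)]) (use * assms in \<open>auto simp: hom_iff\<close>)
qed

lemma epi_Comp_left:
  assumes "epi_arr C (g \<cdot> f)" "f \<in> Arr C" "g \<in> Arr C" "Cod C f = Dom C g"
  shows "epi_arr C g"
  unfolding epi_arr_def
proof (intro conjI allI ballI impI)
  show "g \<in> Arr C" by fact
  fix w u v assume *: "u \<in> homs C (Cod C g) w" "v \<in> homs C (Cod C g) w" "u \<cdot> g = v \<cdot> g"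
  then have "u \<cdot> (g \<cdot> f) = v \<cdot> (g \<cdot> f)" using assms reassoc[of u g "v \<cdot> g" f] by (simp add: hom_iff)
  then show "u = v"
    by (rule epi_cancel[OF assms(1)]) (use * assms in \<open>auto simp: hom_iff\<close>)
qed

lemma epi_Comp:
  assumes "epi_arr C f" "epi_arr C g" "Cod C f = Dom C g"
  shows "epi_arr C (g \<cdot> f)"
  unfolding epi_arr_def
proof (intro conjI allI ballI impI)
  show "g \<cdot> f \<in> Arr C" using assms by simp
  fix w u v assume *: "u \<in> homs C (Cod C (g \<cdot> f)) w" "v \<in> homs C (Cod C (g \<cdot> f)) w" "u \<cdot> (g \<cdot> f) = v \<cdot> (g \<cdot> f)"
  then have "(u \<cdot> g) \<cdot> f = (v \<cdot> g) \<cdot> f" using assms by (simp add: hom_iff)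
  then have "u \<cdot> g = v \<cdot> g"
    by (rule epi_cancel[OF assms(1)]) (use * assms in \<open>auto simp: hom_iff\<close>)
  then show "u = v"
    by (rule epi_cancel[OF assms(2)]) (use * assms in \<open>auto simp: hom_iff\<close>)
qed

lemma is_isoE:
  assumes "is_iso C f"
  obtains g where "f \<in> Arr C" "g \<in> Arr C" "Dom C g = Cod C f" "Cod C g = Dom C f"
    "g \<cdot> f = Id C (Dom C f)" "f \<cdot> g = Id C (Cod C f)"
  using assms by (auto simp: is_iso_def hom_iff)

lemma is_isoI:
  assumes "f \<in> Arr C" "g \<in> Arr C" "Dom C g = Cod C f" "Cod C g = Dom C f"
    "g \<cdot> f = Id C (Dom C f)" "f \<cdot> g = Id C (Cod C f)"
  shows "is_iso C f"
  using assms by (auto simp: is_iso_def hom_iff)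

lemma split_mono:
  assumes "f \<in> Arr C" "g \<in> Arr C" "Cod C f = Dom C g" "g \<cdot> f = Id C (Dom C f)"
  shows "mono_arr C f"
  unfolding mono_arr_def
proof (intro conjI allI ballI impI)
  show "f \<in> Arr C" by fact
  fix w u v assume *: "u \<in> homs C w (Dom C f)" "v \<in> homs C w (Dom C f)" "f \<cdot> u = f \<cdot> v"
  then have "g \<cdot> f \<cdot> u = g \<cdot> f \<cdot> v" using assms(1-3) by (simp add: hom_iff)
  then show "u = v" using assms * by (simp add: hom_iff)
qed

lemma split_epi:
  assumes "f \<in> Arr C" "g \<in> Arr C" "Cod C f = Dom C g" "g \<cdot> f = Id C (Dom C f)" "Cod C g = Dom C f"
  shows "epi_arr C g"
  unfolding epi_arr_def
proof (intro conjI allI ballI impI)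
  show "g \<in> Arr C" by fact
  fix w u v assume *: "u \<in> homs C (Cod C g) w" "v \<in> homs C (Cod C g) w" "u \<cdot> g = v \<cdot> g"
  then have "u \<cdot> (g \<cdot> f) = v \<cdot> (g \<cdot> f)" using assms(1-3) reassoc[of u g "v \<cdot> g" f] by (simp add: hom_iff)
  then show "u = v" using assms * by (simp add: hom_iff)
qed

lemma iso_mono: "is_iso C f \<Longrightarrow> mono_arr C f"
  by (metis is_isoE split_mono)

lemma iso_epi: "is_iso C f \<Longrightarrow> epi_arr C f"
  by (metis is_isoE split_epi)

lemma iso_Arr: "is_iso C f \<Longrightarrow> f \<in> Arr C"
  by (simp add: is_iso_def)

lemma iso_Comp: "is_iso C f \<Longrightarrow> is_iso C g \<Longrightarrow> Cod C f = Dom C g \<Longrightarrow> is_iso C (g \<cdot> f)"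
proof (elim is_isoE)
  fix f' g'
  assume a: "f \<in> Arr C" "f' \<in> Arr C" "Dom C f' = Cod C f" "Cod C f' = Dom C f"
    "f' \<cdot> f = Id C (Dom C f)" "f \<cdot> f' = Id C (Cod C f)"
    "g \<in> Arr C" "g' \<in> Arr C" "Dom C g' = Cod C g" "Cod C g' = Dom C g"
    "g' \<cdot> g = Id C (Dom C g)" "g \<cdot> g' = Id C (Cod C g)" "Cod C f = Dom C g"
  show "is_iso C (g \<cdot> f)"
    by (rule is_isoI[of _ "f' \<cdot> g'"]) (use a in \<open>simp_all add: reassoc[OF a(6)] reassoc[OF a(11)]\<close>)
qed

lemma isomorphicE:
  assumes "isomorphic C x y"
  obtains f where "is_iso C f" "Dom C f = x" "Cod C f = y"
  using assms by (auto simp: isomorphic_def hom_iff)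

lemma isomorphicI: "is_iso C f \<Longrightarrow> isomorphic C (Dom C f) (Cod C f)"
  by (auto simp: isomorphic_def hom_iff is_iso_def)

lemma Id_iso: "x \<in> Obj C \<Longrightarrow> is_iso C (Id C x)"
  by (rule is_isoI[of _ "Id C x"]) simp_all

lemma isomorphic_refl: "x \<in> Obj C \<Longrightarrow> isomorphic C x x"
  using isomorphicI[OF Id_iso, of x] by simp

lemma isomorphic_sym: "isomorphic C x y \<Longrightarrow> isomorphic C y x"
proof (elim isomorphicE is_isoE)
  fix f g assume a: "f \<in> Arr C" "g \<in> Arr C" "Dom C g = Cod C f" "Cod C g = Dom C f"
    "g \<cdot> f = Id C (Dom C f)" "f \<cdot> g = Id C (Cod C f)" "Dom C f = x" "Cod C f = y"
  have "is_iso C g" by (rule is_isoI[of _ f]) (use a in auto)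
  from isomorphicI[OF this] show "isomorphic C y x" using a by simp
qed

lemma isomorphic_trans: "isomorphic C x y \<Longrightarrow> isomorphic C y z \<Longrightarrow> isomorphic C x z"
proof (elim isomorphicE)
  fix f g assume a: "is_iso C f" "Dom C f = x" "Cod C f = y" "is_iso C g" "Dom C g = y" "Cod C g = z"
  have [simp]: "f \<in> Arr C" "g \<in> Arr C" using a is_iso_def[of C] by blast+
  have "is_iso C (g \<cdot> f)" using a by (intro iso_Comp) auto
  from isomorphicI[OF this] show ?thesis using a by simp
qed

section \<open>Kernels, cokernels and zero morphisms\<close>

lemma is_kernelD:
  assumes "is_kernel C k f"
  shows "k \<in> Arr C" "f \<in> Arr C" "Cod C k = Dom C f" "zero_arr C (f \<cdot> k)"
  using assms unfolding is_kernel_def by blast+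

lemma is_cokernelD:
  assumes "is_cokernel C q f"
  shows "q \<in> Arr C" "f \<in> Arr C" "Dom C q = Cod C f" "zero_arr C (q \<cdot> f)"
  using assms unfolding is_cokernel_def by blast+

lemma kernel_factor:
  assumes "is_kernel C k f" "g \<in> Arr C" "Cod C g = Dom C f" "zero_arr C (f \<cdot> g)"
  obtains h where "h \<in> Arr C" "Dom C h = Dom C g" "Cod C h = Dom C k" "k \<cdot> h = g"
proof -
  have "g \<in> homs C (Dom C g) (Dom C f)" using assms by (simp add: hom_iff)
  then have "\<exists>!h. h \<in> homs C (Dom C g) (Dom C k) \<and> k \<cdot> h = g"
    using assms unfolding is_kernel_def by blast
  then show ?thesis using that unfolding hom_iff by blast
qed

lemma cokernel_factor:
  assumes "is_cokernel C q f" "g \<in> Arr C" "Dom C g = Cod C f" "zero_arr C (g \<cdot> f)"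
  obtains h where "h \<in> Arr C" "Dom C h = Cod C q" "Cod C h = Cod C g" "h \<cdot> q = g"
proof -
  have "g \<in> homs C (Cod C f) (Cod C g)" using assms by (simp add: hom_iff)
  then have "\<exists>!h. h \<in> homs C (Cod C q) (Cod C g) \<and> h \<cdot> q = g"
    using assms unfolding is_cokernel_def by blast
  then show ?thesis using that unfolding hom_iff by blast
qed

text \<open>Monicity of \<open>k\<close> supplies uniqueness, so only the existence of a
  factorization remains to be checked.\<close>

lemma is_kernelI:
  assumes "mono_arr C k" "f \<in> Arr C" "Cod C k = Dom C f" "zero_arr C (f \<cdot> k)"
    "\<And>g. g \<in> Arr C \<Longrightarrow> Cod C g = Dom C f \<Longrightarrow> zero_arr C (f \<cdot> g) \<Longrightarrow>
      \<exists>h \<in> Arr C. Dom C h = Dom C g \<and> Cod C h = Dom C k \<and> k \<cdot> h = g"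
  shows "is_kernel C k f"
  unfolding is_kernel_def
proof (intro conjI allI ballI impI)
  fix w g assume g: "g \<in> homs C w (Dom C f)" "zero_arr C (f \<cdot> g)"
  then obtain h where h: "h \<in> Arr C" "Dom C h = Dom C g" "Cod C h = Dom C k" "k \<cdot> h = g"
    using assms(5)[of g] by (auto simp: hom_iff)
  show "\<exists>!h. h \<in> homs C w (Dom C k) \<and> k \<cdot> h = g"
  proof (rule ex1I[of _ h])
    fix h' assume *: "h' \<in> homs C w (Dom C k) \<and> k \<cdot> h' = g"
    show "h' = h" by (rule mono_cancel[OF assms(1)]) (use * h g in \<open>auto simp: hom_iff\<close>)
  qed (use h g in \<open>auto simp: hom_iff\<close>)
qed (use assms in auto)

lemma is_cokernelI:
  assumes "epi_arr C k" "f \<in> Arr C" "Dom C k = Cod C f" "zero_arr C (k \<cdot> f)"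
    "\<And>g. g \<in> Arr C \<Longrightarrow> Dom C g = Cod C f \<Longrightarrow> zero_arr C (g \<cdot> f) \<Longrightarrow>
      \<exists>h \<in> Arr C. Dom C h = Cod C k \<and> Cod C h = Cod C g \<and> h \<cdot> k = g"
  shows "is_cokernel C k f"
  unfolding is_cokernel_def
proof (intro conjI allI ballI impI)
  fix w g assume g: "g \<in> homs C (Cod C f) w" "zero_arr C (g \<cdot> f)"
  then obtain h where h: "h \<in> Arr C" "Dom C h = Cod C k" "Cod C h = Cod C g" "h \<cdot> k = g"
    using assms(5)[of g] by (auto simp: hom_iff)
  show "\<exists>!h. h \<in> homs C (Cod C k) w \<and> h \<cdot> k = g"
  proof (rule ex1I[of _ h])
    fix h' assume *: "h' \<in> homs C (Cod C k) w \<and> h' \<cdot> k = g"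
    show "h' = h" by (rule epi_cancel[OF assms(1)]) (use * h g in \<open>auto simp: hom_iff\<close>)
  qed (use h g in \<open>auto simp: hom_iff\<close>)
qed (use assms in auto)

lemma is_zero_Obj: "is_zero C z \<Longrightarrow> z \<in> Obj C"
  by (simp add: is_zero_def)

lemma terminal_unique:
  assumes "is_zero C z" "f \<in> Arr C" "g \<in> Arr C" "Dom C f = Dom C g" "Cod C f = z" "Cod C g = z"
  shows "f = g"
proof -
  have "\<exists>!h. h \<in> homs C (Dom C f) z" using assms by (simp add: is_zero_def)
  then show ?thesis using assms by (auto simp: hom_iff)
qed

lemma initial_unique:
  assumes "is_zero C z" "f \<in> Arr C" "g \<in> Arr C" "Cod C f = Cod C g" "Dom C f = z" "Dom C g = z"
  shows "f = g"
proof -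
  have "\<exists>!h. h \<in> homs C z (Cod C f)" using assms by (simp add: is_zero_def)
  then show ?thesis using assms by (auto simp: hom_iff)
qed

lemma terminal_ex:
  assumes "is_zero C z" "x \<in> Obj C"
  obtains f where "f \<in> Arr C" "Dom C f = x" "Cod C f = z"
  using assms unfolding is_zero_def hom_iff by blast

lemma initial_ex:
  assumes "is_zero C z" "x \<in> Obj C"
  obtains f where "f \<in> Arr C" "Dom C f = z" "Cod C f = x"
  using assms unfolding is_zero_def hom_iff by blast

lemma zero_arrE:
  assumes "zero_arr C f"
  obtains z a b where "is_zero C z" "a \<in> Arr C" "b \<in> Arr C" "Dom C a = Dom C f" "Cod C a = z"
    "Dom C b = z" "Cod C b = Cod C f" "f = b \<cdot> a"
  using assms by (auto simp: zero_arr_def hom_iff)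

lemma zero_arrI:
  assumes "is_zero C z" "a \<in> Arr C" "b \<in> Arr C" "Cod C a = z" "Dom C b = z"
  shows "zero_arr C (b \<cdot> a)"
  unfolding zero_arr_def
  by (rule exI[of _ z], rule conjI, fact, rule bexI[of _ a], rule bexI[of _ b])
    (use assms in \<open>auto simp: hom_iff\<close>)

lemma zero_arr_unique:
  assumes "zero_arr C f" "zero_arr C g" "Dom C f = Dom C g" "Cod C f = Cod C g"
  shows "f = g"
proof -
  obtain z a b where z: "is_zero C z" "a \<in> Arr C" "b \<in> Arr C" "Dom C a = Dom C f" "Cod C a = z"
    "Dom C b = z" "Cod C b = Cod C f" "f = b \<cdot> a"
    by (rule zero_arrE[OF assms(1)])
  obtain z' a' b' where z': "is_zero C z'" "a' \<in> Arr C" "b' \<in> Arr C" "Dom C a' = Dom C g" "Cod C a' = z'"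
    "Dom C b' = z'" "Cod C b' = Cod C g" "g = b' \<cdot> a'"
    by (rule zero_arrE[OF assms(2)])
  \<comment> \<open>The two morphisms may factor through different zero objects; \<open>t\<close>
    compares these.\<close>
  obtain t where t: "t \<in> Arr C" "Dom C t = z" "Cod C t = z'"
    using terminal_ex[OF z'(1) is_zero_Obj[OF z(1)]] .
  have "t \<cdot> a = a'" by (rule terminal_unique[OF z'(1)]) (use z z' t assms in auto)
  moreover have "b' \<cdot> t = b" by (rule initial_unique[OF z(1)]) (use z z' t assms in auto)
  ultimately show ?thesis using z z' t assoc[of a t b'] by simp
qed

lemma zero_arr_Comp_left:
  assumes "zero_arr C f" "g \<in> Arr C" "Cod C f = Dom C g"
  shows "zero_arr C (g \<cdot> f)"
proof -
  obtain z a b where z: "is_zero C z" "a \<in> Arr C" "b \<in> Arr C" "Dom C a = Dom C f" "Cod C a = z"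
    "Dom C b = z" "Cod C b = Cod C f" "f = b \<cdot> a"
    by (rule zero_arrE[OF assms(1)])
  then show ?thesis using zero_arrI[of z a "g \<cdot> b"] assms by simp
qed

lemma zero_arr_Comp_right:
  assumes "zero_arr C g" "f \<in> Arr C" "Cod C f = Dom C g"
  shows "zero_arr C (g \<cdot> f)"
proof -
  obtain z a b where z: "is_zero C z" "a \<in> Arr C" "b \<in> Arr C" "Dom C a = Dom C g" "Cod C a = z"
    "Dom C b = z" "Cod C b = Cod C g" "g = b \<cdot> a"
    by (rule zero_arrE[OF assms(1)])
  then show ?thesis using zero_arrI[of z "a \<cdot> f" b] assms by simp
qed

lemma is_zero_arr:
  assumes "is_zero C z" "f \<in> Arr C" "Dom C f = z \<or> Cod C f = z"
  shows "zero_arr C f"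
  using assms zero_arrI[of z "Id C z" f] zero_arrI[of z f "Id C z"] is_zero_Obj[of z] by auto

lemma kernel_mono: assumes "is_kernel C k f" shows "mono_arr C k"
  unfolding mono_arr_def
proof (intro conjI allI ballI impI)
  note k = is_kernelD[OF assms]
  show "k \<in> Arr C" by fact
  fix w u v assume *: "u \<in> homs C w (Dom C k)" "v \<in> homs C w (Dom C k)" "k \<cdot> u = k \<cdot> v"
  have "zero_arr C (f \<cdot> (k \<cdot> u))"
    using zero_arr_Comp_right[OF k(4), of u] * k by (simp add: hom_iff)
  moreover have "k \<cdot> u \<in> homs C w (Dom C f)" using * k by (simp add: hom_iff)
  ultimately have "\<exists>!h. h \<in> homs C w (Dom C k) \<and> k \<cdot> h = k \<cdot> u"
    using assms unfolding is_kernel_def by blast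
  then show "u = v" using * by auto
qed

end

text \<open>Objects, arrows and identities stay literally the same, so each notion simplifies to its
  dual and a dual lemma is a mere instantiation.\<close>

definition op_cat :: "('o, 'a, 'm) cat_scheme \<Rightarrow> ('o, 'a, 'm) cat_scheme" where
  "op_cat C = C\<lparr>Dom := Cod C, Cod := Dom C, Comp := \<lambda>g f. f \<cdot>\<^bsub>C\<^esub> g\<rparr>"

lemma op_cat_simps [simp]:
  "Obj (op_cat C) = Obj C" "Arr (op_cat C) = Arr C" "Dom (op_cat C) = Cod C" "Cod (op_cat C) = Dom C"
  "Id (op_cat C) = Id C" "g \<cdot>\<^bsub>op_cat C\<^esub> f = f \<cdot>\<^bsub>C\<^esub> g" "homs (op_cat C) x y = homs C y x"
  by (auto simp: op_cat_def homs_def)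

lemma op_mono [simp]: "mono_arr (op_cat C) = epi_arr C"
  and op_epi [simp]: "epi_arr (op_cat C) = mono_arr C"
  unfolding mono_arr_def epi_arr_def by auto

lemma op_is_zero [simp]: "is_zero (op_cat C) = is_zero C"
  unfolding is_zero_def by (auto simp: fun_eq_iff)

lemma op_zero_arr [simp]: "zero_arr (op_cat C) = zero_arr C"
  unfolding zero_arr_def by auto

lemma op_kernel [simp]: "is_kernel (op_cat C) = is_cokernel C"
  and op_cokernel [simp]: "is_cokernel (op_cat C) = is_kernel C"
  unfolding is_kernel_def is_cokernel_def by (auto simp: fun_eq_iff)

lemma op_short_exact [simp]: "short_exact (op_cat C) f g = short_exact C g f"
  unfolding short_exact_def by auto

lemma op_closed_under [simp]:
  "closed_under_quotients (op_cat C) = closed_under_subobjects C"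
  "closed_under_subobjects (op_cat C) = closed_under_quotients C"
  unfolding closed_under_quotients_def closed_under_subobjects_def by auto

text \<open>The middle object of a sequence is read off as \<open>Cod f\<close> on one side and as
  \<open>Dom g\<close> on the other; exactness makes the two equal.\<close>

lemma op_closed_under_extensions: "closed_under_extensions C P \<Longrightarrow> closed_under_extensions (op_cat C) P"
  unfolding closed_under_extensions_def by (auto simp: short_exact_def is_kernel_def)

lemma (in category) op_category: "category (op_cat C)"
  by standard (auto simp: hom_iff)

lemma (in category) cokernel_epi: "is_cokernel C q f \<Longrightarrow> epi_arr C q"
  using category.kernel_mono[OF op_category, of q f] by simp

text \<open>
  The consequences of abelianness that are used, in a self-dual form: coproducts and the addition
  of morphisms enter only through the criteria for monomorphisms and epimorphisms.
\<close>

locale normal_category = category C for C :: "('o, 'a, 'm) cat_scheme" (structure) +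
  assumes zero_ex: "\<exists>z. is_zero C z"
    and kernel_ex: "f \<in> Arr C \<Longrightarrow> \<exists>k. is_kernel C k f"
    and cokernel_ex: "f \<in> Arr C \<Longrightarrow> \<exists>q. is_cokernel C q f"
    and mono_normal: "mono_arr C m \<Longrightarrow> \<exists>f. is_kernel C m f"
    and epi_normal: "epi_arr C m \<Longrightarrow> \<exists>f. is_cokernel C m f"
    and monoI: "f \<in> Arr C \<Longrightarrow> (\<And>g. g \<in> Arr C \<Longrightarrow> Cod C g = Dom C f \<Longrightarrow> zero_arr C (f \<cdot> g) \<Longrightarrow> zero_arr C g) \<Longrightarrow>
      mono_arr C f"
    and epiI: "f \<in> Arr C \<Longrightarrow> (\<And>g. g \<in> Arr C \<Longrightarrow> Dom C g = Cod C f \<Longrightarrow> zero_arr C (g \<cdot> f) \<Longrightarrow> zero_arr C g) \<Longrightarrow>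
      epi_arr C f"

lemma (in normal_category) op_normal: "normal_category (op_cat C)"
proof -
  interpret op: category "op_cat C" by (rule op_category)
  show ?thesis
    by standard (use zero_ex kernel_ex cokernel_ex mono_normal epi_normal in \<open>auto intro: monoI epiI\<close>)
qed

section \<open>Abelian categories satisfy the axioms of \<open>normal_category\<close>\<close>

lemma zer_absorb:
  assumes C: "category C"
    and gr: "\<And>x y. x \<in> Obj C \<Longrightarrow> y \<in> Obj C \<Longrightarrow>
      comm_group \<lparr>carrier = homs C x y, monoid.mult = add, one = zer x y\<rparr>"
    and dl: "\<And>x y z f f' g. f \<in> homs C x y \<Longrightarrow> f' \<in> homs C x y \<Longrightarrow> g \<in> homs C y z \<Longrightarrow>
        g \<cdot>\<^bsub>C\<^esub> add f f' = add (g \<cdot>\<^bsub>C\<^esub> f) (g \<cdot>\<^bsub>C\<^esub> f')"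
    and g: "g \<in> homs C y z" and x: "x \<in> Obj C"
  shows "g \<cdot>\<^bsub>C\<^esub> zer x y = zer x z"
proof -
  interpret category C by fact
  have [simp]: "y \<in> Obj C" "z \<in> Obj C" "g \<in> Arr C" "Dom C g = y" "Cod C g = z" using g by (auto simp: hom_iff)
  interpret H: comm_group "\<lparr>carrier = homs C x y, monoid.mult = add, one = zer x y\<rparr>" by (rule gr) (use x in auto)
  interpret K: comm_group "\<lparr>carrier = homs C x z, monoid.mult = add, one = zer x z\<rparr>" by (rule gr) (use x in auto)
  have z: "zer x y \<in> homs C x y" using H.one_closed by simp
  have e: "add (zer x y) (zer x y) = zer x y" using H.l_one[of "zer x y"] z by simp
  have gz: "g \<cdot>\<^bsub>C\<^esub> zer x y \<in> homs C x z" using z by (auto simp: hom_iff)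
  \<comment> \<open>The composite of \<open>g\<close> with the neutral element is idempotent, and in
    a group only the neutral element is.\<close>
  have "add (g \<cdot>\<^bsub>C\<^esub> zer x y) (g \<cdot>\<^bsub>C\<^esub> zer x y) = g \<cdot>\<^bsub>C\<^esub> zer x y"
    using dl[OF z z g] e by simp
  then show ?thesis using K.l_cancel_one[of "g \<cdot>\<^bsub>C\<^esub> zer x y" "g \<cdot>\<^bsub>C\<^esub> zer x y"] gz by simp
qed

lemma preadditive_op: assumes "preadditive C" shows "preadditive (op_cat C)"
proof -
  interpret category C using assms by (simp add: preadditive_def)
  from assms obtain add zer where
    "\<forall>x \<in> Obj C. \<forall>y \<in> Obj C. comm_group \<lparr>carrier = homs C x y, monoid.mult = add, one = zer x y\<rparr>"
    "\<forall>x y z. \<forall>f \<in> homs C x y. \<forall>f' \<in> homs C x y. \<forall>g \<in> homs C y z. \<forall>g' \<in> homs C y z.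
        g \<cdot>\<^bsub>C\<^esub> add f f' = add (g \<cdot>\<^bsub>C\<^esub> f) (g \<cdot>\<^bsub>C\<^esub> f') \<and>
        add g g' \<cdot>\<^bsub>C\<^esub> f = add (g \<cdot>\<^bsub>C\<^esub> f) (g' \<cdot>\<^bsub>C\<^esub> f)"
    unfolding preadditive_def by blast
  then show ?thesis unfolding preadditive_def op_cat_simps
    by (intro conjI op_category exI[of _ add] exI[of _ "\<lambda>x y. zer y x"]) auto
qed

text \<open>The hypothesis on \<open>f\<close> is applied to the difference \<open>add u v'\<close>
  of two morphisms that have the same composite with \<open>f\<close>.\<close>

lemma preadditive_monoI:
  assumes pre: "preadditive C" and ze: "\<exists>z. is_zero C z" and f: "f \<in> Arr C"
    and z: "\<And>g. g \<in> Arr C \<Longrightarrow> Cod C g = Dom C f \<Longrightarrow> zero_arr C (f \<cdot>\<^bsub>C\<^esub> g) \<Longrightarrow> zero_arr C g"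
  shows "mono_arr C f"
proof -
  interpret category C using pre by (simp add: preadditive_def)
  from pre obtain add zer where
    gr: "\<And>x y. x \<in> Obj C \<Longrightarrow> y \<in> Obj C \<Longrightarrow> comm_group \<lparr>carrier = homs C x y, monoid.mult = add, one = zer x y\<rparr>"
    and dl: "\<And>x y z f f' g. f \<in> homs C x y \<Longrightarrow> f' \<in> homs C x y \<Longrightarrow> g \<in> homs C y z \<Longrightarrow>
        g \<cdot>\<^bsub>C\<^esub> add f f' = add (g \<cdot>\<^bsub>C\<^esub> f) (g \<cdot>\<^bsub>C\<^esub> f')"
    unfolding preadditive_def by (elim conjE exE) blast
  obtain z0 where z0: "is_zero C z0" using ze by blast
  have oO: "z0 \<in> Obj C" using is_zero_Obj[OF z0] .
  have zin: "zer x y \<in> homs C x y" if "x \<in> Obj C" "y \<in> Obj C" for x y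
  proof -
    interpret H: comm_group "\<lparr>carrier = homs C x y, monoid.mult = add, one = zer x y\<rparr>" using that by (rule gr)
    show ?thesis using H.one_closed by simp
  qed
  \<comment> \<open>The neutral element of each hom group is a zero morphism, because it factors
    through \<open>z0\<close>.\<close>
  have zz: "zero_arr C (zer x y)" if xy: "x \<in> Obj C" "y \<in> Obj C" for x y
  proof -
    obtain t where t: "t \<in> homs C z0 y" using initial_ex[OF z0 xy(2)] by (auto simp: hom_iff)
    have "t \<cdot>\<^bsub>C\<^esub> zer x z0 = zer x y" by (rule zer_absorb[OF category_axioms gr dl t]) (auto intro: that)
    moreover have "zero_arr C (t \<cdot>\<^bsub>C\<^esub> zer x z0)"
      using zin[of x z0] oO t that by (intro zero_arr_Comp_left is_zero_arr[OF z0]) (auto simp: hom_iff)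
    ultimately show ?thesis by simp
  qed
  show ?thesis unfolding mono_arr_def
  proof (intro conjI allI ballI impI)
    show "f \<in> Arr C" by fact
    fix w u v assume u: "u \<in> homs C w (Dom C f)" and v: "v \<in> homs C w (Dom C f)" and e: "f \<cdot>\<^bsub>C\<^esub> u = f \<cdot>\<^bsub>C\<^esub> v"
    have w: "w \<in> Obj C" "Dom C f \<in> Obj C" "Cod C f \<in> Obj C" using u f by (auto simp: hom_iff)
    have fh: "f \<in> homs C (Dom C f) (Cod C f)" using f by (simp add: hom_iff)
    let ?H = "\<lparr>carrier = homs C w (Dom C f), monoid.mult = add, one = zer w (Dom C f)\<rparr>"
    interpret H: comm_group ?H
      using w(1,2) by (rule gr)
    define v' where "v' = inv\<^bsub>?H\<^esub> v"
    have v': "v' \<in> homs C w (Dom C f)" using H.inv_closed[of v] v by (simp add: v'_def)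
    have vv: "add v v' = zer w (Dom C f)" using H.r_inv[of v] v by (simp add: v'_def)
    have au: "add u v' \<in> homs C w (Dom C f)" using H.m_closed[of u v'] u v' by simp
    have "f \<cdot>\<^bsub>C\<^esub> add u v' = f \<cdot>\<^bsub>C\<^esub> add v v'" using dl[OF u v' fh] dl[OF v v' fh] e by simp
    also have "zero_arr C \<dots>" unfolding vv using zz[OF w(1,2)] zin[OF w(1,2)] f
      by (intro zero_arr_Comp_left) (auto simp: hom_iff)
    finally have "zero_arr C (add u v')" using z[of "add u v'"] au by (auto simp: hom_iff)
    then have "add u v' = zer w (Dom C f)"
      using zero_arr_unique[OF _ zz[OF w(1,2)]] au zin[OF w(1,2)] by (auto simp: hom_iff)
    then show "u = v" using H.right_cancel[of v' u v] vv u v v' by simp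
  qed
qed

text \<open>For the epimorphism criterion only preadditivity and the zero object are dualized;
  binary coproducts would become products in the opposite category.\<close>

lemma abelian_normal:
  assumes "abelian C" shows "normal_category C"
proof -
  have pre: "preadditive C" and z: "\<exists>z. is_zero C z" using assms by (auto simp: abelian_def additive_def)
  interpret category C using pre by (simp add: preadditive_def)
  show ?thesis
  proof
    fix f assume f: "f \<in> Arr C"
    show "epi_arr C f" if "\<And>g. g \<in> Arr C \<Longrightarrow> Dom C g = Cod C f \<Longrightarrow> zero_arr C (g \<cdot>\<^bsub>C\<^esub> f) \<Longrightarrow> zero_arr C g"
      using preadditive_monoI[OF preadditive_op[OF pre], of f] f that z by simp
  qed (use assms pre z in \<open>auto simp: abelian_def intro: preadditive_monoI\<close>)
qed

section \<open>Exactness\<close>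

context normal_category
begin

lemma kernel_obtain:
  assumes "f \<in> Arr C"
  obtains k where "is_kernel C k f" "mono_arr C k" "k \<in> Arr C" "Cod C k = Dom C f" "zero_arr C (f \<cdot> k)"
  using kernel_ex[OF assms] kernel_mono is_kernelD by metis

lemma zero_obtain:
  assumes "x \<in> Obj C" "y \<in> Obj C"
  obtains z where "zero_arr C z" "z \<in> Arr C" "Dom C z = x" "Cod C z = y"
proof -
  obtain o' where o: "is_zero C o'" using zero_ex by blast
  obtain a where a: "a \<in> Arr C" "Dom C a = x" "Cod C a = o'" by (rule terminal_ex[OF o assms(1)])
  obtain b where b: "b \<in> Arr C" "Dom C b = o'" "Cod C b = y" by (rule initial_ex[OF o assms(2)])
  show ?thesis using that[of "b \<cdot> a"] zero_arrI[OF o, of a b] a b by simp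
qed

lemma mono_zero_cancel:
  assumes "mono_arr C m" "g \<in> Arr C" "Cod C g = Dom C m" "zero_arr C (m \<cdot> g)"
  shows "zero_arr C g"
proof -
  obtain z where z: "zero_arr C z" "z \<in> Arr C" "Dom C z = Dom C g" "Cod C z = Dom C m"
    using zero_obtain[of "Dom C g" "Dom C m"] assms by auto
  have "zero_arr C (m \<cdot> z)" using z assms by (intro zero_arr_Comp_left) auto
  then have "m \<cdot> g = m \<cdot> z" using zero_arr_unique[OF assms(4)] z assms by simp
  then have "g = z" by (rule mono_cancel[OF assms(1)]) (use z assms in auto)
  then show ?thesis using z by simp
qed

text \<open>\<open>m\<close> is a kernel of some \<open>f\<close>, and \<open>f\<close> factors
  through \<open>q\<close>. So whatever \<open>q\<close> kills is killed by \<open>f\<close> and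
  factors through \<open>m\<close>.\<close>

lemma mono_kernel_cokernel:
  assumes "mono_arr C m" "is_cokernel C q m"
  shows "is_kernel C m q"
proof -
  obtain f where f: "is_kernel C m f" using mono_normal[OF assms(1)] by blast
  note fD = is_kernelD[OF f] and qD = is_cokernelD[OF assms(2)]
  obtain f' where f': "f' \<in> Arr C" "Dom C f' = Cod C q" "Cod C f' = Cod C f" "f' \<cdot> q = f"
    by (rule cokernel_factor[OF assms(2)]) (use fD in auto)
  show ?thesis
  proof (rule is_kernelI)
    fix g assume g: "g \<in> Arr C" "Cod C g = Dom C q" "zero_arr C (q \<cdot> g)"
    have "f \<cdot> g = f' \<cdot> (q \<cdot> g)" using g f' qD by (auto simp del: assoc simp: assoc[symmetric])
    then have "zero_arr C (f \<cdot> g)" using zero_arr_Comp_left[OF g(3), of f'] f' qD g by simp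
    then show "\<exists>h \<in> Arr C. Dom C h = Dom C g \<and> Cod C h = Dom C m \<and> m \<cdot> h = g"
      using kernel_factor[OF f, of g] g fD qD by metis
  qed (use assms qD in auto)
qed

text \<open>\<open>m\<close> is a kernel of some \<open>f\<close>. Being an epimorphism,
  \<open>m\<close> forces \<open>f\<close> to be zero, so the identity factors through
  \<open>m\<close>.\<close>

lemma mono_epi_iso:
  assumes "mono_arr C m" "epi_arr C m" shows "is_iso C m"
proof -
  obtain f where f: "is_kernel C m f" using mono_normal[OF assms(1)] by blast
  note fD = is_kernelD[OF f]
  obtain z where z: "zero_arr C z" "z \<in> Arr C" "Dom C z = Dom C f" "Cod C z = Cod C f"
    using zero_obtain[of "Dom C f" "Cod C f"] fD by auto
  have "zero_arr C (z \<cdot> m)" using z fD by (intro zero_arr_Comp_right) auto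
  then have "f \<cdot> m = z \<cdot> m" using zero_arr_unique[OF fD(4)] z fD by simp
  then have "f = z" by (rule epi_cancel[OF assms(2)]) (use z fD in auto)
  then have "zero_arr C (f \<cdot> Id C (Cod C m))" using z fD by simp
  then obtain h where h: "h \<in> Arr C" "Dom C h = Cod C m" "Cod C h = Dom C m" "m \<cdot> h = Id C (Cod C m)"
    using kernel_factor[OF f, of "Id C (Cod C m)"] fD by auto
  have "h \<cdot> m = Id C (Dom C m)"
    by (rule mono_cancel[OF assms(1)]) (use h fD reassoc[OF h(4), of m] in auto)
  then show ?thesis using is_isoI[of m h] h fD by simp
qed

text \<open>Suppose \<open>u \<cdot> e\<close> is zero and let \<open>n\<close> be a kernel of
  \<open>u\<close>. Then \<open>f\<close> factors through \<open>k \<cdot> n\<close>, which is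
  itself a kernel, of \<open>p\<close> say. As \<open>p\<close> kills \<open>f\<close>, it factors
  through \<open>q\<close> and so kills \<open>k\<close>. Hence \<open>k\<close> factors through
  \<open>k \<cdot> n\<close>, which gives \<open>n\<close> a right inverse and makes
  \<open>u\<close> zero.\<close>

lemma kernel_cokernel_factor_epi:
  assumes q: "is_cokernel C q f" and k: "is_kernel C k q"
    and e: "e \<in> Arr C" "Cod C e = Dom C k" "k \<cdot> e = f"
  shows "epi_arr C e"
proof (rule epiI)
  note qD = is_cokernelD[OF q] and kD = is_kernelD[OF k]
  show "e \<in> Arr C" by fact
  fix u assume u: "u \<in> Arr C" "Dom C u = Cod C e" "zero_arr C (u \<cdot> e)"
  obtain n where n: "is_kernel C n u" "mono_arr C n" "n \<in> Arr C" "Cod C n = Dom C u" "zero_arr C (u \<cdot> n)"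
    by (rule kernel_obtain[OF u(1)])
  obtain e' where e': "e' \<in> Arr C" "Dom C e' = Dom C e" "Cod C e' = Dom C n" "n \<cdot> e' = e"
    using kernel_factor[OF n(1) e(1)] u by auto
  have m: "mono_arr C (k \<cdot> n)" using mono_Comp[OF n(2) kernel_mono[OF k]] n u e kD by simp
  obtain p where p: "is_kernel C (k \<cdot> n) p" using mono_normal[OF m] by blast
  note pD = is_kernelD[OF p]
  have "p \<cdot> f = (p \<cdot> (k \<cdot> n)) \<cdot> e'" using pD e' e n u kD by auto
  then have "zero_arr C (p \<cdot> f)" using zero_arr_Comp_right[OF pD(4), of e'] pD e' e n u kD by simp
  then obtain p' where p': "p' \<in> Arr C" "Dom C p' = Cod C q" "Cod C p' = Cod C p" "p' \<cdot> q = p"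
    using cokernel_factor[OF q, of p] pD kD qD n e u by auto
  have "p \<cdot> k = p' \<cdot> (q \<cdot> k)" using p' qD kD by (auto simp del: assoc simp: assoc[symmetric])
  then have "zero_arr C (p \<cdot> k)" using zero_arr_Comp_left[OF kD(4), of p'] p' kD by simp
  then obtain t where t: "t \<in> Arr C" "Dom C t = Dom C k" "Cod C t = Dom C n" "(k \<cdot> n) \<cdot> t = k"
    using kernel_factor[OF p, of k] pD kD n e u by auto
  have "n \<cdot> t = Id C (Dom C k)"
    by (rule mono_cancel[OF kernel_mono[OF k]]) (use t n u e kD in auto)
  then have "u = (u \<cdot> n) \<cdot> t" using t n u e kD by simp
  then show "zero_arr C u" using zero_arr_Comp_right[OF n(5), of t] n t u by simp
qed

text \<open>The image is the kernel of the cokernel. The cokernel \<open>q\<close> is a parameter,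
  so that \<open>m\<close> is a kernel of the given one.\<close>

lemma image_obtain:
  assumes "f \<in> Arr C" "is_cokernel C q f"
  obtains m e where "is_kernel C m q" "mono_arr C m" "epi_arr C e" "m \<in> Arr C" "e \<in> Arr C"
    "Dom C e = Dom C f" "Cod C e = Dom C m" "Cod C m = Cod C f" "m \<cdot> e = f"
proof -
  note qD = is_cokernelD[OF assms(2)]
  obtain m where m: "is_kernel C m q" "mono_arr C m" "m \<in> Arr C" "Cod C m = Dom C q"
    by (rule kernel_obtain[OF qD(1)])
  obtain e where e: "e \<in> Arr C" "Dom C e = Dom C f" "Cod C e = Dom C m" "m \<cdot> e = f"
    using kernel_factor[OF m(1) assms(1)] qD by auto
  have "epi_arr C e" by (rule kernel_cokernel_factor_epi[OF assms(2) m(1) e(1,3,4)])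
  then show ?thesis using that m e qD by auto
qed

text \<open>\<open>f\<close> factors through \<open>k\<close>, so a morphism that kills
  \<open>k\<close> also kills \<open>f\<close>.\<close>

lemma cokernel_of_kernel:
  assumes "is_cokernel C q f" "is_kernel C k q"
  shows "is_cokernel C q k"
proof -
  note qD = is_cokernelD[OF assms(1)] and kD = is_kernelD[OF assms(2)]
  obtain e where e: "e \<in> Arr C" "Dom C e = Dom C f" "Cod C e = Dom C k" "k \<cdot> e = f"
    using kernel_factor[OF assms(2) qD(2)] qD by auto
  show ?thesis
  proof (rule is_cokernelI)
    show "epi_arr C q" by (rule cokernel_epi[OF assms(1)])
    fix g assume g: "g \<in> Arr C" "Dom C g = Cod C k" "zero_arr C (g \<cdot> k)"
    have "zero_arr C ((g \<cdot> k) \<cdot> e)" using zero_arr_Comp_right[OF g(3), of e] g e kD by simp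
    then have "zero_arr C (g \<cdot> f)" using g e kD by simp
    then show "\<exists>h\<in>Arr C. Dom C h = Cod C q \<and> Cod C h = Cod C g \<and> h \<cdot> q = g"
      using cokernel_factor[OF assms(1), of g] g kD qD by metis
  qed (use qD kD in auto)
qed

lemma epi_cokernel_kernel:
  assumes "epi_arr C q" "is_kernel C k q"
  shows "is_cokernel C q k"
  using epi_normal[OF assms(1)] cokernel_of_kernel[OF _ assms(2)] by blast

text \<open>Injectivity on the left is dispensable when quotients stay in \<open>P\<close>: the
  middle object is an extension of \<open>Cod C q\<close> by the image of \<open>f\<close>, and this
  image is a quotient of \<open>Dom C f\<close>. Right exactness of the tensor product is thereby
  enough.\<close>

lemma right_exact_closed:
  assumes P: "closed_under_quotients C P" "closed_under_extensions C P"
    and q: "is_cokernel C q f" and f: "Dom C f \<in> P" "Cod C q \<in> P"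
  shows "Cod C f \<in> P"
proof -
  note qD = is_cokernelD[OF q]
  obtain m e where m: "is_kernel C m q" "epi_arr C e" "Dom C e = Dom C f" "Cod C e = Dom C m" "Cod C m = Cod C f"
    using image_obtain[OF qD(2) q] by metis
  have "Dom C m \<in> P" using P(1) m f unfolding closed_under_quotients_def by metis
  moreover have "short_exact C m q" using m cokernel_of_kernel[OF q m(1)] by (simp add: short_exact_def)
  ultimately show ?thesis using P(2) m f unfolding closed_under_extensions_def by metis
qed

lemma left_exact_closed:
  assumes P: "closed_under_subobjects C P" "closed_under_extensions C P"
    and k: "is_kernel C k g" and g: "Dom C k \<in> P" "Cod C g \<in> P"
  shows "Dom C g \<in> P"
  using normal_category.right_exact_closed[OF op_normal, of P k g] assms op_closed_under_extensions[of C P]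
  by simp

text \<open>If \<open>m\<close> represents a subobject, then \<open>n\<close> represents its sum with the image of \<open>h\<close>.\<close>

lemma adjoin:
  assumes P: "closed_under_quotients C P" "closed_under_extensions C P"
    and m: "is_kernel C m q" "is_cokernel C q m" and h: "h \<in> Arr C" "Cod C h = Cod C m"
    and r: "is_cokernel C r (q \<cdot> h)" and n: "is_kernel C n (r \<cdot> q)"
    and mP: "Dom C m \<in> P" "Dom C h \<in> P"
  shows "Dom C n \<in> P" and "\<exists>t \<in> Arr C. Dom C t = Dom C m \<and> Cod C t = Dom C n \<and> n \<cdot> t = m"
    and "\<exists>t \<in> Arr C. Dom C t = Dom C h \<and> Cod C t = Dom C n \<and> n \<cdot> t = h"
proof -
  note mD = is_kernelD[OF m(1)] and rD = is_cokernelD[OF r] and nD = is_kernelD[OF n]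
  have qh: "q \<cdot> h \<in> Arr C" "Dom C (q \<cdot> h) = Dom C h" "Cod C (q \<cdot> h) = Cod C q" using h mD by auto
  have rq: "r \<cdot> q \<in> Arr C" "Dom C (r \<cdot> q) = Dom C q" "Cod C (r \<cdot> q) = Cod C r" using rD mD h qh by auto
  \<comment> \<open>\<open>j\<close> is the image of \<open>h\<close> in the quotient by
    \<open>m\<close>. The aim is a short exact sequence with middle term \<open>Dom C n\<close>,
    left term \<open>Dom C m\<close> and right term \<open>Dom C j\<close>; the latter is a quotient
    of \<open>Dom C h\<close>.\<close>
  obtain j e where j: "is_kernel C j r" "mono_arr C j" "epi_arr C e" "j \<in> Arr C" "e \<in> Arr C"
    "Dom C e = Dom C h" "Cod C e = Dom C j" "Cod C j = Cod C q" "j \<cdot> e = q \<cdot> h"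
    using image_obtain[OF qh(1) r] qh by metis
  have "zero_arr C (r \<cdot> (q \<cdot> m))" using zero_arr_Comp_left[OF mD(4), of r] rD mD qh h by simp
  then have "zero_arr C ((r \<cdot> q) \<cdot> m)" using rD mD h by simp
  then obtain t where t: "t \<in> Arr C" "Dom C t = Dom C m" "Cod C t = Dom C n" "n \<cdot> t = m"
    using kernel_factor[OF n, of m] mD rq by metis
  then show "\<exists>t \<in> Arr C. Dom C t = Dom C m \<and> Cod C t = Dom C n \<and> n \<cdot> t = m" by blast
  have "zero_arr C ((r \<cdot> q) \<cdot> h)" using rD mD h by simp
  then obtain h' where h': "h' \<in> Arr C" "Dom C h' = Dom C h" "Cod C h' = Dom C n" "n \<cdot> h' = h"
    using kernel_factor[OF n, of h] mD rq h by metis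
  then show "\<exists>t \<in> Arr C. Dom C t = Dom C h \<and> Cod C t = Dom C n \<and> n \<cdot> t = h" by blast
  have "zero_arr C (r \<cdot> (q \<cdot> n))" using nD rD mD qh h rq by simp
  then obtain s where s: "s \<in> Arr C" "Dom C s = Dom C n" "Cod C s = Dom C j" "j \<cdot> s = q \<cdot> n"
    using kernel_factor[OF j(1), of "q \<cdot> n"] nD rq rD qh mD by (metis Comp_Arr Dom_Comp Cod_Comp)
  \<comment> \<open>The epimorphism \<open>e\<close> onto the image factors through
    \<open>s\<close>, so \<open>s\<close> is an epimorphism as well.\<close>
  have "s \<cdot> h' = e"
    by (rule mono_cancel[OF j(2)]) (use s h' j h nD rq mD reassoc[OF s(4), of h'] in auto)
  then have epis: "epi_arr C s" using epi_Comp_left[of s h'] j s h' by simp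
  have ker: "is_kernel C t s"
  proof (rule is_kernelI)
    show "mono_arr C t" using mono_Comp_right[of n t] kernel_mono[OF m(1)] t nD by simp
    have "j \<cdot> (s \<cdot> t) = q \<cdot> m" using s t j nD rq reassoc[OF s(4), of t] mD by simp
    then show "zero_arr C (s \<cdot> t)" using mono_zero_cancel[OF j(2), of "s \<cdot> t"] s t mD by simp
    fix g assume g: "g \<in> Arr C" "Cod C g = Dom C s" "zero_arr C (s \<cdot> g)"
    have "j \<cdot> (s \<cdot> g) = q \<cdot> (n \<cdot> g)" using s g j nD rq reassoc[OF s(4), of g] mD by simp
    then have "zero_arr C (q \<cdot> (n \<cdot> g))" using zero_arr_Comp_left[OF g(3), of j] s g j by simp
    then obtain v where v: "v \<in> Arr C" "Dom C v = Dom C g" "Cod C v = Dom C m" "m \<cdot> v = n \<cdot> g"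
      using kernel_factor[OF m(1), of "n \<cdot> g"] nD g s rq by auto
    have "t \<cdot> v = g"
      by (rule mono_cancel[OF kernel_mono[OF n]]) (use v t g nD s reassoc[OF t(4), of v] in auto)
    then show "\<exists>h\<in>Arr C. Dom C h = Dom C g \<and> Cod C h = Dom C t \<and> t \<cdot> h = g" using v t by auto
  qed (use s t in auto)
  have "Dom C j \<in> P" using P(1) j mP unfolding closed_under_quotients_def by metis
  then show "Dom C n \<in> P"
    using P(2) epi_cokernel_kernel[OF epis ker] ker s t mP unfolding closed_under_extensions_def short_exact_def
    by metis
qed

section \<open>Membership along filtrations and ascending chains of subobjects\<close>

lemma iso_closed:
  assumes "closed_under_quotients C P \<or> closed_under_subobjects C P" "isomorphic C x y" "x \<in> P"
  shows "y \<in> P"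
proof -
  obtain f where f: "is_iso C f" "Dom C f = x" "Cod C f = y" using assms(2) by (rule isomorphicE)
  obtain g where g: "is_iso C g" "Dom C g = y" "Cod C g = x"
    using isomorphic_sym[OF assms(2)] by (rule isomorphicE)
  show ?thesis using assms(1,3) f g iso_epi[OF f(1)] iso_mono[OF g(1)]
    unfolding closed_under_quotients_def closed_under_subobjects_def by metis
qed

lemma zero_isomorphic:
  assumes "is_zero C x" "is_zero C y" shows "isomorphic C x y"
proof -
  obtain f where f: "f \<in> Arr C" "Dom C f = x" "Cod C f = y" by (rule terminal_ex[OF assms(2) is_zero_Obj[OF assms(1)]])
  obtain g where g: "g \<in> Arr C" "Dom C g = y" "Cod C g = x" by (rule terminal_ex[OF assms(1) is_zero_Obj[OF assms(2)]])
  have "g \<cdot> f = Id C x" by (rule terminal_unique[OF assms(1)]) (use f g is_zero_Obj[OF assms(1)] in auto)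
  moreover have "f \<cdot> g = Id C y" by (rule terminal_unique[OF assms(2)]) (use f g is_zero_Obj[OF assms(2)] in auto)
  ultimately show ?thesis using is_isoI[of f g] f g isomorphicI[of f] by simp
qed

text \<open>Each step of the filtration is an extension of an object isomorphic to one in
  \<open>S\<close> by the preceding step, so membership climbs up from the zero object.\<close>

lemma filtered_in:
  assumes P: "closed_under_quotients C P" "closed_under_extensions C P" and z: "\<And>z. is_zero C z \<Longrightarrow> z \<in> P"
    and S: "S \<subseteq> P" and x: "filtered_object C S x"
  shows "x \<in> P"
proof -
  obtain n m where m: "\<And>k. k \<le> n \<Longrightarrow> mono_arr C (m k) \<and> Cod C (m k) = x"
     "is_zero C (Dom C (m 0))" "is_iso C (m n)"
     and step: "\<And>k. k < n \<Longrightarrow> (\<exists>j q. j \<in> homs C (Dom C (m k)) (Dom C (m (Suc k))) \<and> m (Suc k) \<cdot> j = m k \<and>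
           short_exact C j q \<and> (\<exists>s \<in> S. isomorphic C (Cod C q) s))"
    using x unfolding filtered_object_def by auto
  have "k \<le> n \<Longrightarrow> Dom C (m k) \<in> P" for k
  proof (induction k)
    case 0 then show ?case using m(2) z by blast
  next
    case (Suc k)
    then obtain j q s where j: "j \<in> homs C (Dom C (m k)) (Dom C (m (Suc k)))" "short_exact C j q" "s \<in> S"
      "isomorphic C (Cod C q) s"
      using step[of k] by auto
    have "Cod C q \<in> P" using iso_closed[OF disjI1[OF P(1)] isomorphic_sym[OF j(4)]] j S by blast
    then show ?case using P(2) j Suc unfolding closed_under_extensions_def hom_iff by (metis Suc_leD)
  qed
  from this[of n] m(1)[of n] iso_epi[OF m(3)] show ?thesis using P(1) unfolding closed_under_quotients_def by auto
qed

text \<open>If \<open>q\<close> killed every morphism from \<open>S\<close>, it would be zero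
  because \<open>S\<close> generates. Then \<open>m\<close> would be an epimorphism besides being a
  monomorphism, hence an isomorphism.\<close>

lemma not_iso_generating:
  assumes "generating C S" "mono_arr C m" "\<not> is_iso C m" "is_cokernel C q m"
  shows "\<exists>h \<in> Arr C. Dom C h \<in> S \<and> Cod C h = Cod C m \<and> \<not> zero_arr C (q \<cdot> h)"
proof (rule ccontr)
  assume neg: "\<not> ?thesis"
  note qD = is_cokernelD[OF assms(4)]
  have *: "zero_arr C (q \<cdot> h)" if "h \<in> Arr C" "Dom C h \<in> S" "Cod C h = Cod C m" for h
    using neg that by blast
  obtain z where z: "zero_arr C z" "z \<in> Arr C" "Dom C z = Dom C q" "Cod C z = Cod C q"
    using zero_obtain[of "Dom C q" "Cod C q"] qD by auto
  have "q \<cdot> h = z \<cdot> h" if "s \<in> S" "h \<in> homs C s (Cod C m)" for s h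
  proof (rule zero_arr_unique)
    show "zero_arr C (q \<cdot> h)" using * that by (auto simp: hom_iff)
    show "zero_arr C (z \<cdot> h)" using z that qD by (intro zero_arr_Comp_right) (auto simp: hom_iff)
  qed (use that z qD in \<open>auto simp: hom_iff\<close>)
  moreover have "q \<in> homs C (Cod C m) (Cod C q)" "z \<in> homs C (Cod C m) (Cod C q)" using z qD by (auto simp: hom_iff)
  ultimately have "q = z" using assms(1) unfolding generating_def by blast
  have "epi_arr C m"
  proof (rule epiI)
    fix g assume g: "g \<in> Arr C" "Dom C g = Cod C m" "zero_arr C (g \<cdot> m)"
    obtain h where "h \<in> Arr C" "Dom C h = Cod C q" "Cod C h = Cod C g" "h \<cdot> q = g"
      by (rule cokernel_factor[OF assms(4) g])
    then show "zero_arr C g" using zero_arr_Comp_left[OF z(1), of h] \<open>q = z\<close> by auto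
  qed (use assms in auto)
  then show False using mono_epi_iso assms by blast
qed

lemma noetherian_in:
  assumes P: "closed_under_quotients C P" "closed_under_extensions C P" and z: "\<And>z. is_zero C z \<Longrightarrow> z \<in> P"
    and S: "S \<subseteq> P" "generating C S" and x: "noetherian_object C x"
  shows "x \<in> P"
proof (rule ccontr)
  assume nx: "x \<notin> P"
  define Q where "Q m \<longleftrightarrow> mono_arr C m \<and> Cod C m = x \<and> Dom C m \<in> P" for m
  \<comment> \<open>\<open>Q\<close> singles out the subobjects of \<open>x\<close> that belong to
    \<open>P\<close>. None of them is all of \<open>x\<close>, so some \<open>h\<close> from
    \<open>S\<close> survives in the quotient, and adjoining its image gives a strictly larger
    one.\<close>
  have step: "\<exists>n. Q n \<and> sub_le C m n \<and> \<not> sub_le C n m" if Qm: "Q m" for m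
  proof -
    have m: "mono_arr C m" "m \<in> Arr C" "Cod C m = x" "Dom C m \<in> P" using Qm by (auto simp: Q_def)
    have "\<not> is_iso C m" using iso_epi[of m] P(1) m nx unfolding closed_under_quotients_def by blast
    obtain q where q: "is_cokernel C q m" using cokernel_ex[OF m(2)] by blast
    note ker = mono_kernel_cokernel[OF m(1) q] and qD = is_cokernelD[OF q]
    obtain h where h: "h \<in> Arr C" "Dom C h \<in> S" "Cod C h = Cod C m" "\<not> zero_arr C (q \<cdot> h)"
      using not_iso_generating[OF S(2) m(1) _ q] \<open>\<not> is_iso C m\<close> by blast
    obtain r where r: "is_cokernel C r (q \<cdot> h)" using cokernel_ex[of "q \<cdot> h"] h qD by auto
    obtain n where n: "is_kernel C n (r \<cdot> q)" using kernel_ex[of "r \<cdot> q"] h qD is_cokernelD[OF r] by auto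
    note nD = is_kernelD[OF n]
    have cn: "Cod C n = x" using nD is_cokernelD[OF r] qD h m by simp
    have dh: "Dom C h \<in> P" using h S by blast
    note adj = adjoin[OF P ker q h(1,3) r n m(4) dh]
    obtain t where t: "t \<in> Arr C" "Dom C t = Dom C m" "Cod C t = Dom C n" "n \<cdot> t = m" using adj(2) by blast
    obtain h' where h': "h' \<in> Arr C" "Dom C h' = Dom C h" "Cod C h' = Dom C n" "n \<cdot> h' = h" using adj(3) by blast
    have "sub_le C m n" using t by (auto simp: sub_le_def hom_iff)
    \<comment> \<open>If \<open>n\<close> were contained in \<open>m\<close>, then \<open>h\<close>
      would factor through \<open>m\<close> and be killed by \<open>q\<close>.\<close>
    moreover have "\<not> sub_le C n m"
    proof
      assume "sub_le C n m"
      then obtain v where v: "v \<in> Arr C" "Dom C v = Dom C n" "Cod C v = Dom C m" "m \<cdot> v = n"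
        by (auto simp: sub_le_def hom_iff)
      have "h = m \<cdot> (v \<cdot> h')" using v h' m reassoc[OF v(4), of h'] by simp
      then have "q \<cdot> h = (q \<cdot> m) \<cdot> (v \<cdot> h')" using v h' m qD by simp
      then have "zero_arr C (q \<cdot> h)" using zero_arr_Comp_right[OF qD(4), of "v \<cdot> h'"] v h' m qD by simp
      then show False using h by blast
    qed
    ultimately show ?thesis using adj(1) kernel_mono[OF n] cn unfolding Q_def by blast
  qed
  have xO: "x \<in> Obj C" using x by (simp add: noetherian_object_def)
  obtain o' where o: "is_zero C o'" using zero_ex by blast
  obtain b where b: "b \<in> Arr C" "Dom C b = o'" "Cod C b = x" by (rule initial_ex[OF o xO])
  have "mono_arr C b"
  proof (rule monoI)
    fix g assume "g \<in> Arr C" "Cod C g = Dom C b"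
    then show "zero_arr C g" using is_zero_arr[OF o, of g] b by simp
  qed (use b in auto)
  then have Qb: "Q b" using b z[OF o] by (simp add: Q_def)
  \<comment> \<open>Dependent choice, available because the zero subobject satisfies
    \<open>Q\<close>, yields a strictly ascending chain.\<close>
  have "\<exists>f. \<forall>n::nat. Q (f n) \<and> (sub_le C (f n) (f (Suc n)) \<and> \<not> sub_le C (f (Suc n)) (f n))"
    by (rule dependent_nat_choice) (use Qb step in auto)
  then obtain f where f: "\<And>n::nat. Q (f n)" "\<And>n. sub_le C (f n) (f (Suc n))" "\<And>n. \<not> sub_le C (f (Suc n)) (f n)"
    by blast
  then obtain N where "\<forall>n\<ge>N. sub_le C (f n) (f N)"
    using x unfolding noetherian_object_def Q_def by blast
  then show False using f(3)[of N] by auto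
qed

end

section \<open>Smallness and noetherian objects\<close>

lemma inaccessible_Cinfinite: "inaccessible \<kappa> \<Longrightarrow> Cinfinite \<kappa>"
  unfolding inaccessible_def using cinfinite_mono[OF ordLess_imp_ordLeq natLeq_cinfinite] by blast

lemma small_UNION:
  "inaccessible \<kappa> \<Longrightarrow> small \<kappa> S \<Longrightarrow> (\<And>s. s \<in> S \<Longrightarrow> small \<kappa> (T s)) \<Longrightarrow> small \<kappa> (\<Union>s\<in>S. T s)"
  unfolding small_def using regularCard_UNION_bound[OF inaccessible_Cinfinite] by (auto simp: inaccessible_def)

lemma small_image: "small \<kappa> S \<Longrightarrow> small \<kappa> (f ` S)"
  unfolding small_def using ordLeq_ordLess_trans[OF card_of_image] .

lemma small_subset: "small \<kappa> S \<Longrightarrow> T \<subseteq> S \<Longrightarrow> small \<kappa> T"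
  unfolding small_def using ordLeq_ordLess_trans[OF card_of_mono1] .

text \<open>Coproducts and direct limits are indexed by subsets of \<open>'u\<close>, so small sets
  of morphisms have to be transported there.\<close>

lemma small_encode:
  fixes \<kappa> :: "'u rel" and T :: "'x set"
  assumes "inaccessible \<kappa>" "small \<kappa> T"
  obtains enc :: "'x \<Rightarrow> 'u" where "inj_on enc T"
proof -
  have "|T| \<le>o \<kappa>" using assms ordLess_imp_ordLeq unfolding small_def by blast
  moreover have "\<kappa> =o |Field \<kappa>|"
    using assms(1) card_of_Field_ordIso ordIso_symmetric unfolding inaccessible_def by blast
  ultimately have "|T| \<le>o |Field \<kappa>|" by (rule ordLeq_ordIso_trans)
  then show ?thesis using that card_of_ordLeq[of T "Field \<kappa>"] by blast
qed

text \<open>Inaccessibility speaks of power sets of subsets of \<open>'u\<close> only; other types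
  are reached through an injection.\<close>

lemma small_Pow:
  fixes \<kappa> :: "'u rel" and T :: "'x set"
  assumes "inaccessible \<kappa>" "small \<kappa> T"
  shows "small \<kappa> (Pow T)"
proof -
  obtain enc :: "'x \<Rightarrow> 'u" where enc: "inj_on enc T" using small_encode[OF assms] .
  have "|enc ` T| <o \<kappa>" using small_image[OF assms(2)] by (simp add: small_def)
  then have "|Pow (enc ` T)| <o \<kappa>" using assms(1) unfolding inaccessible_def by blast
  moreover have "|Pow T| \<le>o |Pow (enc ` T)|"
    by (rule card_of_ordLeqI[of "image enc"]) (use enc in \<open>auto simp: inj_on_image_Pow\<close>)
  ultimately show ?thesis unfolding small_def using ordLeq_ordLess_trans by blast
qed

section \<open>The preorder of subobjects and noetherian objects\<close>

context category
begin

lemma sub_leI: "h \<in> Arr C \<Longrightarrow> Dom C h = Dom C m \<Longrightarrow> Cod C h = Dom C n \<Longrightarrow> n \<cdot> h = m \<Longrightarrow> sub_le C m n"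
  by (auto simp: sub_le_def hom_iff)

lemma sub_leE:
  assumes "sub_le C m n"
  obtains h where "h \<in> Arr C" "Dom C h = Dom C m" "Cod C h = Dom C n" "n \<cdot> h = m"
  using assms by (auto simp: sub_le_def hom_iff)

lemma sub_le_refl: "m \<in> Arr C \<Longrightarrow> sub_le C m m"
  by (rule sub_leI[of "Id C (Dom C m)"]) auto

lemma sub_le_trans:
  assumes "sub_le C l m" "sub_le C m n" "n \<in> Arr C"
  shows "sub_le C l n"
proof -
  obtain h where h: "h \<in> Arr C" "Dom C h = Dom C l" "Cod C h = Dom C m" "m \<cdot> h = l" using assms(1) by (rule sub_leE)
  obtain k where k: "k \<in> Arr C" "Dom C k = Dom C m" "Cod C k = Dom C n" "n \<cdot> k = m" using assms(2) by (rule sub_leE)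
  show ?thesis by (rule sub_leI[of "k \<cdot> h"]) (use h k assms(3) reassoc[OF k(4), of h] in auto)
qed

lemma chain_sub_le:
  assumes "\<And>n::nat. m n \<in> Arr C" "\<And>n. sub_le C (m n) (m (Suc n))" "i \<le> j"
  shows "sub_le C (m i) (m j)"
  using assms(3)
proof (induction rule: dec_induct)
  case base then show ?case using sub_le_refl assms(1) .
next
  case (step n) then show ?case using sub_le_trans assms(1,2) by blast
qed

text \<open>\<open>F\<close> embeds the preorder of subobjects of \<open>y\<close> into that of
  \<open>x\<close>, so the ascending chain condition pulls back. It serves for subobjects
  (composition), quotients (preimage) and invertible objects (tensoring with an inverse).\<close>

lemma noetherian_transfer:
  assumes x: "noetherian_object C x" and y: "y \<in> Obj C"
    and F: "\<And>m. mono_arr C m \<Longrightarrow> Cod C m = y \<Longrightarrow> mono_arr C (F m) \<and> Cod C (F m) = x"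
    "\<And>m n. mono_arr C m \<Longrightarrow> Cod C m = y \<Longrightarrow> mono_arr C n \<Longrightarrow> Cod C n = y \<Longrightarrow> sub_le C (F m) (F n) = sub_le C m n"
  shows "noetherian_object C y"
  unfolding noetherian_object_def
proof (intro conjI allI impI)
  fix m :: "nat \<Rightarrow> _" assume m: "\<forall>n. mono_arr C (m n) \<and> Cod C (m n) = y \<and> sub_le C (m n) (m (Suc n))"
  then have "\<forall>n. mono_arr C (F (m n)) \<and> Cod C (F (m n)) = x \<and> sub_le C (F (m n)) (F (m (Suc n)))"
    using F by simp
  then have "\<exists>N. \<forall>n \<ge> N. sub_le C (F (m n)) (F (m N))"
    using x unfolding noetherian_object_def by (elim conjE, drule_tac spec[of _ "\<lambda>n. F (m n)"]) blast
  then show "\<exists>N. \<forall>n \<ge> N. sub_le C (m n) (m N)" using F m by simp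
qed fact

lemma noetherian_subobjects: "closed_under_subobjects C {x. noetherian_object C x}"
  unfolding closed_under_subobjects_def
proof (intro allI impI CollectI)
  fix i assume i: "mono_arr C i \<and> Cod C i \<in> {x. noetherian_object C x}"
  show "noetherian_object C (Dom C i)"
  proof (rule noetherian_transfer)
    show "noetherian_object C (Cod C i)" "Dom C i \<in> Obj C" using i by auto
    fix m assume m: "mono_arr C m" "Cod C m = Dom C i"
    then show "mono_arr C (i \<cdot> m) \<and> Cod C (i \<cdot> m) = Cod C i" using mono_Comp i by auto
    fix n assume n: "mono_arr C n" "Cod C n = Dom C i"
    show "sub_le C (i \<cdot> m) (i \<cdot> n) = sub_le C m n"
    proof
      assume "sub_le C (i \<cdot> m) (i \<cdot> n)"
      then obtain h where h: "h \<in> Arr C" "Dom C h = Dom C m" "Cod C h = Dom C n" "(i \<cdot> n) \<cdot> h = i \<cdot> m"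
        using m n i by (auto elim: sub_leE)
      have "n \<cdot> h = m" by (rule mono_cancel[of i]) (use h m n i in auto)
      then show "sub_le C m n" using h by (intro sub_leI)
    next
      assume "sub_le C m n"
      then obtain h where h: "h \<in> Arr C" "Dom C h = Dom C m" "Cod C h = Dom C n" "n \<cdot> h = m" by (rule sub_leE)
      then show "sub_le C (i \<cdot> m) (i \<cdot> n)" using m n i by (intro sub_leI[of h]) auto
    qed
  qed
qed

end

context normal_category
begin

lemma epi_zero_cancel:
  "epi_arr C m \<Longrightarrow> g \<in> Arr C \<Longrightarrow> Dom C g = Cod C m \<Longrightarrow> zero_arr C (g \<cdot> m) \<Longrightarrow> zero_arr C g"
  using normal_category.mono_zero_cancel[OF op_normal, of m g] by simp

text \<open>Turns containment into the vanishing of a composite, which can be moved along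
  epimorphisms.\<close>

lemma sub_le_iff_zero:
  assumes "m \<in> Arr C" "is_kernel C n d" "Cod C m = Dom C d"
  shows "sub_le C m n \<longleftrightarrow> zero_arr C (d \<cdot> m)"
proof
  note nD = is_kernelD[OF assms(2)]
  assume "sub_le C m n"
  then obtain h where h: "h \<in> Arr C" "Dom C h = Dom C m" "Cod C h = Dom C n" "n \<cdot> h = m" by (rule sub_leE)
  then show "zero_arr C (d \<cdot> m)" using zero_arr_Comp_right[OF nD(4), of h] nD by auto
next
  assume "zero_arr C (d \<cdot> m)"
  then show "sub_le C m n" by (elim kernel_factor[OF assms(2,1,3)]) (rule sub_leI)
qed

text \<open>\<open>k\<close> and \<open>l\<close> are the preimages of \<open>m\<close> and
  \<open>n\<close> under \<open>e\<close>. Containment is reflected because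
  \<open>c \<cdot> e\<close> is a cokernel of \<open>k\<close>: if \<open>d \<cdot> e\<close> kills
  \<open>k\<close>, it factors through \<open>c \<cdot> e\<close>, and cancelling \<open>e\<close>
  makes \<open>d\<close> factor through \<open>c\<close>.\<close>

lemma preimage_sub_le:
  assumes e: "epi_arr C e" "Cod C e = y" and m: "mono_arr C m" "Cod C m = y" and n: "mono_arr C n" "Cod C n = y"
    and c: "is_cokernel C c m" and d: "is_cokernel C d n"
    and k: "is_kernel C k (c \<cdot> e)" and l: "is_kernel C l (d \<cdot> e)"
  shows "sub_le C k l \<longleftrightarrow> sub_le C m n"
proof -
  note cD = is_cokernelD[OF c] and dD = is_cokernelD[OF d] and kD = is_kernelD[OF k] and lD = is_kernelD[OF l]
  have kc: "Cod C k = Dom C e" using kD cD e m by simp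
  have "sub_le C k l \<longleftrightarrow> zero_arr C ((d \<cdot> e) \<cdot> k)"
    by (rule sub_le_iff_zero[OF kD(1) l]) (use kc dD e n in auto)
  also have "\<dots> \<longleftrightarrow> zero_arr C (d \<cdot> m)"
  proof
    assume z: "zero_arr C ((d \<cdot> e) \<cdot> k)"
    have ce: "epi_arr C (c \<cdot> e)" using epi_Comp[OF e(1) cokernel_epi[OF c]] cD e m by simp
    obtain t where t: "t \<in> Arr C" "Dom C t = Cod C (c \<cdot> e)" "Cod C t = Cod C (d \<cdot> e)" "t \<cdot> (c \<cdot> e) = d \<cdot> e"
      by (rule cokernel_factor[OF epi_cokernel_kernel[OF ce k] _ _ z]) (use dD e n kc in auto)
    have "t \<cdot> c = d" by (rule epi_cancel[OF e(1)]) (use t cD dD e m n in auto)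
    then have "d \<cdot> m = t \<cdot> (c \<cdot> m)" by (intro reassoc[symmetric]) (use t cD e m in auto)
    then show "zero_arr C (d \<cdot> m)" using zero_arr_Comp_left[OF cD(4), of t] t cD e m by simp
  next
    assume z: "zero_arr C (d \<cdot> m)"
    obtain t where t: "t \<in> Arr C" "Dom C t = Cod C c" "Cod C t = Cod C d" "t \<cdot> c = d"
      by (rule cokernel_factor[OF c _ _ z]) (use dD m n in auto)
    then have "(d \<cdot> e) \<cdot> k = t \<cdot> ((c \<cdot> e) \<cdot> k)" using cD e m kc kD by auto
    then show "zero_arr C ((d \<cdot> e) \<cdot> k)" using zero_arr_Comp_left[OF kD(4), of t] t cD e m kD by simp
  qed
  also have "\<dots> \<longleftrightarrow> sub_le C m n"
    by (rule sub_le_iff_zero[OF _ mono_kernel_cokernel[OF n(1) d], symmetric]) (use m n dD in auto)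
  finally show ?thesis .
qed

lemma noetherian_quotients: "closed_under_quotients C {x. noetherian_object C x}"
  unfolding closed_under_quotients_def
proof (intro allI impI CollectI)
  fix e assume e: "epi_arr C e \<and> Dom C e \<in> {x. noetherian_object C x}"
  \<comment> \<open>Choosing a cokernel and a kernel for each subobject makes the preimage the
    function that \<open>noetherian_transfer\<close> asks for.\<close>
  define c where "c m = (SOME c. is_cokernel C c m)" for m
  define k where "k m = (SOME k. is_kernel C k (c m \<cdot> e))" for m
  have c: "is_cokernel C (c m) m" if "mono_arr C m" for m
    unfolding c_def using cokernel_ex[of m] that by (auto intro: someI_ex)
  have k: "is_kernel C (k m) (c m \<cdot> e)" if "mono_arr C m" "Cod C m = Cod C e" for m
    unfolding k_def using kernel_ex[of "c m \<cdot> e"] is_cokernelD[OF c[OF that(1)]] that e by (auto intro: someI_ex)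
  show "noetherian_object C (Cod C e)"
  proof (rule noetherian_transfer)
    show "noetherian_object C (Dom C e)" "Cod C e \<in> Obj C" using e by auto
    fix m assume m: "mono_arr C m" "Cod C m = Cod C e"
    then show "mono_arr C (k m) \<and> Cod C (k m) = Dom C e"
      using k[of m] kernel_mono[of "k m"] is_kernelD[of "k m"] is_cokernelD[OF c, of m] e by simp
    fix n assume n: "mono_arr C n" "Cod C n = Cod C e"
    show "sub_le C (k m) (k n) = sub_le C m n"
      using preimage_sub_le[of e _ m n "c m" "c n" "k m" "k n"] e m n c k by simp
  qed
qed

text \<open>A chain of subobjects of the middle term induces the chain of its intersections with
  \<open>Dom C f\<close> and the chain of its images in \<open>Cod C g\<close>. Once both are
  stationary, so is the original chain.\<close>

lemma noetherian_extensions: "closed_under_extensions C {x. noetherian_object C x}"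
  unfolding closed_under_extensions_def
proof (intro allI impI CollectI)
  fix f g assume asm: "short_exact C f g \<and> Dom C f \<in> {x. noetherian_object C x} \<and> Cod C g \<in> {x. noetherian_object C x}"
  then have f: "is_kernel C f g" and noe: "noetherian_object C (Dom C f)" "noetherian_object C (Cod C g)"
    by (auto simp: short_exact_def)
  note fD = is_kernelD[OF f]
  \<comment> \<open>\<open>t\<close> is the intersection of \<open>m\<close> with
    \<open>Dom C f\<close>, and \<open>k\<close> is the same object regarded as a subobject of
    \<open>Dom C m\<close>. The factorization of \<open>g \<cdot> m\<close> into \<open>e\<close>
    and \<open>j\<close> exhibits the image of \<open>m\<close> in \<open>Cod C g\<close>.\<close>
  define D where "D m k t j e \<longleftrightarrow> mono_arr C m \<and> Cod C m = Cod C f \<and> is_kernel C k (g \<cdot> m) \<and> mono_arr C t \<and> Dom C t = Dom C k \<and>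
    Cod C t = Dom C f \<and> f \<cdot> t = m \<cdot> k \<and> mono_arr C j \<and> Cod C j = Cod C g \<and> epi_arr C e \<and> Dom C e = Dom C m \<and>
    Cod C e = Dom C j \<and> j \<cdot> e = g \<cdot> m" for m k t j e
  have exD: "\<exists>k t j e. D m k t j e" if m: "mono_arr C m" "Cod C m = Cod C f" for m
  proof -
    have gm: "g \<cdot> m \<in> Arr C" "Dom C (g \<cdot> m) = Dom C m" "Cod C (g \<cdot> m) = Cod C g" using m fD by auto
    obtain k where k: "is_kernel C k (g \<cdot> m)" using kernel_ex[OF gm(1)] by blast
    note kD = is_kernelD[OF k]
    have "zero_arr C (g \<cdot> (m \<cdot> k))" using kD m fD by simp
    then obtain t where t: "t \<in> Arr C" "Dom C t = Dom C (m \<cdot> k)" "Cod C t = Dom C f" "f \<cdot> t = m \<cdot> k"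
      by (elim kernel_factor[OF f, rotated -1]) (use kD m fD gm in auto)
    have "mono_arr C (m \<cdot> k)" using mono_Comp[OF kernel_mono[OF k] m(1)] kD gm by simp
    then have "mono_arr C t" using mono_Comp_right[of f t] t fD by simp
    obtain q where q: "is_cokernel C q (g \<cdot> m)" using cokernel_ex[OF gm(1)] by blast
    obtain j e where "mono_arr C j" "Cod C j = Cod C g" "epi_arr C e" "Dom C e = Dom C m" "Cod C e = Dom C j" "j \<cdot> e = g \<cdot> m"
      using image_obtain[OF gm(1) q] gm by metis
    then show ?thesis unfolding D_def using m k t kD gm \<open>mono_arr C t\<close> by auto
  qed
  have mon: "sub_le C t t' \<and> sub_le C j j'" if D: "D m k t j e" "D m' k' t' j' e'" and le: "sub_le C m m'"
    for m k t j e m' k' t' j' e'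
  proof
    obtain h where h: "h \<in> Arr C" "Dom C h = Dom C m" "Cod C h = Dom C m'" "m' \<cdot> h = m" using le by (rule sub_leE)
    have a: "mono_arr C m" "Cod C m = Cod C f" "is_kernel C k (g \<cdot> m)" "mono_arr C t" "Dom C t = Dom C k"
     "Cod C t = Dom C f" "f \<cdot> t = m \<cdot> k" "mono_arr C j" "Cod C j = Cod C g" "epi_arr C e" "Dom C e = Dom C m"
     "Cod C e = Dom C j" "j \<cdot> e = g \<cdot> m" using D(1) by (auto simp: D_def)
    have a': "mono_arr C m'" "Cod C m' = Cod C f" "is_kernel C k' (g \<cdot> m')" "mono_arr C t'" "Dom C t' = Dom C k'"
     "Cod C t' = Dom C f" "f \<cdot> t' = m' \<cdot> k'" "mono_arr C j'" "Cod C j' = Cod C g" "epi_arr C e'" "Dom C e' = Dom C m'"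
     "Cod C e' = Dom C j'" "j' \<cdot> e' = g \<cdot> m'" using D(2) by (auto simp: D_def)
    note kD = is_kernelD[OF a(3)] and kD' = is_kernelD[OF a'(3)]
    have kc: "Cod C k = Dom C m" "Cod C k' = Dom C m'" using kD kD' a a' fD by auto
    have "(g \<cdot> m') \<cdot> (h \<cdot> k) = (g \<cdot> m) \<cdot> k"
      using kD kc h a a' fD reassoc[OF h(4), of k] by simp
    then have "zero_arr C ((g \<cdot> m') \<cdot> (h \<cdot> k))" using kD by simp
    then obtain s where s: "s \<in> Arr C" "Dom C s = Dom C (h \<cdot> k)" "Cod C s = Dom C k'" "k' \<cdot> s = h \<cdot> k"
      using kernel_factor[OF a'(3), of "h \<cdot> k"] kD kc h a a' fD by auto
    have "t' \<cdot> s = t"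
      by (rule mono_cancel[OF kernel_mono[OF f]])
        (use s a a' h kD kD' kc fD reassoc[OF a'(7), of s] reassoc[OF h(4), of k] in auto)
    then show "sub_le C t t'" using s a a' h kD kc by (intro sub_leI[of s]) auto
    \<comment> \<open>Containment of \<open>j\<close> in \<open>j'\<close> means that
      \<open>d\<close> kills \<open>j\<close>. This is tested after the epimorphism
      \<open>e\<close>, since \<open>j \<cdot> e\<close> factors through \<open>j'\<close>.\<close>
    obtain d where d: "is_cokernel C d j'" using cokernel_ex[of j'] a' by auto
    note dD = is_cokernelD[OF d]
    have 1: "j' \<cdot> (e' \<cdot> h) = (g \<cdot> m') \<cdot> h" by (rule reassoc[OF a'(13)]) (use a' h in auto)
    have 2: "(g \<cdot> m') \<cdot> h = g \<cdot> (m' \<cdot> h)" by (rule assoc) (use a' h fD in auto)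
    have 3: "j' \<cdot> (e' \<cdot> h) = j \<cdot> e" unfolding 1 2 h(4) a(13) ..
    have "(d \<cdot> j) \<cdot> e = d \<cdot> (j \<cdot> e)" by (rule assoc) (use dD a a' in auto)
    also have "\<dots> = (d \<cdot> j') \<cdot> (e' \<cdot> h)" unfolding 3[symmetric] by (rule assoc[symmetric]) (use dD a' h in auto)
    finally have "(d \<cdot> j) \<cdot> e = (d \<cdot> j') \<cdot> (e' \<cdot> h)" .
    then have "zero_arr C ((d \<cdot> j) \<cdot> e)" using zero_arr_Comp_right[OF dD(4), of "e' \<cdot> h"] dD a' h by simp
    then have "zero_arr C (d \<cdot> j)" by (rule epi_zero_cancel[OF a(10), rotated -1]) (use dD a a' in auto)
    then show "sub_le C j j'"
      using sub_le_iff_zero[OF _ mono_kernel_cokernel[OF a'(8) d], of j] dD a a' by simp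
  qed
  \<comment> \<open>As in the five lemma, equal intersections and equal images force the inclusion
    \<open>h\<close> of \<open>m\<close> into \<open>m'\<close> to be an isomorphism.\<close>
  have conv: "sub_le C m' m" if D: "D m k t j e" "D m' k' t' j' e'" and le: "sub_le C m m'" "sub_le C t' t" "sub_le C j' j"
    for m k t j e m' k' t' j' e'
  proof -
    obtain h where h: "h \<in> Arr C" "Dom C h = Dom C m" "Cod C h = Dom C m'" "m' \<cdot> h = m" using le(1) by (rule sub_leE)
    obtain s where s: "s \<in> Arr C" "Dom C s = Dom C t'" "Cod C s = Dom C t" "t \<cdot> s = t'" using le(2) by (rule sub_leE)
    obtain r where r: "r \<in> Arr C" "Dom C r = Dom C j'" "Cod C r = Dom C j" "j \<cdot> r = j'" using le(3) by (rule sub_leE)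
    have a: "mono_arr C m" "Cod C m = Cod C f" "is_kernel C k (g \<cdot> m)" "mono_arr C t" "Dom C t = Dom C k"
     "Cod C t = Dom C f" "f \<cdot> t = m \<cdot> k" "mono_arr C j" "Cod C j = Cod C g" "epi_arr C e" "Dom C e = Dom C m"
     "Cod C e = Dom C j" "j \<cdot> e = g \<cdot> m" using D(1) by (auto simp: D_def)
    have a': "mono_arr C m'" "Cod C m' = Cod C f" "is_kernel C k' (g \<cdot> m')" "mono_arr C t'" "Dom C t' = Dom C k'"
     "Cod C t' = Dom C f" "f \<cdot> t' = m' \<cdot> k'" "mono_arr C j'" "Cod C j' = Cod C g" "epi_arr C e'" "Dom C e' = Dom C m'"
     "Cod C e' = Dom C j'" "j' \<cdot> e' = g \<cdot> m'" using D(2) by (auto simp: D_def)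
    note kD = is_kernelD[OF a(3)] and kD' = is_kernelD[OF a'(3)]
    have kc: "Cod C k = Dom C m" "Cod C k' = Dom C m'" using kD kD' a a' fD by auto
    \<comment> \<open>The part of \<open>m'\<close> inside \<open>Dom C f\<close> already lies in
      \<open>m\<close>, so \<open>k'\<close> factors through \<open>h\<close>.\<close>
    have "m' \<cdot> k' = f \<cdot> (t \<cdot> s)" using a' s by simp
    also have "\<dots> = (m \<cdot> k) \<cdot> s" by (rule reassoc) (use a s fD in auto)
    also have "\<dots> = m \<cdot> (k \<cdot> s)" using a s kD kc by simp
    also have "\<dots> = m' \<cdot> (h \<cdot> (k \<cdot> s))" by (rule reassoc[symmetric]) (use h a a' s kD kc in auto)
    finally have mk: "m' \<cdot> k' = m' \<cdot> (h \<cdot> (k \<cdot> s))" .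
    have k': "k' = h \<cdot> (k \<cdot> s)"
      by (rule mono_cancel[OF a'(1) mk]) (use a a' h s kD kD' kc in auto)
    have kere: "is_kernel C k' e'"
    proof (rule is_kernelI[OF kernel_mono[OF a'(3)]])
      have "zero_arr C (j' \<cdot> (e' \<cdot> k'))"
        using kD' a' kc fD reassoc[OF a'(13), of k'] by simp
      then show "zero_arr C (e' \<cdot> k')" by (rule mono_zero_cancel[OF a'(8), rotated -1]) (use a' kD' kc in auto)
      fix u assume u: "u \<in> Arr C" "Cod C u = Dom C e'" "zero_arr C (e' \<cdot> u)"
      have "zero_arr C (j' \<cdot> (e' \<cdot> u))" using zero_arr_Comp_left[OF u(3), of j'] u a' by simp
      then have "zero_arr C ((g \<cdot> m') \<cdot> u)" using reassoc[OF a'(13), of u] u a' fD by simp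
      then obtain h where "h \<in> Arr C" "Dom C h = Dom C u" "Cod C h = Dom C k'" "k' \<cdot> h = u"
        using kernel_factor[OF a'(3) u(1)] u a' kD' kc by metis
      then show "\<exists>h\<in>Arr C. Dom C h = Dom C u \<and> Cod C h = Dom C k' \<and> k' \<cdot> h = u" by blast
    qed (use a' kD' kc in auto)
    have coke: "is_cokernel C e' k'" by (rule epi_cokernel_kernel[OF a'(10) kere])
    have "j \<cdot> (r \<cdot> (e' \<cdot> h)) = j' \<cdot> (e' \<cdot> h)" by (rule reassoc) (use r a a' h in auto)
    also have "\<dots> = (g \<cdot> m') \<cdot> h" by (rule reassoc) (use a' h in auto)
    also have "\<dots> = j \<cdot> e" using a a' h fD by simp
    finally have rr: "j \<cdot> (r \<cdot> (e' \<cdot> h)) = j \<cdot> e" .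
    have re: "r \<cdot> (e' \<cdot> h) = e" by (rule mono_cancel[OF a(8) rr]) (use r a a' h in auto)
    then have "epi_arr C r" using epi_Comp_left[of r "e' \<cdot> h"] r a a' h by simp
    moreover have "mono_arr C r" using mono_Comp_right[of j r] r a a' by simp
    ultimately have "is_iso C r" by (intro mono_epi_iso)
    then obtain r' where r': "r' \<in> Arr C" "Dom C r' = Cod C r" "Cod C r' = Dom C r" "r' \<cdot> r = Id C (Dom C r)"
      by (rule is_isoE)
    have "epi_arr C h"
    proof (rule epiI[OF h(1)])
      fix u assume u: "u \<in> Arr C" "Dom C u = Cod C h" "zero_arr C (u \<cdot> h)"
      \<comment> \<open>If \<open>u\<close> kills \<open>h\<close>, it kills \<open>k'\<close> and
        hence equals some \<open>v \<cdot> e'\<close>. The isomorphism \<open>r\<close> between the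
        images rewrites \<open>u \<cdot> h\<close> as \<open>(v \<cdot> r') \<cdot> e\<close>, and
        cancelling \<open>e\<close> makes \<open>v \<cdot> r'\<close> zero, hence also
        \<open>u\<close>.\<close>
      have "u \<cdot> k' = (u \<cdot> h) \<cdot> (k \<cdot> s)" unfolding k' using u h s a kD kc by simp
      then have "zero_arr C (u \<cdot> k')" using zero_arr_Comp_right[OF u(3), of "k \<cdot> s"] u h s a kD kc by simp
      then obtain v where v: "v \<in> Arr C" "Dom C v = Cod C e'" "Cod C v = Cod C u" "v \<cdot> e' = u"
        using cokernel_factor[OF coke u(1)] u h kc by metis
      have "(v \<cdot> r') \<cdot> e = (v \<cdot> (r' \<cdot> r)) \<cdot> (e' \<cdot> h)" using re[symmetric] v r' r a a' h reassoc[OF r'(4)] by simp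
      also have "\<dots> = u \<cdot> h" using v r' r a' h reassoc[OF v(4), of h] by simp
      finally have "zero_arr C ((v \<cdot> r') \<cdot> e)" using u by simp
      then have "zero_arr C (v \<cdot> r')" by (rule epi_zero_cancel[OF a(10), rotated -1]) (use v r' r a a' in auto)
      then have "zero_arr C ((v \<cdot> r') \<cdot> (r \<cdot> e'))" using zero_arr_Comp_right[of "v \<cdot> r'" "r \<cdot> e'"] v r' r a a' by simp
      moreover have "(v \<cdot> r') \<cdot> (r \<cdot> e') = u" using v r' r a a' reassoc[OF r'(4), of e'] by simp
      ultimately show "zero_arr C u" by simp
    qed
    moreover have "mono_arr C h" using mono_Comp_right[of m' h] h a a' by simp
    ultimately have "is_iso C h" by (intro mono_epi_iso)
    then obtain h' where h': "h' \<in> Arr C" "Dom C h' = Cod C h" "Cod C h' = Dom C h" "h \<cdot> h' = Id C (Cod C h)"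
      by (rule is_isoE)
    have "m \<cdot> h' = m' \<cdot> (h \<cdot> h')" by (rule reassoc[symmetric]) (use h h' a' in auto)
    then show "sub_le C m' m" using h' h a' by (intro sub_leI[of h']) auto
  qed
  show "noetherian_object C (Cod C f)"
    unfolding noetherian_object_def
  proof (intro conjI allI impI)
    show "Cod C f \<in> Obj C" using fD by simp
    fix m :: "nat \<Rightarrow> _" assume m: "\<forall>n. mono_arr C (m n) \<and> Cod C (m n) = Cod C f \<and> sub_le C (m n) (m (Suc n))"
    then have "\<forall>n. \<exists>k t j e. D (m n) k t j e" using exD by blast
    then obtain k t j e where D: "\<And>n. D (m n) (k n) (t n) (j n) (e n)" by metis
    have t: "\<forall>n. mono_arr C (t n) \<and> Cod C (t n) = Dom C f \<and> sub_le C (t n) (t (Suc n))"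
      using mon[OF D D] m D unfolding D_def by blast
    have j: "\<forall>n. mono_arr C (j n) \<and> Cod C (j n) = Cod C g \<and> sub_le C (j n) (j (Suc n))"
      using mon[OF D D] m D unfolding D_def by blast
    obtain N1 where N1: "\<And>n. n \<ge> N1 \<Longrightarrow> sub_le C (t n) (t N1)" using noe(1) t unfolding noetherian_object_def by blast
    obtain N2 where N2: "\<And>n. n \<ge> N2 \<Longrightarrow> sub_le C (j n) (j N2)" using noe(2) j unfolding noetherian_object_def by blast
    have "sub_le C (m n) (m (max N1 N2))" if n: "n \<ge> max N1 N2" for n
    proof (rule conv[OF D D])
      show "sub_le C (m (max N1 N2)) (m n)" by (rule chain_sub_le) (use m n in auto)
      have "sub_le C (t N1) (t (max N1 N2))" by (rule chain_sub_le) (use t in auto)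
      then show "sub_le C (t n) (t (max N1 N2))" using sub_le_trans[OF N1[of n]] t n by auto
      have "sub_le C (j N2) (j (max N1 N2))" by (rule chain_sub_le) (use j in auto)
      then show "sub_le C (j n) (j (max N1 N2))" using sub_le_trans[OF N2[of n]] j n by auto
    qed
    then show "\<exists>N. \<forall>n \<ge> N. sub_le C (m n) (m N)" by blast
  qed
qed

lemma zero_noetherian:
  assumes z: "is_zero C z" shows "noetherian_object C z"
  unfolding noetherian_object_def
proof (intro conjI allI impI)
  fix m :: "nat \<Rightarrow> _" assume m: "\<forall>n. mono_arr C (m n) \<and> Cod C (m n) = z \<and> sub_le C (m n) (m (Suc n))"
  have "sub_le C (m n) (m 0)" for n
  proof -
    obtain h where h: "zero_arr C h" "h \<in> Arr C" "Dom C h = Dom C (m n)" "Cod C h = Dom C (m 0)"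
      using zero_obtain[of "Dom C (m n)" "Dom C (m 0)"] m by auto
    moreover have "m 0 \<cdot> h = m n" by (rule terminal_unique[OF z]) (use h m in auto)
    ultimately show ?thesis by (intro sub_leI)
  qed
  then show "\<exists>N. \<forall>n \<ge> N. sub_le C (m n) (m N)" by blast
qed (rule is_zero_Obj[OF z])

end

section \<open>Finitely presented objects\<close>

context normal_category
begin

lemma epi_initial_mono:
  assumes "is_zero C z" "b \<in> Arr C" "Dom C b = z" shows "mono_arr C b"
proof (rule monoI)
  fix g assume "g \<in> Arr C" "Cod C g = Dom C b"
  then show "zero_arr C g" using is_zero_arr[OF assms(1), of g] assms by simp
qed fact

text \<open>The quotient of \<open>x\<close> by the sum of the images of finitely many morphisms.\<close>

lemma finite_quotient_ex:
  assumes x: "x \<in> Obj C" and J: "finite J" "\<And>h. h \<in> J \<Longrightarrow> h \<in> Arr C \<and> Cod C h = x \<and> noetherian_object C (Dom C h)"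
  shows "\<exists>q. epi_arr C q \<and> Dom C q = x \<and> (\<forall>h\<in>J. zero_arr C (q \<cdot> h)) \<and>
    (\<forall>g\<in>Arr C. Dom C g = x \<longrightarrow> (\<forall>h\<in>J. zero_arr C (g \<cdot> h)) \<longrightarrow>
      (\<exists>t\<in>Arr C. Dom C t = Cod C q \<and> Cod C t = Cod C g \<and> t \<cdot> q = g)) \<and>
    (\<exists>k. is_kernel C k q \<and> noetherian_object C (Dom C k))"
  using J
proof (induction J rule: finite_induct)
  case empty
  obtain z where z: "is_zero C z" using zero_ex by blast
  obtain b where b: "b \<in> Arr C" "Dom C b = z" "Cod C b = x" by (rule initial_ex[OF z x])
  have "is_kernel C b (Id C x)"
  proof (rule is_kernelI[OF epi_initial_mono[OF z b(1,2)]])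
    show "zero_arr C (Id C x \<cdot> b)" using is_zero_arr[OF z, of b] b by simp
    fix g assume g: "g \<in> Arr C" "Cod C g = Dom C (Id C x)" "zero_arr C (Id C x \<cdot> g)"
    obtain t where t: "t \<in> Arr C" "Dom C t = Dom C g" "Cod C t = z" using terminal_ex[OF z, of "Dom C g"] g by auto
    have "b \<cdot> t = g" by (rule zero_arr_unique) (use zero_arrI[OF z, of t b] t b g x in auto)
    then show "\<exists>h\<in>Arr C. Dom C h = Dom C g \<and> Cod C h = Dom C b \<and> b \<cdot> h = g" using t b by auto
  qed (use b x in auto)
  then show ?case using b zero_noetherian[OF z] x iso_epi[OF Id_iso[OF x]]
    by (intro exI[of _ "Id C x"]) (auto intro: exI[of _ b])
next
  case (insert h J)
  then obtain q k where q: "epi_arr C q" "Dom C q = x" "\<And>h. h \<in> J \<Longrightarrow> zero_arr C (q \<cdot> h)"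
    "\<And>g. g \<in> Arr C \<Longrightarrow> Dom C g = x \<Longrightarrow> (\<forall>h\<in>J. zero_arr C (g \<cdot> h)) \<Longrightarrow>
      (\<exists>t\<in>Arr C. Dom C t = Cod C q \<and> Cod C t = Cod C g \<and> t \<cdot> q = g)"
    and k: "is_kernel C k q" "noetherian_object C (Dom C k)"
    by auto
  have h: "h \<in> Arr C" "Cod C h = x" "noetherian_object C (Dom C h)" using insert.prems by auto
  obtain r where r: "is_cokernel C r (q \<cdot> h)" using cokernel_ex[of "q \<cdot> h"] q h by auto
  note rD = is_cokernelD[OF r]
  have rq: "r \<cdot> q \<in> Arr C" "Dom C (r \<cdot> q) = x" "Cod C (r \<cdot> q) = Cod C r" using rD q h by auto
  obtain n where n: "is_kernel C n (r \<cdot> q)" using kernel_ex[OF rq(1)] by blast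
  \<comment> \<open>\<open>n\<close> is the sum of \<open>k\<close> and the image of
    \<open>h\<close>; \<open>adjoin\<close> applies with the class of noetherian objects as
    \<open>P\<close>.\<close>
  have "Dom C n \<in> {x. noetherian_object C x}"
    by (rule adjoin(1)[OF noetherian_quotients noetherian_extensions k(1) epi_cokernel_kernel[OF q(1) k(1)] h(1) _ r n])
      (use k h q is_kernelD[OF k(1)] in auto)
  moreover have "epi_arr C (r \<cdot> q)" using epi_Comp[OF q(1) cokernel_epi[OF r]] rD q h by simp
  moreover have "zero_arr C ((r \<cdot> q) \<cdot> h')" if h': "h' \<in> insert h J" for h'
  proof -
    have h'': "h' \<in> Arr C" "Cod C h' = x" using insert.prems h' by auto
    have "zero_arr C (r \<cdot> (q \<cdot> h'))"
      using h' rD zero_arr_Comp_left[OF q(3), of h' r] h'' q h by (cases "h' = h") auto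
    then show ?thesis using h'' rD q h by simp
  qed
  moreover have "\<exists>t\<in>Arr C. Dom C t = Cod C (r \<cdot> q) \<and> Cod C t = Cod C g \<and> t \<cdot> (r \<cdot> q) = g"
    if g: "g \<in> Arr C" "Dom C g = x" "\<forall>h\<in>insert h J. zero_arr C (g \<cdot> h)" for g
  proof -
    obtain t where t: "t \<in> Arr C" "Dom C t = Cod C q" "Cod C t = Cod C g" "t \<cdot> q = g"
      using q(4)[OF g(1,2)] g(3) by auto
    have "t \<cdot> (q \<cdot> h) = g \<cdot> h" by (rule reassoc) (use t q h in auto)
    then have "zero_arr C (t \<cdot> (q \<cdot> h))" using g by simp
    then obtain s where s: "s \<in> Arr C" "Dom C s = Cod C r" "Cod C s = Cod C t" "s \<cdot> r = t"
      by (rule cokernel_factor[OF r, rotated -2]) (use t q h in auto)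
    have "s \<cdot> (r \<cdot> q) = t \<cdot> q" by (rule reassoc) (use s rD q h in auto)
    then show ?thesis using s t rq by auto
  qed
  ultimately show ?case using n rq by (intro exI[of _ "r \<cdot> q"]) auto
qed

text \<open>In the zero limit, a quotient map of \<open>x\<close> and a zero morphism become equal.
  Finite presentation makes them equal at some stage \<open>k\<close>; there \<open>q k\<close> is
  zero, so its noetherian kernel is all of \<open>x\<close>.\<close>

theorem finitely_presented_noetherian:
  fixes \<kappa> :: "'u rel"
  assumes \<kappa>: "inaccessible \<kappa>" "locally_small \<kappa> C" "locally_noetherian \<kappa> C" and x: "finitely_presented \<kappa> C x"
  shows "noetherian_object C x"
proof -
  have xO: "x \<in> Obj C" using x by (simp add: finitely_presented_def)
  obtain S where S: "small \<kappa> S" "\<And>s. s \<in> S \<Longrightarrow> noetherian_object C s" "generating C S"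
    using \<kappa>(3) by (auto simp: locally_noetherian_def)
  have SO: "S \<subseteq> Obj C" using S(3) by (simp add: generating_def)
  \<comment> \<open>All morphisms from generators to \<open>x\<close>. The direct system is indexed
    by the finite subsets of \<open>H\<close>, encoded in \<open>'u\<close> by \<open>enc\<close>
    and recovered by \<open>dec\<close>.\<close>
  define H where "H = (\<Union>s\<in>S. homs C s x)"
  have "small \<kappa> H" unfolding H_def
    by (rule small_UNION[OF \<kappa>(1) S(1)]) (use SO xO \<kappa>(2) in \<open>auto simp: locally_small_def\<close>)
  then have smF: "small \<kappa> (Fpow H)" using small_subset[OF small_Pow[OF \<kappa>(1)], of H "Fpow H"] by (auto simp: Fpow_def)
  obtain enc :: "'a set \<Rightarrow> 'u" where enc: "inj_on enc (Fpow H)" using small_encode[OF \<kappa>(1) smF] .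
  define I where "I = enc ` Fpow H"
  define dec where "dec = inv_into (Fpow H) enc"
  have dec: "dec i \<in> Fpow H" if "i \<in> I" for i using that unfolding I_def dec_def by (rule inv_into_into)
  have deci [simp]: "dec (enc J) = J" if "J \<in> Fpow H" for J unfolding dec_def using enc that by simp
  have smI: "small \<kappa> I" unfolding I_def by (rule small_image[OF smF])
  have Hh: "h \<in> Arr C \<and> Cod C h = x \<and> noetherian_object C (Dom C h)" if "h \<in> H" for h
    using that S(2) by (auto simp: H_def hom_iff)
  define P where "P J q \<longleftrightarrow> epi_arr C q \<and> Dom C q = x \<and> (\<forall>h\<in>J. zero_arr C (q \<cdot> h)) \<and>
    (\<forall>g\<in>Arr C. Dom C g = x \<longrightarrow> (\<forall>h\<in>J. zero_arr C (g \<cdot> h)) \<longrightarrow>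
      (\<exists>t\<in>Arr C. Dom C t = Cod C q \<and> Cod C t = Cod C g \<and> t \<cdot> q = g)) \<and>
    (\<exists>k. is_kernel C k q \<and> noetherian_object C (Dom C k))" for J q
  have "\<exists>q. P (dec i) q" if "i \<in> I" for i
    unfolding P_def by (rule finite_quotient_ex[OF xO]) (use dec[OF that] Hh in \<open>auto simp: Fpow_def\<close>)
  then have "\<forall>i. \<exists>q. i \<in> I \<longrightarrow> P (dec i) q" by blast
  then obtain q where q: "\<And>i. i \<in> I \<Longrightarrow> P (dec i) (q i)" by metis
  have qe: "epi_arr C (q i)" "q i \<in> Arr C" "Dom C (q i) = x" if "i \<in> I" for i
    using q[OF that] unfolding P_def by auto
  have qz: "zero_arr C (q i \<cdot> h)" if "i \<in> I" "h \<in> dec i" for i h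
    using q[OF that(1)] that(2) unfolding P_def by blast
  have qf: "\<exists>t\<in>Arr C. Dom C t = Cod C (q i) \<and> Cod C t = Cod C g \<and> t \<cdot> q i = g"
    if "i \<in> I" "g \<in> Arr C" "Dom C g = x" "\<And>h. h \<in> dec i \<Longrightarrow> zero_arr C (g \<cdot> h)" for i g
    using q[OF that(1)] that(2-) unfolding P_def by blast
  \<comment> \<open>More morphisms to kill means a further quotient, whence the transition maps
    \<open>\<phi>\<close>.\<close>
  define leq where "leq i j \<longleftrightarrow> dec i \<subseteq> dec j" for i j
  have "\<exists>t. i \<in> I \<longrightarrow> j \<in> I \<longrightarrow> leq i j \<longrightarrow> t \<in> Arr C \<and> Dom C t = Cod C (q i) \<and> Cod C t = Cod C (q j) \<and> t \<cdot> q i = q j" for i j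
  proof (cases "i \<in> I \<and> j \<in> I \<and> leq i j")
    case True
    then show ?thesis using qf[of i "q j"] qe[of j] qz[of j] unfolding leq_def by blast
  qed blast
  then obtain \<phi> where \<phi>: "\<And>i j. i \<in> I \<Longrightarrow> j \<in> I \<Longrightarrow> leq i j \<Longrightarrow>
      \<phi> i j \<in> Arr C \<and> Dom C (\<phi> i j) = Cod C (q i) \<and> Cod C (\<phi> i j) = Cod C (q j) \<and> \<phi> i j \<cdot> q i = q j"
    by metis
  obtain z where z: "is_zero C z" using zero_ex by blast
  have "\<exists>t. i \<in> I \<longrightarrow> t \<in> Arr C \<and> Dom C t = Cod C (q i) \<and> Cod C t = z" for i
  proof (cases "i \<in> I")
    case True
    obtain t where "t \<in> Arr C" "Dom C t = Cod C (q i)" "Cod C t = z" by (rule terminal_ex[OF z, of "Cod C (q i)"]) (use qe True in auto)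
    then show ?thesis by blast
  qed blast
  then obtain \<iota> where \<iota>: "\<And>i. i \<in> I \<Longrightarrow> \<iota> i \<in> Arr C \<and> Dom C (\<iota> i) = Cod C (q i) \<and> Cod C (\<iota> i) = z" by metis
  have UN: "\<exists>k\<in>I. dec k = dec i \<union> dec j" if "i \<in> I" "j \<in> I" for i j
  proof -
    have "dec i \<union> dec j \<in> Fpow H" using dec that by (auto simp: Fpow_def)
    then show ?thesis by (intro bexI[of _ "enc (dec i \<union> dec j)"]) (auto simp: I_def)
  qed
  have e0: "{} \<in> Fpow H" "enc {} \<in> I" "dec (enc {}) = {}" by (auto simp: Fpow_def I_def)
  have dirset: "directed_set I leq" unfolding directed_set_def
  proof (intro conjI ballI impI)
    show "I \<noteq> {}" using e0 by blast
    fix i j assume "i \<in> I" "j \<in> I"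
    then obtain k where "k \<in> I" "dec k = dec i \<union> dec j" using UN by blast
    then show "\<exists>k\<in>I. leq i k \<and> leq j k" by (intro bexI[of _ k]) (auto simp: leq_def)
  qed (auto simp: leq_def)
  have dirsys: "direct_system C I leq (\<lambda>i. Cod C (q i)) \<phi>"
    unfolding direct_system_def
  proof (intro conjI ballI impI dirset)
    fix i assume i: "i \<in> I"
    show "Cod C (q i) \<in> Obj C" using qe i by simp
    have l: "leq i i" by (simp add: leq_def)
    show "\<phi> i i = Id C (Cod C (q i))"
      by (rule epi_cancel[OF qe(1)[OF i]]) (use \<phi>[OF i i l] qe[OF i] in auto)
    fix j assume j: "j \<in> I"
    show "leq i j \<Longrightarrow> \<phi> i j \<in> homs C (Cod C (q i)) (Cod C (q j))" using \<phi>[OF i j] by (simp add: hom_iff)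
    fix k assume k: "k \<in> I" and "leq i j \<and> leq j k"
    then have l: "leq i j" "leq j k" "leq i k" by (auto simp: leq_def)
    have "\<phi> j k \<cdot> (\<phi> i j \<cdot> q i) = \<phi> i k \<cdot> q i" using \<phi>[OF i j l(1)] \<phi>[OF j k l(2)] \<phi>[OF i k l(3)] by simp
    then have "(\<phi> j k \<cdot> \<phi> i j) \<cdot> q i = \<phi> i k \<cdot> q i"
      using \<phi>[OF i j l(1)] \<phi>[OF j k l(2)] qe[OF i] by simp
    then show "\<phi> j k \<cdot> \<phi> i j = \<phi> i k"
      by (rule epi_cancel[OF qe(1)[OF i]]) (use \<phi>[OF i j l(1)] \<phi>[OF j k l(2)] \<phi>[OF i k l(3)] qe[OF i] in auto)
  qed
  have "is_direct_limit C I leq (\<lambda>i. Cod C (q i)) \<phi> z \<iota>"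
    unfolding is_direct_limit_def
  proof (intro conjI ballI impI dirsys is_zero_Obj[OF z] allI)
    fix i assume i: "i \<in> I"
    show "\<iota> i \<in> homs C (Cod C (q i)) z" using \<iota>[OF i] by (simp add: hom_iff)
    fix j assume j: "j \<in> I" and l: "leq i j"
    show "\<iota> j \<cdot> \<phi> i j = \<iota> i"
      by (rule terminal_unique[OF z]) (use \<phi>[OF i j l] \<iota>[OF i] \<iota>[OF j] in auto)
  next
    fix d g assume d: "d \<in> Obj C" and g: "(\<forall>i\<in>I. g i \<in> homs C (Cod C (q i)) d) \<and> (\<forall>i\<in>I. \<forall>j\<in>I. leq i j \<longrightarrow> g j \<cdot> \<phi> i j = g i)"
    have gD: "g i \<in> Arr C" "Dom C (g i) = Cod C (q i)" "Cod C (g i) = d" if "i \<in> I" for i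
      using g that by (auto simp: hom_iff)
    have mono: "g j \<cdot> q j = g i \<cdot> q i" if i: "i \<in> I" and j: "j \<in> I" and l: "leq i j" for i j
    proof -
      have "g j \<cdot> q j = g j \<cdot> (\<phi> i j \<cdot> q i)" using \<phi>[OF i j l] by simp
      also have "\<dots> = g i \<cdot> q i" by (rule reassoc) (use \<phi>[OF i j l] gD[OF i] gD[OF j] g i j l qe[OF i] in auto)
      finally show ?thesis .
    qed
    \<comment> \<open>All composites \<open>g i \<cdot> q i\<close> coincide with the one at the
      empty set. \<open>G\<close> kills each \<open>h\<close> in \<open>H\<close> because it also
      passes through the quotient indexed by the singleton of \<open>h\<close>; as \<open>S\<close>
      generates, \<open>G\<close> is zero.\<close>
    define G where "G = g (enc {}) \<cdot> q (enc {})"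
    have Geq: "g i \<cdot> q i = G" if i: "i \<in> I" for i
      unfolding G_def by (rule mono) (use e0 i in \<open>auto simp: leq_def\<close>)
    have GA: "G \<in> Arr C" "Dom C G = x" "Cod C G = d" unfolding G_def using gD[OF e0(2)] qe[OF e0(2)] by auto
    obtain w where w: "zero_arr C w" "w \<in> Arr C" "Dom C w = x" "Cod C w = d" by (rule zero_obtain[OF xO d])
    have "G \<cdot> h = w \<cdot> h" if s: "s \<in> S" and h: "h \<in> homs C s x" for s h
    proof (rule zero_arr_unique)
      have hA: "h \<in> Arr C" "Cod C h = x" "h \<in> H" using h s by (auto simp: hom_iff H_def)
      have F: "{h} \<in> Fpow H" using hA by (auto simp: Fpow_def)
      define i where "i = enc {h}"
      have i: "i \<in> I" "dec i = {h}" using F by (auto simp: i_def I_def)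
      have "zero_arr C (g i \<cdot> (q i \<cdot> h))"
        by (rule zero_arr_Comp_left[OF qz]) (use i gD[OF i(1)] qe[OF i(1)] hA in auto)
      moreover have "g i \<cdot> (q i \<cdot> h) = G \<cdot> h" by (rule reassoc) (use Geq i gD[OF i(1)] qe[OF i(1)] hA in auto)
      ultimately show "zero_arr C (G \<cdot> h)" by simp
      show "zero_arr C (w \<cdot> h)" using w hA by (intro zero_arr_Comp_right) auto
    qed (use h w GA in \<open>auto simp: hom_iff\<close>)
    moreover have "G \<in> homs C x d" "w \<in> homs C x d" using GA w by (auto simp: hom_iff)
    ultimately have "G = w" using S(3) unfolding generating_def by blast
    have gz: "zero_arr C (g i)" if i: "i \<in> I" for i
      by (rule epi_zero_cancel[OF qe(1)[OF i]]) (use gD[OF i] Geq[OF i] \<open>G = w\<close> w in auto)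
    obtain b where b: "b \<in> Arr C" "Dom C b = z" "Cod C b = d" by (rule initial_ex[OF z d])
    show "\<exists>!h. h \<in> homs C z d \<and> (\<forall>i\<in>I. h \<cdot> \<iota> i = g i)"
    proof (rule ex1I[of _ b])
      have "b \<cdot> \<iota> i = g i" if i: "i \<in> I" for i
        by (rule zero_arr_unique[OF zero_arrI[OF z] gz[OF i]]) (use b \<iota>[OF i] gD[OF i] in auto)
      then show "b \<in> homs C z d \<and> (\<forall>i\<in>I. b \<cdot> \<iota> i = g i)" using b by (auto simp: hom_iff)
      fix h assume "h \<in> homs C z d \<and> (\<forall>i\<in>I. h \<cdot> \<iota> i = g i)"
      then show "h = b" using initial_unique[OF z, of h b] b by (auto simp: hom_iff)
    qed
  qed
  with x smI have fp: "\<And>i j g h. i \<in> I \<Longrightarrow> j \<in> I \<Longrightarrow> g \<in> homs C x (Cod C (q i)) \<Longrightarrow> h \<in> homs C x (Cod C (q j)) \<Longrightarrow>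
           \<iota> i \<cdot> g = \<iota> j \<cdot> h \<Longrightarrow> \<exists>k \<in> I. leq i k \<and> leq j k \<and> \<phi> i k \<cdot> g = \<phi> j k \<cdot> h"
    unfolding finitely_presented_def by blast
  \<comment> \<open>At the index of the empty set, \<open>q i\<close> is compared with the zero
    morphism \<open>w\<close>; both have the same composite into \<open>z\<close>.\<close>
  define i where "i = enc {}"
  have i: "i \<in> I" using e0 by (simp add: i_def)
  obtain w where w: "zero_arr C w" "w \<in> Arr C" "Dom C w = x" "Cod C w = Cod C (q i)"
    using zero_obtain[OF xO, of "Cod C (q i)"] qe[OF i] by auto
  have "\<iota> i \<cdot> q i = \<iota> i \<cdot> w" by (rule terminal_unique[OF z]) (use \<iota>[OF i] qe[OF i] w in auto)
  then obtain k where k: "k \<in> I" "leq i k" "\<phi> i k \<cdot> q i = \<phi> i k \<cdot> w"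
    using fp[OF i i, of "q i" w] qe[OF i] w by (auto simp: hom_iff)
  have "zero_arr C (\<phi> i k \<cdot> w)" using \<phi>[OF i k(1,2)] w by (intro zero_arr_Comp_left) auto
  then have zq: "zero_arr C (q k)" using k \<phi>[OF i k(1,2)] by simp
  obtain n where n: "is_kernel C n (q k)" "noetherian_object C (Dom C n)" using q[OF k(1)] by (auto simp: P_def)
  note nD = is_kernelD[OF n(1)]
  obtain s where s: "s \<in> Arr C" "Dom C s = x" "Cod C s = Dom C n" "n \<cdot> s = Id C x"
    using kernel_factor[OF n(1), of "Id C x"] zq qe[OF k(1)] xO by auto
  have "epi_arr C n" using split_epi[of s n] s nD qe[OF k(1)] by simp
  then show ?thesis using noetherian_quotients n(2) nD qe[OF k(1)] unfolding closed_under_quotients_def by auto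
qed

end

section \<open>Exactness of the tensor product and the internal Hom\<close>

context category
begin

text \<open>Being a cokernel is invariant under isomorphism of diagrams. This carries right
  exactness across the symmetry from one tensor factor to the other.\<close>

lemma cokernel_conj:
  assumes q: "is_cokernel C q f" and f': "f' \<in> Arr C" "q' \<in> Arr C" "Dom C q' = Cod C f'"
    and k: "is_iso C k" "Dom C k = Dom C f" "Cod C k = Dom C f'"
    and i: "is_iso C i" "Dom C i = Cod C f" "Cod C i = Cod C f'"
    and j: "is_iso C j" "Dom C j = Cod C q" "Cod C j = Cod C q'"
    and e: "f' \<cdot> k = i \<cdot> f" "q' \<cdot> i = j \<cdot> q"
  shows "is_cokernel C q' f'"
proof -
  note qD = is_cokernelD[OF q]
  obtain k' where k': "k \<in> Arr C" "k' \<in> Arr C" "Dom C k' = Cod C k" "Cod C k' = Dom C k" "k \<cdot> k' = Id C (Cod C k)"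
    using k(1) by (rule is_isoE)
  obtain i' where i': "i \<in> Arr C" "i' \<in> Arr C" "Dom C i' = Cod C i" "Cod C i' = Dom C i" "i \<cdot> i' = Id C (Cod C i)"
    using i(1) by (rule is_isoE)
  obtain j' where j': "j \<in> Arr C" "j' \<in> Arr C" "Dom C j' = Cod C j" "Cod C j' = Dom C j" "j' \<cdot> j = Id C (Dom C j)"
    using j(1) by (rule is_isoE)
  show ?thesis
  proof (rule is_cokernelI)
    have "epi_arr C (j \<cdot> q)" using epi_Comp[OF cokernel_epi[OF q] iso_epi[OF j(1)]] j by simp
    then have "epi_arr C (q' \<cdot> i)" using e by simp
    then show "epi_arr C q'" by (rule epi_Comp_left) (use i' i f' in auto)
    have "f' = f' \<cdot> (k \<cdot> k')" using k' k f' by simp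
    also have "\<dots> = (i \<cdot> f) \<cdot> k'" by (rule reassoc) (use e k' k f' in auto)
    also have "\<dots> = i \<cdot> (f \<cdot> k')" by (rule assoc) (use i' i k' k qD in auto)
    finally have f'e: "f' = i \<cdot> (f \<cdot> k')" .
    have "q' \<cdot> f' = (j \<cdot> q) \<cdot> (f \<cdot> k')" unfolding f'e by (rule reassoc) (use e i' i k' k qD f' in auto)
    also have "\<dots> = j \<cdot> ((q \<cdot> f) \<cdot> k')" using j' j k' k qD by simp
    finally have "q' \<cdot> f' = j \<cdot> ((q \<cdot> f) \<cdot> k')" .
    moreover have "zero_arr C (j \<cdot> ((q \<cdot> f) \<cdot> k'))"
      by (intro zero_arr_Comp_left zero_arr_Comp_right qD(4)) (use j' j k' k qD in auto)
    ultimately show "zero_arr C (q' \<cdot> f')" by simp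
    fix g assume g: "g \<in> Arr C" "Dom C g = Cod C f'" "zero_arr C (g \<cdot> f')"
    have "(g \<cdot> i) \<cdot> f = (g \<cdot> f') \<cdot> k" using e g i' i k' k f' qD by simp
    then have "zero_arr C ((g \<cdot> i) \<cdot> f)" using zero_arr_Comp_right[OF g(3) k'(1)] k f' g by simp
    then obtain t where t: "t \<in> Arr C" "Dom C t = Cod C q" "Cod C t = Cod C (g \<cdot> i)" "t \<cdot> q = g \<cdot> i"
      by (rule cokernel_factor[OF q, rotated -2]) (use g i i' qD in auto)
    have "((t \<cdot> j') \<cdot> q') \<cdot> i = (t \<cdot> j') \<cdot> (j \<cdot> q)"
      unfolding e(2)[symmetric] by (rule assoc) (use t j' j i i' f' in auto)
    also have "\<dots> = ((t \<cdot> j') \<cdot> j) \<cdot> q" by (rule assoc[symmetric]) (use t j' j qD in auto)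
    also have "(t \<cdot> j') \<cdot> j = t \<cdot> (j' \<cdot> j)" by (rule assoc) (use t j' j in auto)
    also have "\<dots> \<cdot> q = g \<cdot> i" unfolding j'(5) using t j qD by simp
    finally have "(t \<cdot> j') \<cdot> q' = g"
      by (rule epi_cancel[OF iso_epi[OF i(1)]]) (use t j' j g i i' f' in auto)
    then show "\<exists>h\<in>Arr C. Dom C h = Cod C q' \<and> Cod C h = Cod C g \<and> h \<cdot> q' = g"
      using t j' j g i i' by (intro bexI[of _ "t \<cdot> j'"]) auto
  qed (use f' in auto)
qed

text \<open>Every morphism into or out of \<open>x\<close> is a composite with the identity, hence
  zero, and parallel zero morphisms agree.\<close>

lemma is_zeroI:
  assumes "x \<in> Obj C" "zero_arr C (Id C x)"
  shows "is_zero C x"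
proof -
  obtain z a b where z: "is_zero C z" "a \<in> Arr C" "b \<in> Arr C" "Dom C a = x" "Cod C a = z"
    "Dom C b = z" "Cod C b = x" "Id C x = b \<cdot> a"
    using zero_arrE[OF assms(2)] assms(1) by (metis Dom_Id Cod_Id)
  have 1: "\<exists>f. f \<in> Arr C \<and> Dom C f = x \<and> Cod C f = y" if y: "y \<in> Obj C" for y
  proof -
    obtain f where "f \<in> Arr C" "Dom C f = z" "Cod C f = y" by (rule initial_ex[OF z(1) y])
    then show ?thesis using z by (intro exI[of _ "f \<cdot> a"]) auto
  qed
  have 2: "\<exists>f. f \<in> Arr C \<and> Cod C f = x \<and> Dom C f = y" if y: "y \<in> Obj C" for y
  proof -
    obtain f where "f \<in> Arr C" "Dom C f = y" "Cod C f = z" by (rule terminal_ex[OF z(1) y])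
    then show ?thesis using z by (intro exI[of _ "b \<cdot> f"]) auto
  qed
  have 3: "f = g" if f: "f \<in> Arr C" "Dom C f = x" and g: "g \<in> Arr C" "Dom C g = x" "Cod C f = Cod C g" for f g
  proof -
    have "zero_arr C (f \<cdot> Id C x)" by (rule zero_arr_Comp_left) (use assms f in auto)
    moreover have "zero_arr C (g \<cdot> Id C x)" by (rule zero_arr_Comp_left) (use assms g in auto)
    ultimately show ?thesis using zero_arr_unique[of f g] f g by simp
  qed
  have 4: "f = g" if f: "f \<in> Arr C" "Cod C f = x" and g: "g \<in> Arr C" "Cod C g = x" "Dom C f = Dom C g" for f g
  proof -
    have "zero_arr C (Id C x \<cdot> f)" by (rule zero_arr_Comp_right) (use assms f in auto)
    moreover have "zero_arr C (Id C x \<cdot> g)" by (rule zero_arr_Comp_right) (use assms g in auto)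
    ultimately show ?thesis using zero_arr_unique[of f g] f g by simp
  qed
  show ?thesis unfolding is_zero_def hom_iff
  proof (intro conjI ballI assms(1))
    fix y assume y: "y \<in> Obj C"
    show "\<exists>!f. f \<in> Arr C \<and> Dom C f = x \<and> Cod C f = y"
      using 1[OF y] by (rule ex_ex1I) (auto intro: 3)
    show "\<exists>!f. f \<in> Arr C \<and> Dom C f = y \<and> Cod C f = x"
      using 2[OF y] by (intro ex_ex1I) (auto intro: 4)
  qed
qed

lemma isomorphic_zero:
  assumes "isomorphic C x y" "is_zero C x" shows "is_zero C y"
proof -
  obtain f where f: "is_iso C f" "Dom C f = x" "Cod C f = y" using assms(1) by (rule isomorphicE)
  obtain g where g: "f \<in> Arr C" "g \<in> Arr C" "Dom C g = Cod C f" "Cod C g = Dom C f" "f \<cdot> g = Id C (Cod C f)"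
    using f(1) by (rule is_isoE)
  have "zero_arr C (f \<cdot> g)" by (rule zero_arr_Comp_left[OF is_zero_arr[OF assms(2)]]) (use f g in auto)
  then show ?thesis using is_zeroI[of y] f g by auto
qed

end

section \<open>Tensoring as a left adjoint of the internal Hom\<close>

locale normal_symmetric_monoidal_closed =
  symmetric_monoidal_closed A + normal_category A for A :: "('o, 'a, 'm) smc_cat_scheme" (structure)
begin

lemma TensA_Arr [simp]: "f \<in> Arr A \<Longrightarrow> g \<in> Arr A \<Longrightarrow> f \<boxdot> g \<in> Arr A"
  and Dom_TensA [simp]: "f \<in> Arr A \<Longrightarrow> g \<in> Arr A \<Longrightarrow> Dom A (f \<boxdot> g) = Dom A f \<boxtimes> Dom A g"
  and Cod_TensA [simp]: "f \<in> Arr A \<Longrightarrow> g \<in> Arr A \<Longrightarrow> Cod A (f \<boxdot> g) = Cod A f \<boxtimes> Cod A g"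
  using TensA_in_homs[of f "Dom A f" "Cod A f" g "Dom A g" "Cod A g"] by (auto simp: hom_iff)

lemma Ev_Arr [simp]: "m \<in> Obj A \<Longrightarrow> x \<in> Obj A \<Longrightarrow> Ev A m x \<in> Arr A"
  and Dom_Ev [simp]: "m \<in> Obj A \<Longrightarrow> x \<in> Obj A \<Longrightarrow> Dom A (Ev A m x) = IHom A m x \<boxtimes> m"
  and Cod_Ev [simp]: "m \<in> Obj A \<Longrightarrow> x \<in> Obj A \<Longrightarrow> Cod A (Ev A m x) = x"
  using Ev_in_homs[of m x] by (auto simp: hom_iff)

lemma Swap_Arr [simp]: "m \<in> Obj A \<Longrightarrow> x \<in> Obj A \<Longrightarrow> Swap A m x \<in> Arr A"
  and Dom_Swap [simp]: "m \<in> Obj A \<Longrightarrow> x \<in> Obj A \<Longrightarrow> Dom A (Swap A m x) = m \<boxtimes> x"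
  and Cod_Swap [simp]: "m \<in> Obj A \<Longrightarrow> x \<in> Obj A \<Longrightarrow> Cod A (Swap A m x) = x \<boxtimes> m"
  using Swap_in_homs[of m x] by (auto simp: hom_iff)

declare Tens_in_Obj [simp] IHom_in_Obj [simp] Unit_in_Obj [simp] TensA_Id [simp]

lemma interchange:
  assumes "f \<in> Arr A" "f' \<in> Arr A" "g \<in> Arr A" "g' \<in> Arr A" "Cod A f = Dom A f'" "Cod A g = Dom A g'"
  shows "(f' \<boxdot> g') \<cdot> (f \<boxdot> g) = (f' \<cdot> f) \<boxdot> (g' \<cdot> g)"
  using TensA_Comp[of f "Dom A f" "Cod A f" f' "Cod A f'" g "Dom A g" "Cod A g" g' "Cod A g'"] assms
  by (auto simp: hom_iff)

lemma tens_Comp: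
  assumes "f \<in> Arr A" "f' \<in> Arr A" "m \<in> Obj A" "Cod A f = Dom A f'"
  shows "(f' \<boxdot> Id A m) \<cdot> (f \<boxdot> Id A m) = (f' \<cdot> f) \<boxdot> Id A m"
  using interchange[of f f' "Id A m" "Id A m"] assms by simp

lemma curry_ex:
  assumes "m \<in> Obj A" "z \<in> Obj A" "f \<in> Arr A" "Dom A f = z \<boxtimes> m"
  obtains g where "g \<in> Arr A" "Dom A g = z" "Cod A g = IHom A m (Cod A f)" "Ev A m (Cod A f) \<cdot> (g \<boxdot> Id A m) = f"
proof -
  have "\<exists>!g. g \<in> homs A z (IHom A m (Cod A f)) \<and> Ev A m (Cod A f) \<cdot> (g \<boxdot> Id A m) = f"
    by (rule Ev_universal) (use assms in \<open>auto simp: hom_iff\<close>)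
  then show ?thesis using that by (auto simp: hom_iff)
qed

lemma curry_unique:
  assumes "m \<in> Obj A" "x \<in> Obj A" "g \<in> Arr A" "h \<in> Arr A" "Dom A g = Dom A h"
    "Cod A g = IHom A m x" "Cod A h = IHom A m x" "Ev A m x \<cdot> (g \<boxdot> Id A m) = Ev A m x \<cdot> (h \<boxdot> Id A m)"
  shows "g = h"
proof -
  have "\<exists>!t. t \<in> homs A (Dom A g) (IHom A m x) \<and> Ev A m x \<cdot> (t \<boxdot> Id A m) = Ev A m x \<cdot> (g \<boxdot> Id A m)"
    by (rule Ev_universal) (use assms in \<open>auto simp: hom_iff\<close>)
  then show ?thesis using assms by (auto simp: hom_iff)
qed

text \<open>Naturality of transposition in the first tensor factor.\<close>

lemma curry_Comp:
  assumes "m \<in> Obj A" "x \<in> Obj A" "g \<in> Arr A" "Cod A g = IHom A m x" "f \<in> Arr A" "Cod A f = Dom A g"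
  shows "Ev A m x \<cdot> ((g \<cdot> f) \<boxdot> Id A m) = (Ev A m x \<cdot> (g \<boxdot> Id A m)) \<cdot> (f \<boxdot> Id A m)"
  using assms by (simp add: tens_Comp[symmetric])

text \<open>The identity of \<open>z \<boxtimes> m\<close> and its zero endomorphism have transposes
  with source \<open>z\<close>, and these agree because \<open>z\<close> is initial.\<close>

lemma tens_is_zero:
  assumes z: "is_zero A z" and m: "m \<in> Obj A" shows "is_zero A (z \<boxtimes> m)"
proof -
  have zO: "z \<in> Obj A" by (rule is_zero_Obj[OF z])
  let ?x = "z \<boxtimes> m"
  obtain w where w: "zero_arr A w" "w \<in> Arr A" "Dom A w = ?x" "Cod A w = ?x"
    using zero_obtain[of ?x ?x] zO m by auto
  obtain u where u: "u \<in> Arr A" "Dom A u = z" "Cod A u = IHom A m (Cod A (Id A ?x))" "Ev A m (Cod A (Id A ?x)) \<cdot> (u \<boxdot> Id A m) = Id A ?x"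
    by (rule curry_ex[of m z "Id A ?x"]) (use zO m in auto)
  obtain v where v: "v \<in> Arr A" "Dom A v = z" "Cod A v = IHom A m (Cod A w)" "Ev A m (Cod A w) \<cdot> (v \<boxdot> Id A m) = w"
    by (rule curry_ex[of m z w]) (use zO m w in auto)
  have "u = v" by (rule initial_unique[OF z]) (use u v w zO m in auto)
  then have "Id A ?x = w" using u v w zO m by simp
  then show ?thesis using is_zeroI[of ?x] w zO m by simp
qed

lemma tens_zero_arr:
  assumes "zero_arr A f" "m \<in> Obj A" shows "zero_arr A (f \<boxdot> Id A m)"
proof -
  obtain z a b where z: "is_zero A z" "a \<in> Arr A" "b \<in> Arr A" "Dom A a = Dom A f" "Cod A a = z"
    "Dom A b = z" "Cod A b = Cod A f" "f = b \<cdot> a"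
    by (rule zero_arrE[OF assms(1)])
  have "f \<boxdot> Id A m = (b \<boxdot> Id A m) \<cdot> (a \<boxdot> Id A m)" using z assms tens_Comp[of a b m] by simp
  moreover have "zero_arr A \<dots>" by (rule zero_arrI[OF tens_is_zero[OF z(1) assms(2)]]) (use z assms in auto)
  ultimately show ?thesis by simp
qed

text \<open>Transposition reduces cancelling \<open>e \<boxdot> Id A m\<close> to cancelling
  \<open>e\<close>, as for every left adjoint.\<close>

lemma tens_epi:
  assumes e: "epi_arr A e" and m: "m \<in> Obj A" shows "epi_arr A (e \<boxdot> Id A m)"
  unfolding epi_arr_def
proof (intro conjI ballI allI impI)
  show "e \<boxdot> Id A m \<in> Arr A" using assms by simp
  fix w u v assume "u \<in> homs A (Cod A (e \<boxdot> Id A m)) w" "v \<in> homs A (Cod A (e \<boxdot> Id A m)) w"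
    and uv: "u \<cdot> (e \<boxdot> Id A m) = v \<cdot> (e \<boxdot> Id A m)"
  then have D: "u \<in> Arr A" "v \<in> Arr A" "Dom A u = Cod A e \<boxtimes> m" "Dom A v = Cod A e \<boxtimes> m" "Cod A u = w" "Cod A v = w" "w \<in> Obj A"
    using assms by (auto simp: hom_iff)
  obtain u' where u': "u' \<in> Arr A" "Dom A u' = Cod A e" "Cod A u' = IHom A m (Cod A u)" "Ev A m (Cod A u) \<cdot> (u' \<boxdot> Id A m) = u"
    by (rule curry_ex[of m "Cod A e" u]) (use D assms in auto)
  obtain v' where v': "v' \<in> Arr A" "Dom A v' = Cod A e" "Cod A v' = IHom A m (Cod A v)" "Ev A m (Cod A v) \<cdot> (v' \<boxdot> Id A m) = v"
    by (rule curry_ex[of m "Cod A e" v]) (use D assms in auto)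
  have "u' \<cdot> e = v' \<cdot> e"
    by (rule curry_unique[OF m D(7)]) (use u' v' D assms uv curry_Comp[of m w u' e] curry_Comp[of m w v' e] in auto)
  then have "u' = v'" by (rule epi_cancel[OF e]) (use u' v' D in auto)
  then show "u = v" using u' v' D by simp
qed

text \<open>The transpose \<open>u\<close> of \<open>g\<close> kills \<open>f\<close>, because
  \<open>g\<close> kills \<open>f \<boxdot> Id A m\<close>. So \<open>u\<close> factors through
  \<open>q\<close>, and the transpose of the factor is the required factorization of
  \<open>g\<close>.\<close>

lemma tens_cokernel:
  assumes q: "is_cokernel A q f" and m: "m \<in> Obj A" shows "is_cokernel A (q \<boxdot> Id A m) (f \<boxdot> Id A m)"
proof (rule is_cokernelI)
  note qD = is_cokernelD[OF q]
  show "epi_arr A (q \<boxdot> Id A m)" by (rule tens_epi[OF cokernel_epi[OF q] m])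
  show "zero_arr A ((q \<boxdot> Id A m) \<cdot> (f \<boxdot> Id A m))" using tens_Comp[of f q m] tens_zero_arr[OF qD(4) m] qD m by simp
  fix g assume g: "g \<in> Arr A" "Dom A g = Cod A (f \<boxdot> Id A m)" "zero_arr A (g \<cdot> (f \<boxdot> Id A m))"
  define x where "x = Cod A g"
  have x: "x \<in> Obj A" using g by (simp add: x_def)
  obtain u where u: "u \<in> Arr A" "Dom A u = Cod A f" "Cod A u = IHom A m x" "Ev A m x \<cdot> (u \<boxdot> Id A m) = g"
    unfolding x_def by (rule curry_ex[of m "Cod A f" g]) (use g qD m in auto)
  obtain w where w: "zero_arr A w" "w \<in> Arr A" "Dom A w = Dom A f" "Cod A w = IHom A m x"
    using zero_obtain[of "Dom A f" "IHom A m x"] qD m x by auto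
  have "u \<cdot> f = w"
  proof (rule curry_unique[OF m x])
    have e: "Ev A m x \<cdot> ((u \<cdot> f) \<boxdot> Id A m) = g \<cdot> (f \<boxdot> Id A m)" using curry_Comp[OF m x u(1,3) qD(2)] u by simp
    have z: "zero_arr A (Ev A m x \<cdot> (w \<boxdot> Id A m))"
      by (rule zero_arr_Comp_left[OF tens_zero_arr[OF w(1) m]]) (use w m x in auto)
    show "Ev A m x \<cdot> ((u \<cdot> f) \<boxdot> Id A m) = Ev A m x \<cdot> (w \<boxdot> Id A m)"
      unfolding e by (rule zero_arr_unique[OF g(3) z]) (use g w qD m x in \<open>auto simp: x_def\<close>)
  qed (use u w qD m x in auto)
  then obtain t where t: "t \<in> Arr A" "Dom A t = Cod A q" "Cod A t = Cod A u" "t \<cdot> q = u"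
    using cokernel_factor[OF q u(1,2)] w by metis
  have "(Ev A m x \<cdot> (t \<boxdot> Id A m)) \<cdot> (q \<boxdot> Id A m) = g"
    using curry_Comp[OF m x t(1) _ qD(1)] t u by simp
  then show "\<exists>h\<in>Arr A. Dom A h = Cod A (q \<boxdot> Id A m) \<and> Cod A h = Cod A g \<and> h \<cdot> (q \<boxdot> Id A m) = g"
    using t u qD m x by (intro bexI[of _ "Ev A m x \<cdot> (t \<boxdot> Id A m)"]) (auto simp: x_def)
qed (use is_cokernelD[OF q] m in auto)

lemma Swap_iso: "x \<in> Obj A \<Longrightarrow> y \<in> Obj A \<Longrightarrow> is_iso A (Swap A x y)"
  by (rule is_isoI[of _ "Swap A y x"]) (auto simp: Swap_Swap)

lemma Swap_isomorphic: "x \<in> Obj A \<Longrightarrow> y \<in> Obj A \<Longrightarrow> isomorphic A (x \<boxtimes> y) (y \<boxtimes> x)"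
  using isomorphicI[OF Swap_iso, of x y] by simp

lemma Swap_nat: "f \<in> Arr A \<Longrightarrow> m \<in> Obj A \<Longrightarrow> (Id A m \<boxdot> f) \<cdot> Swap A (Dom A f) m = Swap A (Cod A f) m \<cdot> (f \<boxdot> Id A m)"
  using Swap_natural[of f "Dom A f" "Cod A f" "Id A m" m m] by (simp add: hom_iff)

lemma tens_cokernel':
  assumes q: "is_cokernel A q f" and m: "m \<in> Obj A" shows "is_cokernel A (Id A m \<boxdot> q) (Id A m \<boxdot> f)"
proof -
  note qD = is_cokernelD[OF q]
  show ?thesis
    by (rule cokernel_conj[OF tens_cokernel[OF q m], where k="Swap A (Dom A f) m" and i="Swap A (Cod A f) m" and j="Swap A (Cod A q) m"])
      (use qD m Swap_nat[OF qD(1) m] Swap_nat[OF qD(2) m] in \<open>auto simp: Swap_iso\<close>)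
qed

lemma tens_epi':
  assumes e: "epi_arr A e" and m: "m \<in> Obj A" shows "epi_arr A (Id A m \<boxdot> e)"
  using epi_normal[OF e] tens_cokernel' m cokernel_epi by blast

text \<open>Left adjoints preserve coproducts: a cocone on the tensored family is transposed,
  factored through \<open>c\<close> and transposed back.\<close>

lemma tens_coproduct:
  assumes c: "is_coproduct A I Y c \<iota>" and m: "m \<in> Obj A"
  shows "is_coproduct A I (\<lambda>i. Y i \<boxtimes> m) (c \<boxtimes> m) (\<lambda>i. \<iota> i \<boxdot> Id A m)"
  unfolding is_coproduct_def
proof (intro conjI ballI allI impI)
  have cO: "c \<in> Obj A" using c by (simp add: is_coproduct_def)
  then show "c \<boxtimes> m \<in> Obj A" using m by simp
  have Y: "Y i \<in> Obj A" "\<iota> i \<in> Arr A" "Dom A (\<iota> i) = Y i" "Cod A (\<iota> i) = c" if "i \<in> I" for i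
    using c that by (auto simp: is_coproduct_def hom_iff)
  show "Y i \<boxtimes> m \<in> Obj A" "\<iota> i \<boxdot> Id A m \<in> homs A (Y i \<boxtimes> m) (c \<boxtimes> m)" if "i \<in> I" for i
    using Y[OF that] m by (auto simp: hom_iff)
  fix d g assume d: "d \<in> Obj A" and g: "\<forall>i\<in>I. g i \<in> homs A (Y i \<boxtimes> m) d"
  have "\<exists>u. i \<in> I \<longrightarrow> u \<in> homs A (Y i) (IHom A m d) \<and> Ev A m d \<cdot> (u \<boxdot> Id A m) = g i" for i
  proof (cases "i \<in> I")
    case True
    then have "g i \<in> Arr A" "Dom A (g i) = Y i \<boxtimes> m" "Cod A (g i) = d" using g by (auto simp: hom_iff)
    then show ?thesis using curry_ex[OF m Y(1)[OF True], of "g i"] by (metis hom_iff)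
  qed blast
  then obtain u where u: "\<And>i. i \<in> I \<Longrightarrow> u i \<in> homs A (Y i) (IHom A m d)" "\<And>i. i \<in> I \<Longrightarrow> Ev A m d \<cdot> (u i \<boxdot> Id A m) = g i"
    by metis
  have "\<exists>!h. h \<in> homs A c (IHom A m d) \<and> (\<forall>i \<in> I. h \<cdot> \<iota> i = u i)"
    using c u(1) d m unfolding is_coproduct_def by simp
  then obtain h where h: "h \<in> homs A c (IHom A m d)" "\<And>i. i \<in> I \<Longrightarrow> h \<cdot> \<iota> i = u i"
    and hu: "\<And>h'. h' \<in> homs A c (IHom A m d) \<Longrightarrow> (\<forall>i \<in> I. h' \<cdot> \<iota> i = u i) \<Longrightarrow> h' = h" by blast
  have hD: "h \<in> Arr A" "Dom A h = c" "Cod A h = IHom A m d" using h by (auto simp: hom_iff)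
  show "\<exists>!h. h \<in> homs A (c \<boxtimes> m) d \<and> (\<forall>i \<in> I. h \<cdot> (\<iota> i \<boxdot> Id A m) = g i)"
  proof (rule ex1I[of _ "Ev A m d \<cdot> (h \<boxdot> Id A m)"], intro conjI ballI)
    show "Ev A m d \<cdot> (h \<boxdot> Id A m) \<in> homs A (c \<boxtimes> m) d" using hD d m by (simp add: hom_iff)
    show "(Ev A m d \<cdot> (h \<boxdot> Id A m)) \<cdot> (\<iota> i \<boxdot> Id A m) = g i" if i: "i \<in> I" for i
      using curry_Comp[OF m d hD(1,3), of "\<iota> i"] h(2) u(2) Y[OF i] i hD by simp
    fix k assume k: "k \<in> homs A (c \<boxtimes> m) d \<and> (\<forall>i \<in> I. k \<cdot> (\<iota> i \<boxdot> Id A m) = g i)"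
    then have kD: "k \<in> Arr A" "Dom A k = c \<boxtimes> m" "Cod A k = d" by (auto simp: hom_iff)
    obtain k' where k': "k' \<in> Arr A" "Dom A k' = c" "Cod A k' = IHom A m d" "Ev A m d \<cdot> (k' \<boxdot> Id A m) = k"
      using curry_ex[OF m cO kD(1,2)] kD by auto
    have "k' \<cdot> \<iota> i = u i" if i: "i \<in> I" for i
    proof (rule curry_unique[OF m d])
      show "Ev A m d \<cdot> ((k' \<cdot> \<iota> i) \<boxdot> Id A m) = Ev A m d \<cdot> (u i \<boxdot> Id A m)"
        using curry_Comp[OF m d k'(1,3), of "\<iota> i"] u(2) Y[OF i] i k' k by simp
    qed (use k' u(1)[OF i] Y[OF i] in \<open>auto simp: hom_iff\<close>)
    then have "k' = h" by (intro hu) (use k' in \<open>auto simp: hom_iff\<close>)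
    then show "k = Ev A m d \<cdot> (h \<boxdot> Id A m)" using k' by simp
  qed
qed

text \<open>\<open>F\<close> is the morphism \<open>[f, x]\<close>.\<close>

lemma IHom_arrow_ex:
  assumes f: "f \<in> Arr A" and x: "x \<in> Obj A"
  obtains F where "F \<in> Arr A" "Dom A F = IHom A (Cod A f) x" "Cod A F = IHom A (Dom A f) x"
    "\<And>g. g \<in> Arr A \<Longrightarrow> Cod A g = IHom A (Cod A f) x \<Longrightarrow>
      Ev A (Dom A f) x \<cdot> ((F \<cdot> g) \<boxdot> Id A (Dom A f)) = (Ev A (Cod A f) x \<cdot> (g \<boxdot> Id A (Cod A f))) \<cdot> (Id A (Dom A g) \<boxdot> f)"
proof -
  let ?a = "Dom A f" and ?b = "Cod A f"
  have E: "Ev A ?b x \<cdot> (Id A (IHom A ?b x) \<boxdot> f) \<in> Arr A" "Dom A (Ev A ?b x \<cdot> (Id A (IHom A ?b x) \<boxdot> f)) = IHom A ?b x \<boxtimes> ?a"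
    "Cod A (Ev A ?b x \<cdot> (Id A (IHom A ?b x) \<boxdot> f)) = x"
    using f x by auto
  \<comment> \<open>\<open>F\<close> is the transpose of evaluation at \<open>?b\<close> precomposed
    with \<open>f\<close> in the second factor.\<close>
  obtain F where F: "F \<in> Arr A" "Dom A F = IHom A ?b x" "Cod A F = IHom A ?a x"
    "Ev A ?a x \<cdot> (F \<boxdot> Id A ?a) = Ev A ?b x \<cdot> (Id A (IHom A ?b x) \<boxdot> f)"
    using curry_ex[OF _ _ E(1,2)] f x E(3) by auto
  have "Ev A ?a x \<cdot> ((F \<cdot> g) \<boxdot> Id A ?a) = (Ev A ?b x \<cdot> (g \<boxdot> Id A ?b)) \<cdot> (Id A (Dom A g) \<boxdot> f)"
    if g: "g \<in> Arr A" "Cod A g = IHom A ?b x" for g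
  proof -
    have "Ev A ?a x \<cdot> ((F \<cdot> g) \<boxdot> Id A ?a) = (Ev A ?b x \<cdot> (Id A (IHom A ?b x) \<boxdot> f)) \<cdot> (g \<boxdot> Id A ?a)"
      using curry_Comp[of ?a x F g] F g f x by simp
    also have "\<dots> = Ev A ?b x \<cdot> (g \<boxdot> f)" using g f x interchange[of g "Id A (IHom A ?b x)" "Id A ?a" f] by simp
    also have "\<dots> = (Ev A ?b x \<cdot> (g \<boxdot> Id A ?b)) \<cdot> (Id A (Dom A g) \<boxdot> f)"
      using g f x interchange[of "Id A (Dom A g)" g f "Id A ?b"] by simp
    finally show ?thesis .
  qed
  then show ?thesis using that F by blast
qed

text \<open>\<open>F\<close> is \<open>[e, x]\<close>. Its composite with \<open>u\<close>
  transposes to the transpose of \<open>u\<close> after \<open>Id A w \<boxdot> e\<close>, and the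
  latter is an epimorphism.\<close>

lemma IHom_epi_mono:
  assumes e: "epi_arr A e" and x: "x \<in> Obj A"
  obtains F where "mono_arr A F" "Dom A F = IHom A (Cod A e) x" "Cod A F = IHom A (Dom A e) x"
proof -
  let ?a = "Dom A e" and ?b = "Cod A e"
  have eA: "e \<in> Arr A" using e by simp
  obtain F where F: "F \<in> Arr A" "Dom A F = IHom A ?b x" "Cod A F = IHom A ?a x"
    "\<And>g. g \<in> Arr A \<Longrightarrow> Cod A g = IHom A ?b x \<Longrightarrow>
      Ev A ?a x \<cdot> ((F \<cdot> g) \<boxdot> Id A ?a) = (Ev A ?b x \<cdot> (g \<boxdot> Id A ?b)) \<cdot> (Id A (Dom A g) \<boxdot> e)"
    using IHom_arrow_ex[OF eA x] by metis
  have "mono_arr A F" unfolding mono_arr_def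
  proof (intro conjI ballI allI impI)
    show "F \<in> Arr A" by fact
    fix w u v assume "u \<in> homs A w (Dom A F)" "v \<in> homs A w (Dom A F)" and uv: "F \<cdot> u = F \<cdot> v"
    then have D: "u \<in> Arr A" "v \<in> Arr A" "Dom A u = w" "Dom A v = w" "Cod A u = IHom A ?b x" "Cod A v = IHom A ?b x" "w \<in> Obj A"
      using F by (auto simp: hom_iff)
    have "(Ev A ?b x \<cdot> (u \<boxdot> Id A ?b)) \<cdot> (Id A w \<boxdot> e) = (Ev A ?b x \<cdot> (v \<boxdot> Id A ?b)) \<cdot> (Id A w \<boxdot> e)"
      using F(4)[OF D(1,5)] F(4)[OF D(2,6)] uv D by simp
    then have "Ev A ?b x \<cdot> (u \<boxdot> Id A ?b) = Ev A ?b x \<cdot> (v \<boxdot> Id A ?b)"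
      by (rule epi_cancel[OF tens_epi'[OF e D(7)]]) (use D eA x in auto)
    then show "u = v" by (intro curry_unique[of ?b x u v]) (use D eA x in auto)
  qed
  then show ?thesis using that F by blast
qed

text \<open>Transposition matches zero morphisms with zero morphisms, so vanishing can be tested on
  either side of the adjunction.\<close>

lemma Ev_zero_iff:
  assumes "m \<in> Obj A" "x \<in> Obj A" "g \<in> Arr A" "Cod A g = IHom A m x"
  shows "zero_arr A (Ev A m x \<cdot> (g \<boxdot> Id A m)) \<longleftrightarrow> zero_arr A g"
proof -
  have 1: "zero_arr A (Ev A m x \<cdot> (g \<boxdot> Id A m))" if "zero_arr A g" "g \<in> Arr A" "Cod A g = IHom A m x" for g
    using that assms(1,2) tens_zero_arr[of g m] by (intro zero_arr_Comp_left) auto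
  have "zero_arr A g" if z: "zero_arr A (Ev A m x \<cdot> (g \<boxdot> Id A m))"
  proof -
    obtain w where w: "zero_arr A w" "w \<in> Arr A" "Dom A w = Dom A g" "Cod A w = IHom A m x"
      using zero_obtain[of "Dom A g" "IHom A m x"] assms by auto
    have "Ev A m x \<cdot> (g \<boxdot> Id A m) = Ev A m x \<cdot> (w \<boxdot> Id A m)"
      by (rule zero_arr_unique[OF z 1]) (use w assms in auto)
    then have "g = w" by (intro curry_unique[of m x g w]) (use w assms in auto)
    then show ?thesis using w by simp
  qed
  then show ?thesis using 1 assms by blast
qed

text \<open>\<open>Q\<close> and \<open>F\<close> are \<open>[q, x]\<close> and
  \<open>[f, x]\<close>. A morphism \<open>g\<close> with source \<open>w\<close> that
  \<open>F\<close> kills transposes to a morphism that kills \<open>Id A w \<boxdot> f\<close>. It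
  therefore factors through the cokernel \<open>Id A w \<boxdot> q\<close>, and the factor
  transposes back to the wanted morphism into \<open>[Cod q, x]\<close>.\<close>

lemma IHom_cokernel_kernel:
  assumes q: "is_cokernel A q f" and x: "x \<in> Obj A"
  obtains Q F where "is_kernel A Q F" "Dom A Q = IHom A (Cod A q) x" "Dom A F = IHom A (Cod A f) x" "Cod A F = IHom A (Dom A f) x"
proof -
  note qD = is_cokernelD[OF q]
  let ?a = "Dom A f" and ?b = "Cod A f" and ?c = "Cod A q"
  obtain F where F: "F \<in> Arr A" "Dom A F = IHom A ?b x" "Cod A F = IHom A ?a x"
    "\<And>g. g \<in> Arr A \<Longrightarrow> Cod A g = IHom A ?b x \<Longrightarrow>
      Ev A ?a x \<cdot> ((F \<cdot> g) \<boxdot> Id A ?a) = (Ev A ?b x \<cdot> (g \<boxdot> Id A ?b)) \<cdot> (Id A (Dom A g) \<boxdot> f)"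
    using IHom_arrow_ex[OF qD(2) x] by metis
  obtain Q where Q: "Q \<in> Arr A" "Dom A Q = IHom A ?c x" "Cod A Q = IHom A ?b x"
    "\<And>g. g \<in> Arr A \<Longrightarrow> Cod A g = IHom A ?c x \<Longrightarrow>
      Ev A ?b x \<cdot> ((Q \<cdot> g) \<boxdot> Id A ?b) = (Ev A ?c x \<cdot> (g \<boxdot> Id A ?c)) \<cdot> (Id A (Dom A g) \<boxdot> q)"
    using IHom_arrow_ex[OF qD(1) x] qD(3) by metis
  have O: "?a \<in> Obj A" "?b \<in> Obj A" "?c \<in> Obj A" using qD by auto
  have hit: "\<exists>h. h \<in> Arr A \<and> Dom A h = Dom A g \<and> Cod A h = Dom A Q \<and> Q \<cdot> h = g"
    if g: "g \<in> Arr A" "Cod A g = Dom A F" "zero_arr A (F \<cdot> g)" for g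
  proof -
    let ?w = "Dom A g"
    have wO: "?w \<in> Obj A" using g by simp
    let ?g = "Ev A ?b x \<cdot> (g \<boxdot> Id A ?b)"
    have gA: "?g \<in> Arr A" "Dom A ?g = ?w \<boxtimes> ?b" "Cod A ?g = x" using g O x F by auto
    have "zero_arr A (Ev A ?a x \<cdot> ((F \<cdot> g) \<boxdot> Id A ?a))"
      by (subst Ev_zero_iff) (use g F O x in auto)
    then have "zero_arr A (?g \<cdot> (Id A ?w \<boxdot> f))" using F(4)[of g] g F by simp
    then obtain t where t: "t \<in> Arr A" "Dom A t = Cod A (Id A ?w \<boxdot> q)" "Cod A t = Cod A ?g" "t \<cdot> (Id A ?w \<boxdot> q) = ?g"
      by (rule cokernel_factor[OF tens_cokernel'[OF q wO] gA(1), rotated -2]) (use gA qD wO in auto)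
    have t': "Dom A t = ?w \<boxtimes> ?c" "Cod A t = x" using t gA qD wO by auto
    obtain h where h: "h \<in> Arr A" "Dom A h = ?w" "Cod A h = IHom A ?c x" "Ev A ?c x \<cdot> (h \<boxdot> Id A ?c) = t"
      using curry_ex[OF O(3) wO t(1) t'(1)] t' by metis
    have "Q \<cdot> h = g"
      by (rule curry_unique[OF O(2) x]) (use Q(1-3) Q(4)[OF h(1,3)] h t g F in auto)
    then show ?thesis using h Q by auto
  qed
  have "is_kernel A Q F"
  proof (rule is_kernelI)
    show "mono_arr A Q"
    proof (rule monoI[OF Q(1)])
      fix g assume g: "g \<in> Arr A" "Cod A g = Dom A Q" "zero_arr A (Q \<cdot> g)"
      have "zero_arr A (Ev A ?b x \<cdot> ((Q \<cdot> g) \<boxdot> Id A ?b))"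
        by (subst Ev_zero_iff) (use g Q O x in auto)
      then have "zero_arr A ((Ev A ?c x \<cdot> (g \<boxdot> Id A ?c)) \<cdot> (Id A (Dom A g) \<boxdot> q))" using Q(4)[of g] g Q by simp
      then have "zero_arr A (Ev A ?c x \<cdot> (g \<boxdot> Id A ?c))"
        by (rule epi_zero_cancel[OF tens_epi'[OF cokernel_epi[OF q]], rotated -1]) (use g Q O x qD in auto)
      then show "zero_arr A g" by (subst (asm) Ev_zero_iff) (use g Q O x in auto)
    qed
    let ?I = "Id A (IHom A ?c x)"
    have I: "?I \<in> Arr A" "Cod A ?I = IHom A ?c x" "Dom A ?I = IHom A ?c x" using O x by auto
    have "Ev A ?a x \<cdot> ((F \<cdot> Q) \<boxdot> Id A ?a) = (Ev A ?b x \<cdot> (Q \<boxdot> Id A ?b)) \<cdot> (Id A (IHom A ?c x) \<boxdot> f)"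
      using F(4)[OF Q(1,3)] Q by simp
    also have "Ev A ?b x \<cdot> (Q \<boxdot> Id A ?b) = Ev A ?c x \<cdot> (Id A (IHom A ?c x) \<boxdot> q)"
      using Q(4)[OF I(1,2)] Q I O x qD by simp
    also have "\<dots> \<cdot> (Id A (IHom A ?c x) \<boxdot> f) = Ev A ?c x \<cdot> ((Id A (IHom A ?c x) \<boxdot> q) \<cdot> (Id A (IHom A ?c x) \<boxdot> f))"
      by (rule assoc) (use O x qD in auto)
    finally have "Ev A ?a x \<cdot> ((F \<cdot> Q) \<boxdot> Id A ?a) = Ev A ?c x \<cdot> ((Id A (IHom A ?c x) \<boxdot> q) \<cdot> (Id A (IHom A ?c x) \<boxdot> f))" .
    moreover have "zero_arr A \<dots>"
      by (rule zero_arr_Comp_left[OF is_cokernelD(4)[OF tens_cokernel'[OF q]]]) (use O x qD in auto)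
    ultimately have "zero_arr A (Ev A ?a x \<cdot> ((F \<cdot> Q) \<boxdot> Id A ?a))" by simp
    then show "zero_arr A (F \<cdot> Q)" by (subst (asm) Ev_zero_iff) (use F Q O x in auto)
    show "\<And>g. g \<in> Arr A \<Longrightarrow> Cod A g = Dom A F \<Longrightarrow> zero_arr A (F \<cdot> g) \<Longrightarrow> \<exists>h\<in>Arr A. Dom A h = Dom A g \<and> Cod A h = Dom A Q \<and> Q \<cdot> h = g"
      using hit by blast
  qed (use F Q in auto)
  then show ?thesis using that F Q by blast
qed

lemma IHom_is_zero:
  assumes z: "is_zero A z" and x: "x \<in> Obj A" shows "is_zero A (IHom A z x)"
proof -
  let ?y = "IHom A z x"
  have zO: "z \<in> Obj A" by (rule is_zero_Obj[OF z])
  have yz: "is_zero A (?y \<boxtimes> z)"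
    by (rule isomorphic_zero[OF Swap_isomorphic tens_is_zero[OF z]]) (use zO x in auto)
  have "zero_arr A (Ev A z x \<cdot> (Id A ?y \<boxdot> Id A z))"
    by (rule is_zero_arr[OF yz]) (use zO x in auto)
  then have "zero_arr A (Id A ?y)" by (subst (asm) Ev_zero_iff) (use zO x in auto)
  then show ?thesis by (intro is_zeroI) (use zO x in auto)
qed

end

section \<open>Full subcategories\<close>

lemma full_subcategory_simps [simp]:
  "Obj (full_subcategory C P) = P"
  "Arr (full_subcategory C P) = {f \<in> Arr C. Dom C f \<in> P \<and> Cod C f \<in> P}"
  "Dom (full_subcategory C P) = Dom C" "Cod (full_subcategory C P) = Cod C"
  "Id (full_subcategory C P) = Id C" "g \<cdot>\<^bsub>full_subcategory C P\<^esub> f = g \<cdot>\<^bsub>C\<^esub> f"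
  by (simp_all add: full_subcategory_def)

lemma full_subcategory_smc_simps [simp]:
  fixes A :: "('o, 'a, 'm) smc_cat_scheme"
  shows "x \<boxtimes>\<^bsub>full_subcategory A P\<^esub> y = x \<boxtimes>\<^bsub>A\<^esub> y" "IHom (full_subcategory A P) = IHom A"
  by (simp_all add: full_subcategory_def)

lemma homs_full_subcategory: "homs (full_subcategory C P) x y = (if x \<in> P \<and> y \<in> P then homs C x y else {})"
  by (auto simp: hom_iff)

context normal_category
begin

lemma full_mono: "mono_arr C m \<Longrightarrow> Dom C m \<in> P \<Longrightarrow> Cod C m \<in> P \<Longrightarrow> mono_arr (full_subcategory C P) m"
  by (auto simp: mono_arr_def homs_full_subcategory split: if_splits)

lemma full_epi: "epi_arr C m \<Longrightarrow> Dom C m \<in> P \<Longrightarrow> Cod C m \<in> P \<Longrightarrow> epi_arr (full_subcategory C P) m"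
  by (auto simp: epi_arr_def homs_full_subcategory split: if_splits)

text \<open>\<open>z\<close> has a single endomorphism, so the one that passes through
  \<open>o'\<close> is the identity of \<open>z\<close>.\<close>

lemma full_is_zero:
  assumes o': "is_zero C o'" "o' \<in> P" and P: "P \<subseteq> Obj C" and z: "is_zero (full_subcategory C P) z"
  shows "is_zero C z"
proof -
  have zP: "z \<in> P" "z \<in> Obj C" using z P by (auto simp: is_zero_def)
  obtain a where a: "a \<in> Arr C" "Dom C a = z" "Cod C a = o'" by (rule terminal_ex[OF o'(1) zP(2)])
  obtain b where b: "b \<in> Arr C" "Dom C b = o'" "Cod C b = z" by (rule initial_ex[OF o'(1) zP(2)])
  have "\<exists>!f. f \<in> homs C z z" using z zP unfolding is_zero_def homs_full_subcategory full_subcategory_simps by simp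
  then have "b \<cdot> a = Id C z" using a b zP by (auto simp: hom_iff)
  then have "zero_arr C (Id C z)" using zero_arrI[OF o'(1), of a b] a b by simp
  then show ?thesis by (rule is_zeroI[OF zP(2)])
qed

lemma full_zero_arr:
  assumes o': "is_zero C o'" "o' \<in> P" and P: "P \<subseteq> Obj C" and f: "f \<in> Arr C" "Dom C f \<in> P" "Cod C f \<in> P"
  shows "zero_arr (full_subcategory C P) f \<longleftrightarrow> zero_arr C f"
proof
  assume "zero_arr (full_subcategory C P) f"
  then obtain z g h where z: "is_zero (full_subcategory C P) z" "g \<in> homs C (Dom C f) z" "h \<in> homs C z (Cod C f)" "f = h \<cdot> g"
    unfolding zero_arr_def homs_full_subcategory full_subcategory_simps by (auto split: if_splits)
  show "zero_arr C f" using zero_arrI[OF full_is_zero[OF o' P z(1)], of g h] z by (simp add: hom_iff)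
next
  assume z: "zero_arr C f"
  obtain g where g: "g \<in> Arr C" "Dom C g = Dom C f" "Cod C g = o'" using terminal_ex[OF o'(1), of "Dom C f"] f by auto
  obtain h where h: "h \<in> Arr C" "Dom C h = o'" "Cod C h = Cod C f" using initial_ex[OF o'(1), of "Cod C f"] f by auto
  have e: "f = h \<cdot> g" by (rule zero_arr_unique[OF z zero_arrI[OF o'(1)]]) (use g h in auto)
  have "\<forall>x\<in>P. (\<exists>!f. f \<in> homs C o' x) \<and> (\<exists>!f. f \<in> homs C x o')" using o' P unfolding is_zero_def by blast
  then have "is_zero (full_subcategory C P) o'" using o'(2) by (simp add: is_zero_def homs_full_subcategory)
  then show "zero_arr (full_subcategory C P) f"
    unfolding zero_arr_def homs_full_subcategory full_subcategory_simps using e g h o' f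
    by (intro exI[of _ o'] conjI bexI[of _ g] bexI[of _ h]) (auto simp: hom_iff)
qed

lemma full_short_exact:
  assumes o': "is_zero C o'" "o' \<in> P" and P: "P \<subseteq> Obj C" and s: "short_exact C f g"
    and f: "Dom C f \<in> P" "Cod C f \<in> P" "Cod C g \<in> P"
  shows "short_exact (full_subcategory C P) f g"
proof -
  have k: "is_kernel C f g" and q: "is_cokernel C g f" using s by (auto simp: short_exact_def)
  note kD = is_kernelD[OF k]
  note zi = full_zero_arr[OF o' P]
  have gf: "zero_arr (full_subcategory C P) (g \<cdot> f)" using zi[of "g \<cdot> f"] kD f by simp
  have "is_kernel (full_subcategory C P) f g"
    unfolding is_kernel_def homs_full_subcategory
  proof (intro conjI allI ballI impI)
    fix w h assume h: "h \<in> (if w \<in> P \<and> Dom (full_subcategory C P) g \<in> P then homs C w (Dom (full_subcategory C P) g) else {})"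
      "zero_arr (full_subcategory C P) (g \<cdot>\<^bsub>full_subcategory C P\<^esub> h)"
    then have w: "w \<in> P" "h \<in> homs C w (Dom C g)" by (auto split: if_splits)
    then have "zero_arr C (g \<cdot> h)" using h(2) zi[of "g \<cdot> h"] kD f by (simp add: hom_iff)
    then have "\<exists>!t. t \<in> homs C w (Dom C f) \<and> f \<cdot> t = h" using k w unfolding is_kernel_def by blast
    then show "\<exists>!t. t \<in> (if w \<in> P \<and> Dom (full_subcategory C P) f \<in> P then homs C w (Dom (full_subcategory C P) f) else {}) \<and>
       f \<cdot>\<^bsub>full_subcategory C P\<^esub> t = h" using w f by simp
  qed (use kD f gf in auto)
  moreover have "is_cokernel (full_subcategory C P) g f"
    unfolding is_cokernel_def homs_full_subcategory
  proof (intro conjI allI ballI impI)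
    fix w h assume h: "h \<in> (if Cod (full_subcategory C P) f \<in> P \<and> w \<in> P then homs C (Cod (full_subcategory C P) f) w else {})"
      "zero_arr (full_subcategory C P) (h \<cdot>\<^bsub>full_subcategory C P\<^esub> f)"
    then have w: "w \<in> P" "h \<in> homs C (Cod C f) w" by (auto split: if_splits)
    then have "zero_arr C (h \<cdot> f)" using h(2) zi[of "h \<cdot> f"] kD f by (simp add: hom_iff)
    then have "\<exists>!t. t \<in> homs C (Cod C g) w \<and> t \<cdot> g = h" using q w unfolding is_cokernel_def by blast
    then show "\<exists>!t. t \<in> (if Cod (full_subcategory C P) g \<in> P \<and> w \<in> P then homs C (Cod (full_subcategory C P) g) w else {}) \<and>
       t \<cdot>\<^bsub>full_subcategory C P\<^esub> g = h" using w f by simp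
  qed (use kD f gf in auto)
  ultimately show ?thesis by (simp add: short_exact_def)
qed

text \<open>As \<open>P\<close> is itself closed under extensions, a short exact sequence with outer
  terms in \<open>X\<close> lies entirely in \<open>P\<close> and is exact there.\<close>

lemma full_closed_under_extensions:
  assumes "is_zero C o'" "o' \<in> P" "P \<subseteq> Obj C" "closed_under_extensions C P"
    "X \<subseteq> P" "closed_under_extensions (full_subcategory C P) X"
  shows "closed_under_extensions C X"
  unfolding closed_under_extensions_def
proof (intro allI impI)
  fix f g assume a: "short_exact C f g \<and> Dom C f \<in> X \<and> Cod C g \<in> X"
  then have "Cod C f \<in> P" using assms(4,5) unfolding closed_under_extensions_def by blast
  then have "short_exact (full_subcategory C P) f g" using full_short_exact[OF assms(1-3)] a assms(5) by blast
  then show "Cod C f \<in> X" using assms(6) a unfolding closed_under_extensions_def full_subcategory_simps by blast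
qed

lemma full_closed_under_quotients:
  assumes "closed_under_quotients C P" "X \<subseteq> P" "closed_under_quotients (full_subcategory C P) X"
  shows "closed_under_quotients C X"
  using assms full_epi unfolding closed_under_quotients_def full_subcategory_simps by blast

lemma full_closed_under_subobjects:
  assumes "closed_under_subobjects C P" "X \<subseteq> P" "closed_under_subobjects (full_subcategory C P) X"
  shows "closed_under_subobjects C X"
  using assms full_mono unfolding closed_under_subobjects_def full_subcategory_simps by blast

end

section \<open>Invertible objects and the Picard group\<close>

context normal_symmetric_monoidal_closed
begin

lemma tens_iso:
  assumes "is_iso A f" "is_iso A g" shows "is_iso A (f \<boxdot> g)"
proof -
  obtain f' where f: "f \<in> Arr A" "f' \<in> Arr A" "Dom A f' = Cod A f" "Cod A f' = Dom A f"
    "f' \<cdot> f = Id A (Dom A f)" "f \<cdot> f' = Id A (Cod A f)" using assms(1) by (rule is_isoE)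
  obtain g' where g: "g \<in> Arr A" "g' \<in> Arr A" "Dom A g' = Cod A g" "Cod A g' = Dom A g"
    "g' \<cdot> g = Id A (Dom A g)" "g \<cdot> g' = Id A (Cod A g)" using assms(2) by (rule is_isoE)
  show ?thesis
    by (rule is_isoI[of _ "f' \<boxdot> g'"]) (use f g in \<open>auto simp: interchange\<close>)
qed

lemma tens_isomorphic:
  assumes "isomorphic A x x'" "isomorphic A y y'" shows "isomorphic A (x \<boxtimes> y) (x' \<boxtimes> y')"
proof -
  obtain f where f: "is_iso A f" "Dom A f = x" "Cod A f = x'" using assms(1) by (rule isomorphicE)
  obtain g where g: "is_iso A g" "Dom A g = y" "Cod A g = y'" using assms(2) by (rule isomorphicE)
  show ?thesis using isomorphicI[OF tens_iso[OF f(1) g(1)]] f g is_iso_def[of A] by simp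
qed

lemma Assoc_isomorphic: "x \<in> Obj A \<Longrightarrow> y \<in> Obj A \<Longrightarrow> z \<in> Obj A \<Longrightarrow> isomorphic A ((x \<boxtimes> y) \<boxtimes> z) (x \<boxtimes> (y \<boxtimes> z))"
  unfolding isomorphic_def using Assoc_in_homs[of x y z] by blast

lemma LUnit_isomorphic: "x \<in> Obj A \<Longrightarrow> isomorphic A (Unit A \<boxtimes> x) x"
  unfolding isomorphic_def using LUnit_in_homs[of x] by blast

lemma is_inverse_sym: "is_inverse A l p \<Longrightarrow> is_inverse A p l"
  unfolding is_inverse_def using isomorphic_trans[OF Swap_isomorphic[of p l]] by blast

text \<open>One such natural isomorphism for each order of \<open>l\<close> and \<open>p\<close> suffices; the triangle identities
  of an adjunction are not needed.\<close>

lemma inverse_natural: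
  assumes "is_inverse A l p"
  obtains \<alpha> where "\<And>x. x \<in> Obj A \<Longrightarrow> is_iso A (\<alpha> x) \<and> Dom A (\<alpha> x) = (x \<boxtimes> l) \<boxtimes> p \<and> Cod A (\<alpha> x) = x"
    "\<And>f. f \<in> Arr A \<Longrightarrow> \<alpha> (Cod A f) \<cdot> ((f \<boxdot> Id A l) \<boxdot> Id A p) = f \<cdot> \<alpha> (Dom A f)"
proof -
  have lp: "l \<in> Obj A" "p \<in> Obj A" using assms by (auto simp: is_inverse_def)
  obtain i where i: "is_iso A i" "Dom A i = l \<boxtimes> p" "Cod A i = Unit A"
    using assms unfolding is_inverse_def by (auto elim: isomorphicE)
  have iA: "i \<in> Arr A" using i by (simp add: is_iso_def)
  define \<alpha> where "\<alpha> x = RUnit A x \<cdot> ((Id A x \<boxdot> i) \<cdot> Assoc A x l p)" for x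
  have As: "Assoc A x l p \<in> Arr A" "Dom A (Assoc A x l p) = (x \<boxtimes> l) \<boxtimes> p" "Cod A (Assoc A x l p) = x \<boxtimes> (l \<boxtimes> p)"
    "is_iso A (Assoc A x l p)" if "x \<in> Obj A" for x using Assoc_in_homs[OF that lp] by (auto simp: hom_iff)
  have Ru: "RUnit A x \<in> Arr A" "Dom A (RUnit A x) = x \<boxtimes> Unit A" "Cod A (RUnit A x) = x"
    "is_iso A (RUnit A x)" if "x \<in> Obj A" for x using RUnit_in_homs[OF that] by (auto simp: hom_iff)
  have "is_iso A (\<alpha> x)" if x: "x \<in> Obj A" for x
    unfolding \<alpha>_def by (intro iso_Comp tens_iso Id_iso i) (use x As[OF x] Ru[OF x] i iA in auto)
  moreover have "Dom A (\<alpha> x) = (x \<boxtimes> l) \<boxtimes> p \<and> Cod A (\<alpha> x) = x" if x: "x \<in> Obj A" for x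
    unfolding \<alpha>_def using x As[OF x] Ru[OF x] i iA by auto
  moreover have "\<alpha> (Cod A f) \<cdot> ((f \<boxdot> Id A l) \<boxdot> Id A p) = f \<cdot> \<alpha> (Dom A f)" if f: "f \<in> Arr A" for f
  proof -
    let ?x = "Dom A f" and ?y = "Cod A f"
    have x: "?x \<in> Obj A" and y: "?y \<in> Obj A" using f by auto
    note D = As[OF x] As[OF y] Ru[OF x] Ru[OF y] i iA f lp
    have "\<alpha> ?y \<cdot> ((f \<boxdot> Id A l) \<boxdot> Id A p) = RUnit A ?y \<cdot> ((Id A ?y \<boxdot> i) \<cdot> (Assoc A ?y l p \<cdot> ((f \<boxdot> Id A l) \<boxdot> Id A p)))"
      unfolding \<alpha>_def using D by simp
    also have "Assoc A ?y l p \<cdot> ((f \<boxdot> Id A l) \<boxdot> Id A p) = (f \<boxdot> (Id A l \<boxdot> Id A p)) \<cdot> Assoc A ?x l p"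
      by (rule Assoc_natural) (use f lp in \<open>auto simp: hom_iff\<close>)
    also have "(Id A ?y \<boxdot> i) \<cdot> \<dots> = ((Id A ?y \<boxdot> i) \<cdot> (f \<boxdot> (Id A l \<boxdot> Id A p))) \<cdot> Assoc A ?x l p"
      by (rule assoc[symmetric]) (use D in auto)
    also have "(Id A ?y \<boxdot> i) \<cdot> (f \<boxdot> (Id A l \<boxdot> Id A p)) = f \<boxdot> i"
      using interchange[of f "Id A ?y" "Id A (l \<boxtimes> p)" i] D by simp
    also have "f \<boxdot> i = (f \<boxdot> Id A (Unit A)) \<cdot> (Id A ?x \<boxdot> i)"
      using interchange[of "Id A ?x" f i "Id A (Unit A)"] D by simp
    also have "RUnit A ?y \<cdot> (((f \<boxdot> Id A (Unit A)) \<cdot> (Id A ?x \<boxdot> i)) \<cdot> Assoc A ?x l p) =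
        (RUnit A ?y \<cdot> (f \<boxdot> Id A (Unit A))) \<cdot> ((Id A ?x \<boxdot> i) \<cdot> Assoc A ?x l p)"
      using D by simp
    also have "RUnit A ?y \<cdot> (f \<boxdot> Id A (Unit A)) = f \<cdot> RUnit A ?x"
      by (rule RUnit_natural) (use f in \<open>auto simp: hom_iff\<close>)
    also have "(f \<cdot> RUnit A ?x) \<cdot> ((Id A ?x \<boxdot> i) \<cdot> Assoc A ?x l p) = f \<cdot> \<alpha> ?x"
      unfolding \<alpha>_def using D by simp
    finally show ?thesis .
  qed
  ultimately show ?thesis using that by blast
qed

text \<open>Tensoring with \<open>p\<close> as well recovers \<open>f\<close> up to the natural
  isomorphism \<open>\<alpha>\<close>.\<close>

lemma tens_inverse_faithful:
  assumes "is_inverse A l p" "f \<in> Arr A" "g \<in> Arr A" "Dom A f = Dom A g" "Cod A f = Cod A g"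
    and e: "f \<boxdot> Id A l = g \<boxdot> Id A l"
  shows "f = g"
proof -
  obtain \<alpha> where a: "\<And>x. x \<in> Obj A \<Longrightarrow> is_iso A (\<alpha> x) \<and> Dom A (\<alpha> x) = (x \<boxtimes> l) \<boxtimes> p \<and> Cod A (\<alpha> x) = x"
    and n: "\<And>f. f \<in> Arr A \<Longrightarrow> \<alpha> (Cod A f) \<cdot> ((f \<boxdot> Id A l) \<boxdot> Id A p) = f \<cdot> \<alpha> (Dom A f)"
    using inverse_natural[OF assms(1)] by metis
  have i: "is_iso A (\<alpha> (Dom A g))" "Cod A (\<alpha> (Dom A g)) = Dom A g" using a assms by auto
  have "f \<cdot> \<alpha> (Dom A g) = g \<cdot> \<alpha> (Dom A g)" using n[OF assms(2)] n[OF assms(3)] assms by simp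
  then show ?thesis by (rule epi_cancel[OF iso_epi[OF i(1)]]) (use i assms in auto)
qed

lemma tens_inverse_full:
  assumes lp: "is_inverse A l p" and yz: "y \<in> Obj A" "z \<in> Obj A" and F: "F \<in> Arr A" "Dom A F = y \<boxtimes> l" "Cod A F = z \<boxtimes> l"
  obtains g where "g \<in> Arr A" "Dom A g = y" "Cod A g = z" "g \<boxdot> Id A l = F"
proof -
  have O: "l \<in> Obj A" "p \<in> Obj A" using lp by (auto simp: is_inverse_def)
  obtain \<alpha> where a: "\<And>x. x \<in> Obj A \<Longrightarrow> is_iso A (\<alpha> x) \<and> Dom A (\<alpha> x) = (x \<boxtimes> l) \<boxtimes> p \<and> Cod A (\<alpha> x) = x"
    and n: "\<And>f. f \<in> Arr A \<Longrightarrow> \<alpha> (Cod A f) \<cdot> ((f \<boxdot> Id A l) \<boxdot> Id A p) = f \<cdot> \<alpha> (Dom A f)"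
    using inverse_natural[OF lp] by metis
  have ay: "is_iso A (\<alpha> y)" "Dom A (\<alpha> y) = (y \<boxtimes> l) \<boxtimes> p" "Cod A (\<alpha> y) = y" using a yz by auto
  have az: "is_iso A (\<alpha> z)" "Dom A (\<alpha> z) = (z \<boxtimes> l) \<boxtimes> p" "Cod A (\<alpha> z) = z" "\<alpha> z \<in> Arr A"
    using a yz iso_Arr by auto
  obtain b where b: "\<alpha> y \<in> Arr A" "b \<in> Arr A" "Dom A b = Cod A (\<alpha> y)" "Cod A b = Dom A (\<alpha> y)"
    "b \<cdot> \<alpha> y = Id A (Dom A (\<alpha> y))" "\<alpha> y \<cdot> b = Id A (Cod A (\<alpha> y))" using ay(1) by (rule is_isoE)
  \<comment> \<open>The candidate is \<open>F \<boxdot> Id A p\<close> conjugated by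
    \<open>\<alpha>\<close>. By naturality it agrees with \<open>F\<close> after tensoring with
    \<open>l\<close> and \<open>p\<close>; faithfulness of tensoring with \<open>p\<close> then
    removes the \<open>p\<close>.\<close>
  define g where "g = (\<alpha> z \<cdot> (F \<boxdot> Id A p)) \<cdot> b"
  have g: "g \<in> Arr A" "Dom A g = y" "Cod A g = z" unfolding g_def using b ay az F O yz by auto
  have "\<alpha> z \<cdot> ((g \<boxdot> Id A l) \<boxdot> Id A p) = g \<cdot> \<alpha> y" using n[OF g(1)] g by simp
  also have "\<dots> = (\<alpha> z \<cdot> (F \<boxdot> Id A p)) \<cdot> (b \<cdot> \<alpha> y)" unfolding g_def by (rule assoc) (use b ay az F O yz in auto)
  also have "\<dots> = \<alpha> z \<cdot> (F \<boxdot> Id A p)" unfolding b(5) using b ay az F O yz by simp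
  finally have "(g \<boxdot> Id A l) \<boxdot> Id A p = F \<boxdot> Id A p"
    by (rule mono_cancel[OF iso_mono[OF az(1)]]) (use g ay az F O yz in auto)
  then have "g \<boxdot> Id A l = F"
    by (intro tens_inverse_faithful[OF is_inverse_sym[OF lp], of "g \<boxdot> Id A l" F]) (use g F O in auto)
  then show ?thesis using that g by blast
qed

text \<open>Tensoring an equation between composites with \<open>m \<boxdot> Id A p\<close> by
  \<open>l\<close> and transporting it along \<open>\<alpha>\<close> gives an equation between
  composites with \<open>m\<close>.\<close>

lemma tens_inverse_mono:
  assumes pl: "is_inverse A p l" and m: "mono_arr A m" shows "mono_arr A (m \<boxdot> Id A p)"
  unfolding mono_arr_def
proof (intro conjI ballI allI impI)
  have O: "l \<in> Obj A" "p \<in> Obj A" using pl by (auto simp: is_inverse_def)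
  then show "m \<boxdot> Id A p \<in> Arr A" using m by simp
  obtain \<alpha> where a: "\<And>x. x \<in> Obj A \<Longrightarrow> is_iso A (\<alpha> x) \<and> Dom A (\<alpha> x) = (x \<boxtimes> p) \<boxtimes> l \<and> Cod A (\<alpha> x) = x"
    and n: "\<And>f. f \<in> Arr A \<Longrightarrow> \<alpha> (Cod A f) \<cdot> ((f \<boxdot> Id A p) \<boxdot> Id A l) = f \<cdot> \<alpha> (Dom A f)"
    using inverse_natural[OF pl] by metis
  fix w u v assume "u \<in> homs A w (Dom A (m \<boxdot> Id A p))" "v \<in> homs A w (Dom A (m \<boxdot> Id A p))"
    and e: "(m \<boxdot> Id A p) \<cdot> u = (m \<boxdot> Id A p) \<cdot> v"
  then have D: "u \<in> Arr A" "v \<in> Arr A" "Dom A u = w" "Dom A v = w" "Cod A u = Dom A m \<boxtimes> p" "Cod A v = Dom A m \<boxtimes> p"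
    using m O by (auto simp: hom_iff)
  have ad: "\<alpha> (Dom A m) \<in> Arr A" "Dom A (\<alpha> (Dom A m)) = (Dom A m \<boxtimes> p) \<boxtimes> l" "Cod A (\<alpha> (Dom A m)) = Dom A m"
    "is_iso A (\<alpha> (Dom A m))"
    "\<alpha> (Cod A m) \<in> Arr A" "Dom A (\<alpha> (Cod A m)) = (Cod A m \<boxtimes> p) \<boxtimes> l" "Cod A (\<alpha> (Cod A m)) = Cod A m"
    using a[of "Dom A m"] a[of "Cod A m"] m iso_Arr by auto
  have nat: "m \<cdot> (\<alpha> (Dom A m) \<cdot> (u \<boxdot> Id A l)) = \<alpha> (Cod A m) \<cdot> (((m \<boxdot> Id A p) \<cdot> u) \<boxdot> Id A l)"
    if u: "u \<in> Arr A" "Cod A u = Dom A m \<boxtimes> p" for u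
  proof -
    have "m \<cdot> (\<alpha> (Dom A m) \<cdot> (u \<boxdot> Id A l)) = (\<alpha> (Cod A m) \<cdot> ((m \<boxdot> Id A p) \<boxdot> Id A l)) \<cdot> (u \<boxdot> Id A l)"
      by (rule reassoc) (use n[of m] ad u m O in auto)
    also have "\<dots> = \<alpha> (Cod A m) \<cdot> (((m \<boxdot> Id A p) \<boxdot> Id A l) \<cdot> (u \<boxdot> Id A l))"
      by (rule assoc) (use ad u m O in auto)
    also have "((m \<boxdot> Id A p) \<boxdot> Id A l) \<cdot> (u \<boxdot> Id A l) = ((m \<boxdot> Id A p) \<cdot> u) \<boxdot> Id A l"
      by (rule tens_Comp) (use u m O in auto)
    finally show ?thesis .
  qed
  have "m \<cdot> (\<alpha> (Dom A m) \<cdot> (u \<boxdot> Id A l)) = m \<cdot> (\<alpha> (Dom A m) \<cdot> (v \<boxdot> Id A l))"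
    using nat[OF D(1,5)] nat[OF D(2,6)] e by simp
  then have "\<alpha> (Dom A m) \<cdot> (u \<boxdot> Id A l) = \<alpha> (Dom A m) \<cdot> (v \<boxdot> Id A l)"
    by (rule mono_cancel[OF m]) (use D ad O in auto)
  then have "u \<boxdot> Id A l = v \<boxdot> Id A l"
    by (rule mono_cancel[OF iso_mono[OF ad(4)]]) (use D ad O in auto)
  then show "u = v"
    by (intro tens_inverse_faithful[OF is_inverse_sym[OF pl], of u v]) (use D in auto)
qed

text \<open>A factorization of the tensored morphisms descends by fullness and remains a
  factorization by faithfulness.\<close>

lemma tens_inverse_sub_le:
  assumes pl: "is_inverse A p l" and m: "m \<in> Arr A" and n: "mono_arr A n" and c: "Cod A m = Cod A n"
  shows "sub_le A (m \<boxdot> Id A p) (n \<boxdot> Id A p) \<longleftrightarrow> sub_le A m n"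
proof
  have O: "l \<in> Obj A" "p \<in> Obj A" using pl by (auto simp: is_inverse_def)
  have nA: "n \<in> Arr A" using n by simp
  assume "sub_le A m n"
  then obtain h where "h \<in> Arr A" "Dom A h = Dom A m" "Cod A h = Dom A n" "n \<cdot> h = m" by (rule sub_leE)
  then show "sub_le A (m \<boxdot> Id A p) (n \<boxdot> Id A p)" using m nA O
    by (intro sub_leI[of "h \<boxdot> Id A p"]) (auto simp: tens_Comp)
next
  have O: "l \<in> Obj A" "p \<in> Obj A" using pl by (auto simp: is_inverse_def)
  have nA: "n \<in> Arr A" using n by simp
  assume "sub_le A (m \<boxdot> Id A p) (n \<boxdot> Id A p)"
  then obtain h where h: "h \<in> Arr A" "Dom A h = Dom A (m \<boxdot> Id A p)" "Cod A h = Dom A (n \<boxdot> Id A p)"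
    "(n \<boxdot> Id A p) \<cdot> h = m \<boxdot> Id A p" by (rule sub_leE)
  have hD: "Dom A h = Dom A m \<boxtimes> p" "Cod A h = Dom A n \<boxtimes> p" using h m nA O by auto
  obtain g where g: "g \<in> Arr A" "Dom A g = Dom A m" "Cod A g = Dom A n" "g \<boxdot> Id A p = h"
    by (rule tens_inverse_full[OF pl _ _ h(1) hD]) (use m nA in auto)
  have "(n \<cdot> g) \<boxdot> Id A p = m \<boxdot> Id A p" using tens_Comp[of g n p] g nA O h by simp
  then have "n \<cdot> g = m"
    by (intro tens_inverse_faithful[OF pl, of "n \<cdot> g" m]) (use g m nA c in auto)
  then show "sub_le A m n" using g by (intro sub_leI[of g])
qed

text \<open>Tensoring with \<open>p\<close> embeds the subobjects of \<open>l\<close> into those of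
  \<open>l \<boxtimes> p\<close>, which is isomorphic to the unit.\<close>

lemma invertible_noetherian:
  assumes u: "noetherian_object A (Unit A)" and lp: "is_inverse A l p"
  shows "noetherian_object A l"
proof (rule noetherian_transfer)
  have O: "l \<in> Obj A" "p \<in> Obj A" using lp by (auto simp: is_inverse_def)
  note pl = is_inverse_sym[OF lp]
  have "l \<boxtimes> p \<in> {x. noetherian_object A x}"
    by (rule iso_closed[OF disjI1[OF noetherian_quotients] isomorphic_sym, of _ "Unit A"])
      (use lp u in \<open>auto simp: is_inverse_def\<close>)
  then show "noetherian_object A (l \<boxtimes> p)" by simp
  show "l \<in> Obj A" by fact
  fix m assume m: "mono_arr A m" "Cod A m = l"
  then show "mono_arr A (m \<boxdot> Id A p) \<and> Cod A (m \<boxdot> Id A p) = l \<boxtimes> p" using tens_inverse_mono[OF pl] O by simp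
  fix n assume n: "mono_arr A n" "Cod A n = l"
  show "sub_le A (m \<boxdot> Id A p) (n \<boxdot> Id A p) = sub_le A m n"
    by (rule tens_inverse_sub_le[OF pl]) (use m n in auto)
qed

text \<open>Tensoring with \<open>p\<close> and \<open>[l, -]\<close> are both right adjoint to
  tensoring with \<open>l\<close>. The isomorphism \<open>c\<close> is the transpose of
  \<open>\<beta> x\<close>. Its inverse \<open>d\<close> comes from fullness of tensoring with
  \<open>l\<close>, applied to the evaluation followed by the inverse of
  \<open>\<beta> x\<close>.\<close>

lemma IHom_inverse_isomorphic:
  assumes pl: "is_inverse A p l" and x: "x \<in> Obj A"
  shows "isomorphic A (x \<boxtimes> p) (IHom A l x)"
proof -
  have O: "l \<in> Obj A" "p \<in> Obj A" using pl by (auto simp: is_inverse_def)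
  note lp = is_inverse_sym[OF pl]
  obtain \<beta> where b: "\<And>x. x \<in> Obj A \<Longrightarrow> is_iso A (\<beta> x) \<and> Dom A (\<beta> x) = (x \<boxtimes> p) \<boxtimes> l \<and> Cod A (\<beta> x) = x"
    using inverse_natural[OF pl] by metis
  have bx: "is_iso A (\<beta> x)" "Dom A (\<beta> x) = (x \<boxtimes> p) \<boxtimes> l" "Cod A (\<beta> x) = x" using b[OF x] by auto
  obtain b' where b': "\<beta> x \<in> Arr A" "b' \<in> Arr A" "Dom A b' = Cod A (\<beta> x)" "Cod A b' = Dom A (\<beta> x)"
    "\<beta> x \<cdot> b' = Id A (Cod A (\<beta> x))" using bx(1) by (rule is_isoE)
  obtain c where c: "c \<in> Arr A" "Dom A c = x \<boxtimes> p" "Cod A c = IHom A l x" "Ev A l x \<cdot> (c \<boxdot> Id A l) = \<beta> x"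
    using curry_ex[OF O(1) _ b'(1) bx(2)] bx(3) O x by auto
  have B: "b' \<cdot> Ev A l x \<in> Arr A" "Dom A (b' \<cdot> Ev A l x) = IHom A l x \<boxtimes> l" "Cod A (b' \<cdot> Ev A l x) = (x \<boxtimes> p) \<boxtimes> l"
    using b' bx O x by auto
  obtain d where d: "d \<in> Arr A" "Dom A d = IHom A l x" "Cod A d = x \<boxtimes> p" "d \<boxdot> Id A l = b' \<cdot> Ev A l x"
    by (rule tens_inverse_full[OF lp _ _ B]) (use O x in auto)
  have bd: "\<beta> x \<cdot> (d \<boxdot> Id A l) = Ev A l x"
    unfolding d(4) using reassoc[OF b'(5), of "Ev A l x"] b' bx O x by simp
  have "c \<cdot> d = Id A (IHom A l x)"
    by (rule curry_unique[OF O(1) x]) (use c d O x curry_Comp[OF O(1) x c(1,3) d(1)] bd in auto)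
  moreover have "d \<cdot> c = Id A (x \<boxtimes> p)"
  proof (rule tens_inverse_faithful[OF lp])
    have "\<beta> x \<cdot> ((d \<cdot> c) \<boxdot> Id A l) = \<beta> x \<cdot> ((d \<boxdot> Id A l) \<cdot> (c \<boxdot> Id A l))" using tens_Comp[of c d l] c d O by simp
    also have "\<dots> = Ev A l x \<cdot> (c \<boxdot> Id A l)" by (rule reassoc[OF bd]) (use c d b' bx O in auto)
    also have "\<dots> = \<beta> x \<cdot> (Id A (x \<boxtimes> p) \<boxdot> Id A l)" using c b' bx O x by simp
    finally show "(d \<cdot> c) \<boxdot> Id A l = Id A (x \<boxtimes> p) \<boxdot> Id A l"
      by (rule mono_cancel[OF iso_mono[OF bx(1)]]) (use c d bx O x in auto)
  qed (use c d O x in auto)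
  ultimately have "is_iso A c" using is_isoI[of c d] c d by simp
  then show ?thesis using isomorphicI[of c] c by simp
qed

section \<open>Closure of the class of objects \<open>M\<close> with \<open>M \<boxtimes> x\<close>
  or \<open>[M, x]\<close> in \<open>X\<close>\<close>

lemma tens_closed:
  assumes X: "closed_under_quotients A X" "closed_under_extensions A X" and x: "x \<in> Obj A"
  shows "closed_under_quotients A {M \<in> Obj A. M \<boxtimes> x \<in> X}" "closed_under_extensions A {M \<in> Obj A. M \<boxtimes> x \<in> X}"
proof -
  show "closed_under_quotients A {M \<in> Obj A. M \<boxtimes> x \<in> X}"
    unfolding closed_under_quotients_def
  proof (intro allI impI)
    fix e assume e: "epi_arr A e \<and> Dom A e \<in> {M \<in> Obj A. M \<boxtimes> x \<in> X}"
    then have "epi_arr A (e \<boxdot> Id A x)" "Dom A (e \<boxdot> Id A x) \<in> X" using tens_epi x by auto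
    then have "Cod A (e \<boxdot> Id A x) \<in> X" using X(1) unfolding closed_under_quotients_def by blast
    then show "Cod A e \<in> {M \<in> Obj A. M \<boxtimes> x \<in> X}" using e x by simp
  qed
  show "closed_under_extensions A {M \<in> Obj A. M \<boxtimes> x \<in> X}"
    unfolding closed_under_extensions_def
  proof (intro allI impI)
    fix f g assume a: "short_exact A f g \<and> Dom A f \<in> {M \<in> Obj A. M \<boxtimes> x \<in> X} \<and> Cod A g \<in> {M \<in> Obj A. M \<boxtimes> x \<in> X}"
    then have g: "is_cokernel A g f" by (simp add: short_exact_def)
    note gD = is_cokernelD[OF g]
    have "Cod A (f \<boxdot> Id A x) \<in> X"
      by (rule right_exact_closed[OF X tens_cokernel[OF g x]]) (use a gD x in auto)
    then show "Cod A f \<in> {M \<in> Obj A. M \<boxtimes> x \<in> X}" using gD x by simp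
  qed
qed

lemma IHom_closed:
  assumes X: "closed_under_subobjects A X" "closed_under_extensions A X" and x: "x \<in> Obj A"
  shows "closed_under_quotients A {M \<in> Obj A. IHom A M x \<in> X}" "closed_under_extensions A {M \<in> Obj A. IHom A M x \<in> X}"
proof -
  show "closed_under_quotients A {M \<in> Obj A. IHom A M x \<in> X}"
    unfolding closed_under_quotients_def
  proof (intro allI impI)
    fix e assume e: "epi_arr A e \<and> Dom A e \<in> {M \<in> Obj A. IHom A M x \<in> X}"
    then obtain F where F: "mono_arr A F" "Dom A F = IHom A (Cod A e) x" "Cod A F = IHom A (Dom A e) x"
      using IHom_epi_mono[of e x] x by blast
    then have "Dom A F \<in> X" using X(1) e unfolding closed_under_subobjects_def by (metis CollectD)
    then show "Cod A e \<in> {M \<in> Obj A. IHom A M x \<in> X}" using e F by simp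
  qed
  show "closed_under_extensions A {M \<in> Obj A. IHom A M x \<in> X}"
    unfolding closed_under_extensions_def
  proof (intro allI impI)
    fix f g assume a: "short_exact A f g \<and> Dom A f \<in> {M \<in> Obj A. IHom A M x \<in> X} \<and> Cod A g \<in> {M \<in> Obj A. IHom A M x \<in> X}"
    then have g: "is_cokernel A g f" by (simp add: short_exact_def)
    obtain Q F where Q: "is_kernel A Q F" "Dom A Q = IHom A (Cod A g) x" "Dom A F = IHom A (Cod A f) x" "Cod A F = IHom A (Dom A f) x"
      by (rule IHom_cokernel_kernel[OF g x])
    have "Dom A F \<in> X"
      by (rule left_exact_closed[OF X Q(1)]) (use a Q in auto)
    then show "Cod A f \<in> {M \<in> Obj A. IHom A M x \<in> X}" using Q is_cokernelD[OF g] by simp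
  qed
qed

section \<open>The Picard group and its subgroups\<close>

lemma iso_class_eq_iff: "x \<in> Obj A \<Longrightarrow> y \<in> Obj A \<Longrightarrow> iso_class A x = iso_class A y \<longleftrightarrow> isomorphic A x y"
  unfolding iso_class_def using isomorphic_refl isomorphic_sym isomorphic_trans by blast

lemma Pic_mult:
  assumes "x \<in> Obj A" "y \<in> Obj A"
  shows "iso_class A x \<otimes>\<^bsub>Pic A\<^esub> iso_class A y = iso_class A (x \<boxtimes> y)"
proof -
  \<comment> \<open>The union that defines the product runs over nonempty classes, and all its
    members coincide.\<close>
  have "iso_class A (l \<boxtimes> m) = iso_class A (x \<boxtimes> y)" if "l \<in> iso_class A x" "m \<in> iso_class A y" for l m
    using that assms tens_isomorphic[of x l y m] iso_class_eq_iff[of "x \<boxtimes> y" "l \<boxtimes> m"] by (auto simp: iso_class_def)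
  moreover have "x \<in> iso_class A x" "y \<in> iso_class A y" using assms isomorphic_refl by (auto simp: iso_class_def)
  ultimately have "(\<Union>l \<in> iso_class A x. \<Union>m \<in> iso_class A y. iso_class A (l \<boxtimes> m)) = iso_class A (x \<boxtimes> y)" by blast
  then show ?thesis by (simp add: Pic_def)
qed

lemma Pic_carrier: "c \<in> carrier (Pic A) \<longleftrightarrow> (\<exists>l p. is_inverse A l p \<and> c = iso_class A l)"
  by (auto simp: Pic_def invertible_def)

lemma Pic_one: "\<one>\<^bsub>Pic A\<^esub> = iso_class A (Unit A)"
  by (simp add: Pic_def)

lemma is_inverse_Unit: "is_inverse A (Unit A) (Unit A)"
  by (simp add: is_inverse_def LUnit_isomorphic)

lemma is_inverse_Tens:
  assumes l: "is_inverse A l l'" and m: "is_inverse A m m'"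
  shows "is_inverse A (l \<boxtimes> m) (m' \<boxtimes> l')"
proof -
  have O [simp]: "l \<in> Obj A" "l' \<in> Obj A" "m \<in> Obj A" "m' \<in> Obj A" using l m by (auto simp: is_inverse_def)
  have "isomorphic A ((l \<boxtimes> m) \<boxtimes> (m' \<boxtimes> l')) (l \<boxtimes> (m \<boxtimes> (m' \<boxtimes> l')))" by (rule Assoc_isomorphic) auto
  moreover have "isomorphic A (m \<boxtimes> (m' \<boxtimes> l')) ((m \<boxtimes> m') \<boxtimes> l')" by (rule isomorphic_sym, rule Assoc_isomorphic) auto
  moreover have "isomorphic A ((m \<boxtimes> m') \<boxtimes> l') (Unit A \<boxtimes> l')"
    using m by (intro tens_isomorphic isomorphic_refl) (auto simp: is_inverse_def)
  moreover have "isomorphic A (Unit A \<boxtimes> l') l'" by (rule LUnit_isomorphic) simp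
  ultimately have "isomorphic A ((l \<boxtimes> m) \<boxtimes> (m' \<boxtimes> l')) (l \<boxtimes> l')"
    by (meson isomorphic_trans tens_isomorphic isomorphic_refl O)
  then show ?thesis using l isomorphic_trans unfolding is_inverse_def by (auto intro: isomorphic_trans)
qed

lemma Pic_group: "group (Pic A)"
proof (rule groupI)
  fix x y z assume "x \<in> carrier (Pic A)" "y \<in> carrier (Pic A)" "z \<in> carrier (Pic A)"
  then obtain l l' m m' n n' where lmn: "is_inverse A l l'" "x = iso_class A l" "is_inverse A m m'" "y = iso_class A m"
     "is_inverse A n n'" "z = iso_class A n" unfolding Pic_carrier by blast
  then have O: "l \<in> Obj A" "m \<in> Obj A" "n \<in> Obj A" by (auto simp: is_inverse_def)
  show "x \<otimes>\<^bsub>Pic A\<^esub> y \<otimes>\<^bsub>Pic A\<^esub> z = x \<otimes>\<^bsub>Pic A\<^esub> (y \<otimes>\<^bsub>Pic A\<^esub> z)"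
    unfolding lmn using O by (simp add: Pic_mult iso_class_eq_iff Assoc_isomorphic)
next
  fix x y assume "x \<in> carrier (Pic A)" "y \<in> carrier (Pic A)"
  then obtain l l' m m' where lm: "is_inverse A l l'" "x = iso_class A l" "is_inverse A m m'" "y = iso_class A m"
    unfolding Pic_carrier by blast
  then have O: "l \<in> Obj A" "m \<in> Obj A" by (auto simp: is_inverse_def)
  show "x \<otimes>\<^bsub>Pic A\<^esub> y \<in> carrier (Pic A)"
    unfolding lm Pic_mult[OF O] Pic_carrier using is_inverse_Tens[OF lm(1,3)] by blast
next
  show "\<one>\<^bsub>Pic A\<^esub> \<in> carrier (Pic A)" unfolding Pic_one Pic_carrier using is_inverse_Unit by blast
next
  fix x assume "x \<in> carrier (Pic A)"
  then obtain l l' where l: "is_inverse A l l'" "x = iso_class A l" unfolding Pic_carrier by blast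
  then have O: "l \<in> Obj A" "l' \<in> Obj A" by (auto simp: is_inverse_def)
  show "\<one>\<^bsub>Pic A\<^esub> \<otimes>\<^bsub>Pic A\<^esub> x = x"
    unfolding l Pic_one using O by (simp add: Pic_mult iso_class_eq_iff LUnit_isomorphic)
  have "iso_class A l' \<in> carrier (Pic A)" unfolding Pic_carrier using is_inverse_sym[OF l(1)] by blast
  moreover have "iso_class A l' \<otimes>\<^bsub>Pic A\<^esub> x = \<one>\<^bsub>Pic A\<^esub>"
    unfolding l Pic_one using O is_inverse_sym[OF l(1)] by (simp add: Pic_mult iso_class_eq_iff is_inverse_def)
  ultimately show "\<exists>y\<in>carrier (Pic A). y \<otimes>\<^bsub>Pic A\<^esub> x = \<one>\<^bsub>Pic A\<^esub>" by blast
qed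

lemma Pic_subgroup_subgroup:
  assumes "\<forall>l \<in> L. invertible A l" shows "subgroup (Pic_subgroup A L) (Pic A)"
  unfolding Pic_subgroup_def
  by (rule group.generate_is_subgroup[OF Pic_group]) (use assms in \<open>auto simp: Pic_def\<close>)

text \<open>\<open>l\<close> is at first only isomorphic to an invertible object \<open>k\<close>;
  an inverse of \<open>k\<close> is then one of \<open>l\<close>.\<close>

lemma subgroup_invertible:
  assumes "subgroup G (Pic A)" "l \<in> Obj A" "iso_class A l \<in> G"
  obtains p where "is_inverse A l p"
proof -
  have "iso_class A l \<in> carrier (Pic A)" using assms subgroup.subset by blast
  then obtain k p where k: "is_inverse A k p" "iso_class A l = iso_class A k" unfolding Pic_carrier by blast
  have O: "k \<in> Obj A" "p \<in> Obj A" using k by (auto simp: is_inverse_def)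
  have "isomorphic A l k" using k iso_class_eq_iff O assms by blast
  then have "isomorphic A (l \<boxtimes> p) (k \<boxtimes> p)" using tens_isomorphic isomorphic_refl O by blast
  then have "is_inverse A l p" using k O assms isomorphic_trans unfolding is_inverse_def by blast
  then show ?thesis using that by blast
qed

lemma subgroup_inverse:
  assumes "subgroup G (Pic A)" "is_inverse A l p" "iso_class A l \<in> G"
  shows "iso_class A p \<in> G"
proof -
  have O: "l \<in> Obj A" "p \<in> Obj A" using assms by (auto simp: is_inverse_def)
  note pl = is_inverse_sym[OF assms(2)]
  have "inv\<^bsub>Pic A\<^esub> iso_class A l = iso_class A p"
  proof (rule group.inv_equality[OF Pic_group])
    show "iso_class A p \<otimes>\<^bsub>Pic A\<^esub> iso_class A l = \<one>\<^bsub>Pic A\<^esub>"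
      unfolding Pic_one using O pl by (simp add: Pic_mult iso_class_eq_iff is_inverse_def)
    show "iso_class A l \<in> carrier (Pic A)" "iso_class A p \<in> carrier (Pic A)"
      unfolding Pic_carrier using assms(2) pl by blast+
  qed
  then show ?thesis using subgroup.m_inv_closed[OF assms(1,3)] by simp
qed

lemma subgroup_tensor_power:
  assumes "subgroup G (Pic A)" "l \<in> Obj A" "iso_class A l \<in> G"
  shows "tensor_power A l n \<in> Obj A \<and> iso_class A (tensor_power A l n) \<in> G"
proof (induction n)
  case 0 then show ?case using subgroup.one_closed[OF assms(1)] by (simp add: Pic_one)
next
  case (Suc n)
  then show ?case using subgroup.m_closed[OF assms(1), of "iso_class A (tensor_power A l n)" "iso_class A l"] assms
    by (simp add: Pic_mult)
qed

lemma tensor_powers_subgroup: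
  assumes L: "\<forall>l \<in> L. invertible A l" and s: "s \<in> tensor_powers A L"
  shows "s \<in> Obj A \<and> iso_class A s \<in> Pic_subgroup A L"
proof -
  note G = Pic_subgroup_subgroup[OF L]
  obtain l n where l: "l \<in> L" "s = tensor_zpower A l n" using s unfolding tensor_powers_def by blast
  \<comment> \<open>This is the very inverse chosen in \<open>tensor_zpower\<close>, so negative
    powers of \<open>l\<close> unfold to powers of \<open>p\<close>.\<close>
  define p where "p = (SOME m. is_inverse A l m)"
  have p: "is_inverse A l p" unfolding p_def using L l by (auto simp: invertible_def intro: someI_ex)
  have O: "l \<in> Obj A" "p \<in> Obj A" using p by (auto simp: is_inverse_def)
  have lG: "iso_class A l \<in> Pic_subgroup A L" unfolding Pic_subgroup_def using l by (intro generate.incl) auto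
  have pG: "iso_class A p \<in> Pic_subgroup A L" by (rule subgroup_inverse[OF G p lG])
  show ?thesis unfolding l(2) tensor_zpower_def p_def[symmetric]
    using subgroup_tensor_power[OF G O(1) lG] subgroup_tensor_power[OF G O(2) pG] by simp
qed

lemma filtered_tens:
  assumes X: "closed_under_quotients A X" "closed_under_extensions A X" "X \<subseteq> Obj A"
    and z: "z \<in> X" "is_zero A z" and L: "\<forall>l \<in> L. invertible A l"
    and G: "G_closed A (Pic_subgroup A L) X" and x: "x \<in> X" and s: "filtered_object A (tensor_powers A L) s"
  shows "s \<in> {M \<in> Obj A. M \<boxtimes> x \<in> X}"
proof -
  have xO: "x \<in> Obj A" using x X by blast
  show ?thesis
  proof (rule filtered_in[OF tens_closed[OF X(1,2) xO] _ _ s])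
  show "z' \<in> {M \<in> Obj A. M \<boxtimes> x \<in> X}" if z': "is_zero A z'" for z'
    using iso_closed[OF disjI1[OF X(1)] zero_isomorphic[OF z(2) tens_is_zero[OF z' xO]] z(1)] is_zero_Obj[OF z'] by simp
  show "tensor_powers A L \<subseteq> {M \<in> Obj A. M \<boxtimes> x \<in> X}"
  proof
    fix t assume "t \<in> tensor_powers A L"
    then have t: "t \<in> Obj A" "iso_class A t \<in> Pic_subgroup A L" using tensor_powers_subgroup[OF L] by auto
    then have "x \<boxtimes> t \<in> X" using G x unfolding G_closed_def by blast
    then have "t \<boxtimes> x \<in> X" using iso_closed[OF disjI1[OF X(1)] Swap_isomorphic[OF xO t(1)]] by blast
    then show "t \<in> {M \<in> Obj A. M \<boxtimes> x \<in> X}" using t by simp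
  qed
  qed
qed

lemma filtered_IHom:
  assumes X: "closed_under_subobjects A X" "closed_under_extensions A X" "X \<subseteq> Obj A"
    and z: "z \<in> X" "is_zero A z" and L: "\<forall>l \<in> L. invertible A l"
    and G: "G_closed A (Pic_subgroup A L) X" and x: "x \<in> X" and s: "filtered_object A (tensor_powers A L) s"
  shows "s \<in> {M \<in> Obj A. IHom A M x \<in> X}"
proof -
  have xO: "x \<in> Obj A" using x X by blast
  show ?thesis
  proof (rule filtered_in[OF IHom_closed[OF X(1,2) xO] _ _ s])
  show "z' \<in> {M \<in> Obj A. IHom A M x \<in> X}" if z': "is_zero A z'" for z'
    using iso_closed[OF disjI2[OF X(1)] zero_isomorphic[OF z(2) IHom_is_zero[OF z' xO]] z(1)] is_zero_Obj[OF z'] by simp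
  show "tensor_powers A L \<subseteq> {M \<in> Obj A. IHom A M x \<in> X}"
  proof
    fix t assume "t \<in> tensor_powers A L"
    then have t: "t \<in> Obj A" "iso_class A t \<in> Pic_subgroup A L" using tensor_powers_subgroup[OF L] by auto
    obtain p where p: "is_inverse A t p" by (rule subgroup_invertible[OF Pic_subgroup_subgroup[OF L] t])
    have "p \<in> Obj A" "iso_class A p \<in> Pic_subgroup A L"
      using p subgroup_inverse[OF Pic_subgroup_subgroup[OF L] p t(2)] by (auto simp: is_inverse_def)
    then have "x \<boxtimes> p \<in> X" using G x unfolding G_closed_def by blast
    then have "IHom A t x \<in> X"
      using iso_closed[OF disjI2[OF X(1)] IHom_inverse_isomorphic[OF is_inverse_sym[OF p] xO]] by blast
    then show "t \<in> {M \<in> Obj A. IHom A M x \<in> X}" using t by simp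
  qed
  qed
qed

text \<open>\<open>M\<close> is a quotient of the coproduct of the sources of all morphisms from
  \<open>S\<close> to \<open>M\<close>, and \<open>- \<boxtimes> x\<close> preserves both this
  coproduct and the epimorphism.\<close>

lemma localizing_tens:
  fixes \<kappa> :: "'u rel"
  assumes \<kappa>: "inaccessible \<kappa>" "locally_small \<kappa> A" "has_small_coproducts \<kappa> A"
    and X: "closed_under_quotients A X" "closed_under_coproducts \<kappa> A X"
    and S: "small \<kappa> S" "generating A S" "\<And>s. s \<in> S \<Longrightarrow> s \<boxtimes> x \<in> X" and x: "x \<in> Obj A" and M: "M \<in> Obj A"
  shows "M \<boxtimes> x \<in> X"
proof -
  have SO: "S \<subseteq> Obj A" using S(2) by (simp add: generating_def)
  define H where "H = (\<Union>s\<in>S. homs A s M)"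
  have smH: "small \<kappa> H" unfolding H_def
    by (rule small_UNION[OF \<kappa>(1) S(1)]) (use SO M \<kappa>(2) in \<open>auto simp: locally_small_def\<close>)
  obtain enc :: "'a \<Rightarrow> 'u" where enc: "inj_on enc H" using small_encode[OF \<kappa>(1) smH] .
  define I where "I = enc ` H"
  define dec where "dec = inv_into H enc"
  have dec: "dec i \<in> Arr A" "Dom A (dec i) \<in> S" "Cod A (dec i) = M" if "i \<in> I" for i
    using inv_into_into[of i enc H] that unfolding I_def dec_def H_def by (auto simp: hom_iff)
  have smI: "small \<kappa> I" unfolding I_def by (rule small_image[OF smH])
  have "(\<lambda>i. Dom A (dec i)) ` I \<subseteq> Obj A" using dec by auto
  then obtain c \<iota> where c: "is_coproduct A I (\<lambda>i. Dom A (dec i)) c \<iota>"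
    using \<kappa>(3) smI unfolding has_small_coproducts_def by blast
  have "(\<lambda>i. Dom A (dec i) \<boxtimes> x) ` I \<subseteq> X" using dec S(3) by auto
  then have cx: "c \<boxtimes> x \<in> X"
    using X(2) tens_coproduct[OF c x] smI unfolding closed_under_coproducts_def by blast
  have cD: "c \<in> Obj A" "\<And>i. i \<in> I \<Longrightarrow> \<iota> i \<in> homs A (Dom A (dec i)) c" using c by (auto simp: is_coproduct_def)
  have "\<exists>!h. h \<in> homs A c M \<and> (\<forall>i \<in> I. h \<cdot> \<iota> i = dec i)"
    using c M dec unfolding is_coproduct_def by (auto simp: hom_iff)
  then obtain h where h: "h \<in> homs A c M" "\<And>i. i \<in> I \<Longrightarrow> h \<cdot> \<iota> i = dec i" by blast
  have hD: "h \<in> Arr A" "Dom A h = c" "Cod A h = M" using h by (auto simp: hom_iff)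
  \<comment> \<open>Every morphism from \<open>S\<close> to \<open>M\<close> is a component of
    \<open>h\<close>. Hence morphisms that agree after \<open>h\<close> agree on all of
    \<open>S\<close>, which generates.\<close>
  have "epi_arr A h" unfolding epi_arr_def
  proof (intro conjI ballI allI impI)
    fix w u v assume "u \<in> homs A (Cod A h) w" "v \<in> homs A (Cod A h) w" and e: "u \<cdot> h = v \<cdot> h"
    then have D: "u \<in> homs A M w" "v \<in> homs A M w" using hD by auto
    have "u \<cdot> g = v \<cdot> g" if g: "s \<in> S" "g \<in> homs A s M" for s g
    proof -
      define i where "i = enc g"
      have gH: "g \<in> H" using g by (auto simp: H_def)
      then have i: "i \<in> I" "dec i = g" using enc by (auto simp: i_def I_def dec_def)
      have io: "\<iota> i \<in> Arr A" "Cod A (\<iota> i) = c" using cD(2)[OF i(1)] by (auto simp: hom_iff)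
      have "u \<cdot> (h \<cdot> \<iota> i) = (v \<cdot> h) \<cdot> \<iota> i" by (rule reassoc[OF e]) (use D hD io in \<open>auto simp: hom_iff\<close>)
      also have "\<dots> = v \<cdot> (h \<cdot> \<iota> i)" by (rule assoc) (use D hD io in \<open>auto simp: hom_iff\<close>)
      finally show ?thesis using h(2)[OF i(1)] i by simp
    qed
    then show "u = v" using S(2) D unfolding generating_def by blast
  qed (use hD in auto)
  then have "epi_arr A (h \<boxdot> Id A x)" by (rule tens_epi[OF _ x])
  moreover have "Dom A (h \<boxdot> Id A x) = c \<boxtimes> x" "Cod A (h \<boxdot> Id A x) = M \<boxtimes> x" using hD x by auto
  ultimately show ?thesis using X(1) cx unfolding closed_under_quotients_def by metis
qed

end

theorem lemma5p1:
  fixes \<kappa> :: "'u rel" and A :: "('o, 'a) smc_cat" and L :: "'o set"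
  assumes "inaccessible \<kappa>"
    and "grothendieck_cosmos \<kappa> A"
    and "locally_noetherian \<kappa> A"
    and "finitely_presented \<kappa> A (Unit A)"
    and "small \<kappa> L" and "\<forall>l \<in> L. invertible A l"
    and "\<exists>S. small \<kappa> S \<and> (\<forall>s \<in> S. filtered_object A (tensor_powers A L) s) \<and> generating A S"
  shows "(\<forall>X. localizing_subcategory \<kappa> A X \<longrightarrow>
            (tensor_ideal A X \<longleftrightarrow> G_closed A (Pic_subgroup A L) X)) \<and>
         (\<forall>X. torsion_class (noeth A) X \<longrightarrow>
            (tensor_ideal (noeth A) X \<longleftrightarrow> G_closed A (Pic_subgroup A L) X)) \<and>
         (\<forall>X. torsion_free_class (noeth A) X \<longrightarrow>
            (Hom_ideal (noeth A) X \<longleftrightarrow> G_closed A (Pic_subgroup A L) X))"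
proof -
  have gr: "abelian A" "locally_small \<kappa> A" "has_small_coproducts \<kappa> A"
    using assms(2) by (auto simp: grothendieck_cosmos_def grothendieck_category_def)
  interpret symmetric_monoidal_closed A using assms(2) by (simp add: grothendieck_cosmos_def)
  interpret normal_category A by (rule abelian_normal[OF gr(1)])
  interpret normal_symmetric_monoidal_closed A by unfold_locales
  note L = assms(6)
  obtain S where S: "small \<kappa> S" "\<And>s. s \<in> S \<Longrightarrow> filtered_object A (tensor_powers A L) s" "generating A S"
    using assms(7) by blast
  let ?N = "{x. noetherian_object A x}"
  let ?G = "Pic_subgroup A L"
  note G = Pic_subgroup_subgroup[OF L]
  have unit: "noetherian_object A (Unit A)"
    by (rule finitely_presented_noetherian[OF assms(1) gr(2) assms(3,4)])
  \<comment> \<open>Objects with class in the group are noetherian, so the ideal conditions over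
    \<open>noeth A\<close> apply to them.\<close>
  have inv: "l \<in> ?N" if "l \<in> Obj A" "iso_class A l \<in> ?G" for l
    using subgroup_invertible[OF G that] invertible_noetherian[OF unit] by auto
  have NO: "?N \<subseteq> Obj A" by (auto simp: noetherian_object_def)
  obtain o' where o': "is_zero A o'" using zero_ex by blast
  have oN: "o' \<in> ?N" using zero_noetherian[OF o'] by simp
  have swap: "x \<boxtimes>\<^bsub>A\<^esub> M \<in> X" if "closed_under_quotients A X" "M \<boxtimes>\<^bsub>A\<^esub> x \<in> X" "x \<in> Obj A" "M \<in> Obj A" for X x M
    using iso_closed[OF disjI1[OF that(1)] Swap_isomorphic[OF that(4,3)] that(2)] .
  have "tensor_ideal A X \<longleftrightarrow> G_closed A ?G X" if X: "localizing_subcategory \<kappa> A X" for X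
  proof
    assume "tensor_ideal A X"
    then show "G_closed A ?G X" by (auto simp: tensor_ideal_def G_closed_def)
  next
    assume G': "G_closed A ?G X"
    have X': "closed_under_quotients A X" "closed_under_extensions A X" "X \<subseteq> Obj A" "closed_under_coproducts \<kappa> A X"
      and "\<exists>z \<in> X. is_zero A z"
      using X by (auto simp: localizing_subcategory_def additive_subcategory_def)
    then obtain z where z: "z \<in> X" "is_zero A z" by blast
    show "tensor_ideal A X" unfolding tensor_ideal_def
    proof (intro ballI)
      fix x M assume x: "x \<in> X" and M: "M \<in> Obj A"
      have xO: "x \<in> Obj A" using x X' by blast
      have "M \<boxtimes>\<^bsub>A\<^esub> x \<in> X"
        by (rule localizing_tens[OF assms(1) gr(2,3) X'(1,4) S(1,3) _ xO M])
          (use filtered_tens[OF X'(1-3) z L G' x S(2)] in auto)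
      then show "x \<boxtimes>\<^bsub>A\<^esub> M \<in> X" by (rule swap[OF X'(1) _ xO M])
    qed
  qed
  moreover have "tensor_ideal (noeth A) X \<longleftrightarrow> G_closed A ?G X" if X: "torsion_class (noeth A) X" for X
  proof
    assume "tensor_ideal (noeth A) X"
    then show "G_closed A ?G X" using inv by (auto simp: tensor_ideal_def G_closed_def noeth_def)
  next
    assume G': "G_closed A ?G X"
    have XN: "X \<subseteq> ?N" and qe: "closed_under_quotients (full_subcategory A ?N) X" "closed_under_extensions (full_subcategory A ?N) X"
      and "\<exists>z \<in> X. is_zero (full_subcategory A ?N) z"
      using X by (auto simp: torsion_class_def additive_subcategory_def noeth_def)
    then obtain z where z: "z \<in> X" "is_zero A z" using full_is_zero[OF o' oN NO] by blast
    \<comment> \<open>Closure relative to \<open>noeth A\<close> becomes closure in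
      \<open>A\<close>, where the exactness results for tensoring are available.\<close>
    have X': "closed_under_quotients A X" "closed_under_extensions A X" "X \<subseteq> Obj A"
      using full_closed_under_quotients[OF noetherian_quotients XN qe(1)]
        full_closed_under_extensions[OF o' oN NO noetherian_extensions XN qe(2)] XN NO by auto
    show "tensor_ideal (noeth A) X" unfolding tensor_ideal_def
    proof (intro ballI)
      fix x M assume x: "x \<in> X" and "M \<in> Obj (noeth A)"
      then have M: "noetherian_object A M" by (simp add: noeth_def)
      have xO: "x \<in> Obj A" using x X' by blast
      have "M \<in> {M \<in> Obj A. M \<boxtimes>\<^bsub>A\<^esub> x \<in> X}"
      proof (rule noetherian_in[OF tens_closed[OF X'(1,2) xO] _ _ S(3) M])
        show "z' \<in> {M \<in> Obj A. M \<boxtimes>\<^bsub>A\<^esub> x \<in> X}" if z': "is_zero A z'" for z'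
          using iso_closed[OF disjI1[OF X'(1)] zero_isomorphic[OF z(2) tens_is_zero[OF z' xO]] z(1)] is_zero_Obj[OF z'] by simp
        show "S \<subseteq> {M \<in> Obj A. M \<boxtimes>\<^bsub>A\<^esub> x \<in> X}" using filtered_tens[OF X'(1-3) z L G' x S(2)] by blast
      qed
      then show "x \<boxtimes>\<^bsub>noeth A\<^esub> M \<in> X" using swap[OF X'(1) _ xO] by (simp add: noeth_def)
    qed
  qed
  moreover have "Hom_ideal (noeth A) X \<longleftrightarrow> G_closed A ?G X" if X: "torsion_free_class (noeth A) X" for X
  proof -
    have XN: "X \<subseteq> ?N" and qe: "closed_under_subobjects (full_subcategory A ?N) X" "closed_under_extensions (full_subcategory A ?N) X"
      and "\<exists>z \<in> X. is_zero (full_subcategory A ?N) z"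
      using X by (auto simp: torsion_free_class_def additive_subcategory_def noeth_def)
    then obtain z where z: "z \<in> X" "is_zero A z" using full_is_zero[OF o' oN NO] by blast
    have X': "closed_under_subobjects A X" "closed_under_extensions A X" "X \<subseteq> Obj A"
      using full_closed_under_subobjects[OF noetherian_subobjects XN qe(1)]
        full_closed_under_extensions[OF o' oN NO noetherian_extensions XN qe(2)] XN NO by auto
    show ?thesis
    proof
      assume H: "Hom_ideal (noeth A) X"
      show "G_closed A ?G X" unfolding G_closed_def
      proof (intro ballI impI)
        fix x l assume x: "x \<in> X" and l: "l \<in> Obj A" "iso_class A l \<in> ?G"
        have xO: "x \<in> Obj A" using x X' by blast
        \<comment> \<open>\<open>x \<boxtimes> l\<close> is isomorphic to \<open>[p, x]\<close> for
          an inverse \<open>p\<close> of \<open>l\<close>. The class of \<open>p\<close> lies in the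
          group too, so \<open>p\<close> is noetherian and the Hom ideal property applies to
          it.\<close>
        obtain p where p: "is_inverse A l p" by (rule subgroup_invertible[OF G l])
        have "p \<in> ?N" using inv[of p] subgroup_inverse[OF G p l(2)] p by (simp add: is_inverse_def)
        then have "IHom A p x \<in> X" using H x by (simp add: Hom_ideal_def noeth_def)
        then show "x \<boxtimes>\<^bsub>A\<^esub> l \<in> X"
          using iso_closed[OF disjI2[OF X'(1)] isomorphic_sym[OF IHom_inverse_isomorphic[OF p xO]]] by blast
      qed
    next
      assume G': "G_closed A ?G X"
      show "Hom_ideal (noeth A) X" unfolding Hom_ideal_def
      proof (intro ballI)
        fix x M assume x: "x \<in> X" and "M \<in> Obj (noeth A)"
        then have M: "noetherian_object A M" by (simp add: noeth_def)
        have xO: "x \<in> Obj A" using x X' by blast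
        have "M \<in> {M \<in> Obj A. IHom A M x \<in> X}"
        proof (rule noetherian_in[OF IHom_closed[OF X'(1,2) xO] _ _ S(3) M])
          show "z' \<in> {M \<in> Obj A. IHom A M x \<in> X}" if z': "is_zero A z'" for z'
            using iso_closed[OF disjI2[OF X'(1)] zero_isomorphic[OF z(2) IHom_is_zero[OF z' xO]] z(1)] is_zero_Obj[OF z'] by simp
          show "S \<subseteq> {M \<in> Obj A. IHom A M x \<in> X}" using filtered_IHom[OF X'(1-3) z L G' x S(2)] by blast
        qed
        then show "IHom (noeth A) M x \<in> X" by (simp add: noeth_def)
      qed
    qed
  qed
  ultimately show ?thesis by blast
qed

end
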